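(* Let $(M,g)$ be a smooth Riemannian manifold that is diffeomorphic to $\mathbb{R}^n$ and admits an action by isometries of a Bieberbach group $\Gamma$. Let $N$ be the Nash dimension of the quotient manifold $M/\Gamma$. Then there exists a $\Gamma$-equivariant isometric embedding $u:(M,g)\to\mathbb{R}^{N+n}$.
   Context: Everything is $C^\infty$-smooth. Euclidean spaces carry their standard flat metrics. An isometric embedding $u:(M,g)\to\mathbb{R}^D$ is a smooth embedding such that the pullback of the Euclidean metric under $u$ equals $g$. A Bieberbach group $\Gamma$ is a group isomorphic to a torsion-free discrete cocompact subgroup of the isometry group of a Euclidean space. Its action on $(M,g)$ is by isometries, free, properly discontinuous and cocompact, so that $M/\Gamma$ is a compact smooth manifold. A map $u:M\to\mathbb{R}^D$ is $\Gamma$-equivariant if there is an action of $\Gamma$ on the entire target space $\mathbb{R}^D$ by isometries such that $u(\gamma\cdot x)=\gamma\cdot u(x)$ for all $\gamma\in\Gamma$ and $x\in M$. The Nash dimension $N(X)$ of a smooth manifold $X$ is the smallest integer $N$ such that, for every Riemannian metric $h$ on $X$, the Riemannian manifold $(X,h)$ can be isometrically embedded into $\mathbb{R}^N$. *)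

theory Defs
  imports "HOL-Analysis.Analysis" "HOL-Algebra.Group_Action"
begin

section \<open>Smooth functions on open subsets of Euclidean space\<close>

text \<open>
  The dimension of the target of an embedding depends on the data (and is quantified over in the
  Nash dimension), so the Euclidean space of dimension \<open>n\<close> is \<^term>\<open>Euclidean_space n\<close>,
  whose points are the sequences of reals vanishing from index \<open>n\<close> on. The dimension 0 is allowed.
\<close>

definition partial_deriv :: "nat \<Rightarrow> ((nat \<Rightarrow> real) \<Rightarrow> real) \<Rightarrow> (nat \<Rightarrow> real) \<Rightarrow> real" where
  "partial_deriv i f x = deriv (\<lambda>t. f (x(i := t))) (x i)"

primrec Ck_on :: "nat \<Rightarrow> nat \<Rightarrow> (nat \<Rightarrow> real) set \<Rightarrow> ((nat \<Rightarrow> real) \<Rightarrow> real) \<Rightarrow> bool" where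
  "Ck_on n 0 U f \<longleftrightarrow> continuous_on U f"
| "Ck_on n (Suc k) U f \<longleftrightarrow> continuous_on U f \<and>
     (\<forall>i<n. (\<forall>x\<in>U. (\<lambda>t. f (x(i := t))) differentiable (at (x i))) \<and>
            Ck_on n k U (partial_deriv i f))"

definition smooth_fun_on :: "nat \<Rightarrow> (nat \<Rightarrow> real) set \<Rightarrow> ((nat \<Rightarrow> real) \<Rightarrow> real) \<Rightarrow> bool" where
  "smooth_fun_on n U f \<longleftrightarrow> (\<forall>k. Ck_on n k U f)"

definition smooth_vec_on ::
  "nat \<Rightarrow> nat \<Rightarrow> (nat \<Rightarrow> real) set \<Rightarrow> ((nat \<Rightarrow> real) \<Rightarrow> nat \<Rightarrow> real) \<Rightarrow> bool" where
  "smooth_vec_on n m U f \<longleftrightarrow> (\<forall>j<m. smooth_fun_on n U (\<lambda>x. f x j))"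

section \<open>Smooth manifolds and smooth maps\<close>

text \<open>
  A chart is a pair of its domain and its coordinate map. Atlases need not be maximal; the notions
  below do not change when an atlas is replaced by a compatible one.
\<close>

type_synonym 'a chart = "'a set \<times> ('a \<Rightarrow> nat \<Rightarrow> real)"

record 'a manifold =
  mtop :: "'a topology"
  mdim :: nat
  atlas :: "'a chart set"

abbreviation mpoints :: "'a manifold \<Rightarrow> 'a set" where
  "mpoints M \<equiv> topspace (mtop M)"

definition chart_inv :: "'a chart \<Rightarrow> (nat \<Rightarrow> real) \<Rightarrow> 'a" where
  "chart_inv c = inv_into (fst c) (snd c)"

definition local_rep ::
  "'a chart \<Rightarrow> 'b chart \<Rightarrow> ('a \<Rightarrow> 'b) \<Rightarrow> (nat \<Rightarrow> real) \<Rightarrow> nat \<Rightarrow> real" where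
  "local_rep c d f = snd d \<circ> f \<circ> chart_inv c"

definition local_dom :: "'a chart \<Rightarrow> 'b chart \<Rightarrow> ('a \<Rightarrow> 'b) \<Rightarrow> (nat \<Rightarrow> real) set" where
  "local_dom c d f = snd c ` {p \<in> fst c. f p \<in> fst d}"

definition smooth_manifold :: "'a manifold \<Rightarrow> bool" where
  "smooth_manifold M \<longleftrightarrow>
     Hausdorff_space (mtop M) \<and> second_countable (mtop M) \<and>
     (\<Union>c\<in>atlas M. fst c) = mpoints M \<and>
     (\<forall>c\<in>atlas M. openin (mtop M) (fst c) \<and>
        openin (Euclidean_space (mdim M)) (snd c ` fst c) \<and>
        homeomorphic_map (subtopology (mtop M) (fst c))
          (subtopology (Euclidean_space (mdim M)) (snd c ` fst c)) (snd c)) \<and>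
     (\<forall>c\<in>atlas M. \<forall>d\<in>atlas M.
        smooth_vec_on (mdim M) (mdim M) (local_dom c d (\<lambda>p. p)) (local_rep c d (\<lambda>p. p)))"

definition smooth_map :: "'a manifold \<Rightarrow> 'b manifold \<Rightarrow> ('a \<Rightarrow> 'b) \<Rightarrow> bool" where
  "smooth_map M M' f \<longleftrightarrow>
     continuous_map (mtop M) (mtop M') f \<and>
     (\<forall>c\<in>atlas M. \<forall>d\<in>atlas M'.
        smooth_vec_on (mdim M) (mdim M') (local_dom c d f) (local_rep c d f))"

definition diffeomorphism :: "'a manifold \<Rightarrow> 'b manifold \<Rightarrow> ('a \<Rightarrow> 'b) \<Rightarrow> bool" where
  "diffeomorphism M M' f \<longleftrightarrow>
     smooth_map M M' f \<and>
     (\<exists>h. smooth_map M' M h \<and> (\<forall>x\<in>mpoints M. h (f x) = x) \<and> (\<forall>y\<in>mpoints M'. f (h y) = y))"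

definition diffeomorphic :: "'a manifold \<Rightarrow> 'b manifold \<Rightarrow> bool" where
  "diffeomorphic M M' \<longleftrightarrow> (\<exists>f. diffeomorphism M M' f)"

text \<open>\<open>coord_jacobian c d f p k i\<close> is the derivative at \<open>p\<close> of the \<open>k\<close>-th coordinate of \<open>f\<close> (in the chart
  \<open>d\<close>) in the direction of the \<open>i\<close>-th coordinate of \<open>c\<close>.\<close>

definition coord_jacobian :: "'a chart \<Rightarrow> 'b chart \<Rightarrow> ('a \<Rightarrow> 'b) \<Rightarrow> 'a \<Rightarrow> nat \<Rightarrow> nat \<Rightarrow> real" where
  "coord_jacobian c d f p k i = partial_deriv i (\<lambda>x. local_rep c d f x k) (snd c p)"

definition immersion :: "'a manifold \<Rightarrow> 'b manifold \<Rightarrow> ('a \<Rightarrow> 'b) \<Rightarrow> bool" where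
  "immersion M M' f \<longleftrightarrow>
     smooth_map M M' f \<and>
     (\<forall>c\<in>atlas M. \<forall>d\<in>atlas M'. \<forall>p\<in>fst c. f p \<in> fst d \<longrightarrow>
        (\<forall>v :: nat \<Rightarrow> real.
           (\<forall>k<mdim M'. (\<Sum>i<mdim M. coord_jacobian c d f p k i * v i) = 0) \<longrightarrow>
           (\<forall>i<mdim M. v i = 0)))"

definition smooth_embedding :: "'a manifold \<Rightarrow> 'b manifold \<Rightarrow> ('a \<Rightarrow> 'b) \<Rightarrow> bool" where
  "smooth_embedding M M' f \<longleftrightarrow> immersion M M' f \<and> embedding_map (mtop M) (mtop M') f"

definition euclidean_manifold :: "nat \<Rightarrow> (nat \<Rightarrow> real) manifold" where
  "euclidean_manifold n =
     \<lparr>mtop = Euclidean_space n, mdim = n, atlas = {(topspace (Euclidean_space n), \<lambda>x. x)}\<rparr>"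

section \<open>Riemannian metrics\<close>

text \<open>
  A metric is given by its components in the charts of the atlas: \<open>g c p i j\<close> is the inner product
  at \<open>p\<close> of the \<open>i\<close>-th and \<open>j\<close>-th coordinate vector fields of the chart \<open>c\<close>.
\<close>

type_synonym 'a metric_tensor = "'a chart \<Rightarrow> 'a \<Rightarrow> nat \<Rightarrow> nat \<Rightarrow> real"

text \<open>The pullback of \<open>g'\<close> under \<open>f\<close> equals \<open>g\<close>.\<close>

definition pulls_back_to ::
  "'a manifold \<Rightarrow> 'a metric_tensor \<Rightarrow> 'b manifold \<Rightarrow> 'b metric_tensor \<Rightarrow> ('a \<Rightarrow> 'b) \<Rightarrow> bool" where
  "pulls_back_to M g M' g' f \<longleftrightarrow>
     (\<forall>c\<in>atlas M. \<forall>d\<in>atlas M'. \<forall>p\<in>fst c. f p \<in> fst d \<longrightarrow>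
        (\<forall>i<mdim M. \<forall>j<mdim M.
           g c p i j = (\<Sum>k<mdim M'. \<Sum>l<mdim M'.
                          coord_jacobian c d f p k i * coord_jacobian c d f p l j * g' d (f p) k l)))"

text \<open>For the identity map, \<^const>\<open>pulls_back_to\<close> is the transformation law of a covariant
  2-tensor under change of charts.\<close>

definition riemannian_metric :: "'a manifold \<Rightarrow> 'a metric_tensor \<Rightarrow> bool" where
  "riemannian_metric M g \<longleftrightarrow>
     pulls_back_to M g M g (\<lambda>p. p) \<and>
     (\<forall>c\<in>atlas M.
        (\<forall>i<mdim M. \<forall>j<mdim M.
           smooth_fun_on (mdim M) (snd c ` fst c) (\<lambda>x. g c (chart_inv c x) i j)) \<and>
        (\<forall>p\<in>fst c.
           (\<forall>i<mdim M. \<forall>j<mdim M. g c p i j = g c p j i) \<and>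
           (\<forall>v. (\<exists>i<mdim M. v i \<noteq> 0) \<longrightarrow>
              0 < (\<Sum>i<mdim M. \<Sum>j<mdim M. g c p i j * v i * v j))))"

definition flat_metric :: "(nat \<Rightarrow> real) metric_tensor" where
  "flat_metric c p i j = (if i = j then 1 else 0)"

definition riemannian_isometry ::
  "'a manifold \<Rightarrow> 'a metric_tensor \<Rightarrow> 'b manifold \<Rightarrow> 'b metric_tensor \<Rightarrow> ('a \<Rightarrow> 'b) \<Rightarrow> bool" where
  "riemannian_isometry M g M' g' f \<longleftrightarrow> diffeomorphism M M' f \<and> pulls_back_to M g M' g' f"

definition isometric_embedding ::
  "'a manifold \<Rightarrow> 'a metric_tensor \<Rightarrow> nat \<Rightarrow> ('a \<Rightarrow> nat \<Rightarrow> real) \<Rightarrow> bool" where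
  "isometric_embedding M g D u \<longleftrightarrow>
     smooth_embedding M (euclidean_manifold D) u \<and>
     pulls_back_to M g (euclidean_manifold D) flat_metric u"

definition isometrically_embeds :: "'a manifold \<Rightarrow> nat \<Rightarrow> bool" where
  "isometrically_embeds X N \<longleftrightarrow>
     (\<forall>h. riemannian_metric X h \<longrightarrow> (\<exists>f. isometric_embedding X h N f))"

text \<open>A predicate rather than a \<open>LEAST\<close> term, which would be unspecified without a proof that some
  dimension suffices.\<close>

definition is_nash_dimension :: "'a manifold \<Rightarrow> nat \<Rightarrow> bool" where
  "is_nash_dimension X N \<longleftrightarrow>
     isometrically_embeds X N \<and> (\<forall>N'. isometrically_embeds X N' \<longrightarrow> N \<le> N')"

section \<open>Quotients by group actions\<close>

definition quotient_topology :: "'a topology \<Rightarrow> ('a \<Rightarrow> 'b) \<Rightarrow> 'b topology" where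
  "quotient_topology T q =
     topology (\<lambda>W. W \<subseteq> q ` topspace T \<and> openin T {x \<in> topspace T. q x \<in> W})"

lemma openin_quotient_topology:
  "openin (quotient_topology T q) W \<longleftrightarrow>
     W \<subseteq> q ` topspace T \<and> openin T {x \<in> topspace T. q x \<in> W}"
proof -
  have "istopology (\<lambda>W. W \<subseteq> q ` topspace T \<and> openin T {x \<in> topspace T. q x \<in> W})"
    unfolding istopology_def
  proof (intro conjI allI impI)
    fix A B
    assume "A \<subseteq> q ` topspace T \<and> openin T {x \<in> topspace T. q x \<in> A}"
      and "B \<subseteq> q ` topspace T \<and> openin T {x \<in> topspace T. q x \<in> B}"
    moreover have "{x \<in> topspace T. q x \<in> A \<inter> B} =
        {x \<in> topspace T. q x \<in> A} \<inter> {x \<in> topspace T. q x \<in> B}"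
      by auto
    ultimately show "A \<inter> B \<subseteq> q ` topspace T" "openin T {x \<in> topspace T. q x \<in> A \<inter> B}"
      by (auto simp del: Int_iff)
  next
    fix K
    assume K: "\<forall>W\<in>K. W \<subseteq> q ` topspace T \<and> openin T {x \<in> topspace T. q x \<in> W}"
    then show "\<Union>K \<subseteq> q ` topspace T"
      by blast
    have "{x \<in> topspace T. q x \<in> \<Union>K} = (\<Union>W\<in>K. {x \<in> topspace T. q x \<in> W})"
      by auto
    then show "openin T {x \<in> topspace T. q x \<in> \<Union>K}"
      using K by auto
  qed
  then show ?thesis
    by (simp add: quotient_topology_def)
qed

text \<open>The charts of the quotient are the charts of \<open>M\<close>, restricted to open sets on which the
  projection to the orbit space is injective and pushed forward along that projection.\<close>

definition quotient_manifold ::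
  "'a manifold \<Rightarrow> ('g, 'm) monoid_scheme \<Rightarrow> ('g \<Rightarrow> 'a \<Rightarrow> 'a) \<Rightarrow> 'a set manifold" where
  "quotient_manifold M G \<phi> =
     \<lparr>mtop = quotient_topology (mtop M) (orbit G \<phi>),
      mdim = mdim M,
      atlas = {(orbit G \<phi> ` V, snd c \<circ> inv_into V (orbit G \<phi>)) | c V.
                 c \<in> atlas M \<and> openin (mtop M) V \<and> V \<subseteq> fst c \<and> inj_on (orbit G \<phi>) V}\<rparr>"

definition free_action ::
  "('g, 'm) monoid_scheme \<Rightarrow> 'a set \<Rightarrow> ('g \<Rightarrow> 'a \<Rightarrow> 'a) \<Rightarrow> bool" where
  "free_action G E \<phi> \<longleftrightarrow> (\<forall>x\<in>E. stabilizer G \<phi> x = {\<one>\<^bsub>G\<^esub>})"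

definition properly_discontinuous_action ::
  "('g, 'm) monoid_scheme \<Rightarrow> 'a topology \<Rightarrow> ('g \<Rightarrow> 'a \<Rightarrow> 'a) \<Rightarrow> bool" where
  "properly_discontinuous_action G T \<phi> \<longleftrightarrow>
     (\<forall>K. compactin T K \<longrightarrow> finite {\<gamma> \<in> carrier G. \<phi> \<gamma> ` K \<inter> K \<noteq> {}})"

definition cocompact_action ::
  "('g, 'm) monoid_scheme \<Rightarrow> 'a topology \<Rightarrow> ('g \<Rightarrow> 'a \<Rightarrow> 'a) \<Rightarrow> bool" where
  "cocompact_action G T \<phi> \<longleftrightarrow> compact_space (quotient_topology T (orbit G \<phi>))"

definition isometric_action ::
  "('g, 'm) monoid_scheme \<Rightarrow> 'a manifold \<Rightarrow> 'a metric_tensor \<Rightarrow> ('g \<Rightarrow> 'a \<Rightarrow> 'a) \<Rightarrow> bool" where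
  "isometric_action G M g \<phi> \<longleftrightarrow>
     group_action G (mpoints M) \<phi> \<and>
     (\<forall>\<gamma>\<in>carrier G. riemannian_isometry M g M g (\<phi> \<gamma>))"

section \<open>Isometry groups of Euclidean spaces and Bieberbach groups\<close>

definition euclidean_dist :: "nat \<Rightarrow> (nat \<Rightarrow> real) \<Rightarrow> (nat \<Rightarrow> real) \<Rightarrow> real" where
  "euclidean_dist m x y = L2_set (\<lambda>i. x i - y i) {..<m}"

definition euclidean_isometries :: "nat \<Rightarrow> ((nat \<Rightarrow> real) \<Rightarrow> nat \<Rightarrow> real) set" where
  "euclidean_isometries m =
     {f \<in> Bij (topspace (Euclidean_space m)).
        \<forall>x\<in>topspace (Euclidean_space m). \<forall>y\<in>topspace (Euclidean_space m).
          euclidean_dist m (f x) (f y) = euclidean_dist m x y}"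

definition isom_group :: "nat \<Rightarrow> ((nat \<Rightarrow> real) \<Rightarrow> nat \<Rightarrow> real) monoid" where
  "isom_group m = BijGroup (topspace (Euclidean_space m)) \<lparr>carrier := euclidean_isometries m\<rparr>"

text \<open>The topology of pointwise convergence, which for isometries is the compact-open topology.\<close>

definition isom_topology :: "nat \<Rightarrow> ((nat \<Rightarrow> real) \<Rightarrow> nat \<Rightarrow> real) topology" where
  "isom_topology m =
     subtopology (product_topology (\<lambda>_. Euclidean_space m) (topspace (Euclidean_space m)))
       (euclidean_isometries m)"

definition torsion_free :: "('g, 'm) monoid_scheme \<Rightarrow> bool" where
  "torsion_free G \<longleftrightarrow>
     (\<forall>x\<in>carrier G. \<forall>k::nat. 0 < k \<and> x [^]\<^bsub>G\<^esub> k = \<one>\<^bsub>G\<^esub> \<longrightarrow> x = \<one>\<^bsub>G\<^esub>)"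

definition bieberbach_group :: "('g, 'm) monoid_scheme \<Rightarrow> bool" where
  "bieberbach_group G \<longleftrightarrow>
     group G \<and>
     (\<exists>m H. subgroup H (isom_group m) \<and>
            torsion_free (isom_group m \<lparr>carrier := H\<rparr>) \<and>
            subtopology (isom_topology m) H = discrete_topology H \<and>
            cocompact_action (isom_group m \<lparr>carrier := H\<rparr>) (Euclidean_space m) (\<lambda>h. h) \<and>
            G \<cong> isom_group m \<lparr>carrier := H\<rparr>)"

text \<open>An action by isometries on the whole target space is a homomorphism to its isometry group.\<close>

definition equivariant ::
  "('g, 'm) monoid_scheme \<Rightarrow> 'a set \<Rightarrow> ('g \<Rightarrow> 'a \<Rightarrow> 'a) \<Rightarrow> nat \<Rightarrow> ('a \<Rightarrow> nat \<Rightarrow> real) \<Rightarrow> bool" where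
  "equivariant G E \<phi> D u \<longleftrightarrow>
     (\<exists>\<rho> \<in> hom G (isom_group D). \<forall>\<gamma>\<in>carrier G. \<forall>x\<in>E. u (\<phi> \<gamma> x) = \<rho> \<gamma> (u x))"

end

theory Submission
  imports Defs "HOL-Homology.Homology"
begin

text \<open>
  Let \<open>\<rho>\<close> identify \<open>\<Gamma>\<close> with a torsion-free discrete cocompact group of isometries of \<open>\<real>\<^sup>m\<close>.
  Isometries are affine, so they commute with weighted means, and averaging the orbit of the origin
  against a bump function on \<open>M\<close> gives a smooth map \<open>F : M \<rightarrow> \<real>\<^sup>m\<close> with
  \<open>F (\<gamma> x) = \<rho> \<gamma> (F x)\<close>. For small \<open>e > 0\<close> the \<open>\<Gamma>\<close>-invariant tensor \<open>g - e\<^sup>2 F\<^sup>*flat\<close> is still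
  positive definite, by cocompactness, and descends to a metric on \<open>M/\<Gamma>\<close>. An isometric embedding
  \<open>h\<close> of that quotient into \<open>\<real>\<^sup>N\<close> yields the isometric equivariant map \<open>(h \<circ> \<pi>, e F)\<close>; it is an
  embedding because \<open>\<rho>\<close> acts freely and properly on \<open>\<real>\<^sup>m\<close>.

  It remains to see that \<open>m \<le> n\<close>. As \<open>M\<close> is homeomorphic to \<open>\<real>\<^sup>n\<close>, Tietze's theorem gives an
  equivariant continuous map \<open>s : \<real>\<^sup>m \<rightarrow> M\<close>. The composite \<open>F \<circ> s\<close> is at bounded distance from the
  identity, so for \<open>n < m\<close> the identity of \<open>S\<^sup>m\<^sup>-\<^sup>1\<close> would factor, up to homotopy, through \<open>S\<^sup>n\<^sup>-\<^sup>1\<close>.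
\<close>

section \<open>Euclidean spaces\<close>

text \<open>The map \<open>h \<circ> \<pi>\<close> is constant on orbits. The extra coordinates have
  to tell the points of an orbit apart, to transform by isometries of the target, and to contribute
  a known amount to the induced metric; this is why their contribution is subtracted from
  \<open>g\<close> before the metric descends. Nothing beyond smoothness and equivariance is asked
  of \<open>F\<close>: it may be neither injective nor an immersion. Freeness of \<rho> separates
  \<open>F x\<close> from \<open>F (\<gamma> x)\<close>, and the immersion property follows because
  the pullback is a Riemannian metric. The obstacle is the dimension. The number m comes from an
  abstract isomorphism, while the target leaves exactly n coordinates for \<open>e F\<close>; those
  left over are filled with zeros. The two numbers are compared at large scale: the same group acts
  properly and cocompactly on \<open>M\<close> and on \<open>\<real>\<^sup>m\<close>, there are
  equivariant maps in both directions, and the distance from \<open>F (s x)\<close> to x is an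
  invariant function of x, hence bounded. On large spheres this is as good as a factorization of the
  identity.\<close>

abbreviation eucl :: "nat \<Rightarrow> (nat \<Rightarrow> real) set" where
  "eucl n \<equiv> topspace (Euclidean_space n)"

lemma in_eucl: "x \<in> eucl n \<longleftrightarrow> (\<forall>i\<ge>n. x i = 0)"
  by (simp add: topspace_Euclidean_space)

lemma Euclidean_space_eq: "Euclidean_space n = top_of_set (eucl n)"
  by (simp add: Euclidean_space_def euclidean_product_topology topspace_Euclidean_space)

lemma openin_eucl_open: "openin (Euclidean_space n) U \<longleftrightarrow> (\<exists>T. open T \<and> U = eucl n \<inter> T)"
  using openin_open[of "eucl n" U] Euclidean_space_eq[of n] by simp

text \<open>Cubes instead of round balls: the product topology yields them directly, and changing
  one coordinate after another from the centre to a point of a cube never leaves the cube.\<close>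

definition ebox :: "nat \<Rightarrow> (nat \<Rightarrow> real) \<Rightarrow> real \<Rightarrow> (nat \<Rightarrow> real) set" where
  "ebox n x d = {y \<in> eucl n. \<forall>i<n. \<bar>y i - x i\<bar> < d}"

text \<open>A basic open set of the product restricts each coordinate separately. Coordinates from n
  on are constantly 0 in \<open>eucl n\<close>, so a single radius has to serve only finitely many
  coordinates.\<close>

lemma openin_eucl_ebox:
  assumes "openin (Euclidean_space n) U" and "x \<in> U"
  obtains d where "d > 0" and "ebox n x d \<subseteq> U"
proof -
  obtain T where T: "open T" "U = eucl n \<inter> T"
    using assms(1) unfolding openin_eucl_open by auto
  have "openin (product_topology (\<lambda>_. euclidean) UNIV) T"
    using T(1) by (simp add: euclidean_product_topology)
  then obtain V where V: "\<And>i. open (V i)" "x \<in> Pi\<^sub>E UNIV V" "Pi\<^sub>E UNIV V \<subseteq> T"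
  proof -
    have "x \<in> T"
      using assms(2) T(2) by blast
    then obtain V where "\<forall>i\<in>UNIV. openin euclidean (V i)" "x \<in> Pi\<^sub>E UNIV V" "Pi\<^sub>E UNIV V \<subseteq> T"
      using \<open>openin (product_topology (\<lambda>_. euclidean) UNIV) T\<close>
      unfolding openin_product_topology_alt by blast
    then show ?thesis
      using that[of V] by (simp only: UNIV_I open_openin simp_thms ball_simps)
  qed
  have "\<exists>e>0. ball (x i) e \<subseteq> V i" for i
    using V(1)[of i] V(2) by (auto simp: open_contains_ball PiE_iff)
  then obtain e where e: "\<And>i. e i > 0" "\<And>i. ball (x i) (e i) \<subseteq> V i"
    by metis
  \<comment> \<open>The inserted 1 keeps the set non-empty when n is 0; the same device recurs in
    later minima.\<close>
  define d where "d = Min (insert 1 (e ` {..<n}))"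
  have d: "d > 0" "\<And>i. i < n \<Longrightarrow> d \<le> e i"
    using e(1) by (auto simp: d_def)
  have "ebox n x d \<subseteq> U"
  proof
    fix y assume y: "y \<in> ebox n x d"
    have "y i \<in> V i" for i
    proof (cases "i < n")
      case True
      then have "\<bar>y i - x i\<bar> < e i"
        using y d(2)[OF True] by (auto simp: ebox_def)
      then show ?thesis
        using e(2)[of i] by (auto simp: dist_real_def)
    next
      case False
      then have "y i = x i"
        using y assms(2) T(2) by (auto simp: ebox_def in_eucl)
      then show ?thesis
        using V(2) by auto
    qed
    then show "y \<in> U"
      using V(3) T(2) y by (auto simp: ebox_def)
  qed
  with d(1) show ?thesis
    using that by blast
qed

lemma openin_eucl_preimage:
  assumes "openin (Euclidean_space n) U" and "continuous_on U f" and "open S"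
  shows "openin (Euclidean_space n) (U \<inter> f -` S)"
proof -
  obtain T where "open T" "U = eucl n \<inter> T"
    using assms(1) openin_eucl_open by auto
  moreover obtain T' where "open T'" "U \<inter> f -` S = U \<inter> T'"
    using continuous_openin_preimage_gen[OF assms(2,3)] openin_open by metis
  ultimately have "U \<inter> f -` S = eucl n \<inter> (T \<inter> T')" "open (T \<inter> T')"
    by auto
  then show ?thesis
    unfolding openin_eucl_open by blast
qed

lemma fun_upd_in_eucl: "x \<in> eucl n \<Longrightarrow> i < n \<Longrightarrow> x(i := t) \<in> eucl n"
  by (auto simp: in_eucl)

text \<open>Partial derivatives see a function only along coordinate lines, and such a line stays in
  U near its base point. Hence values outside U have no influence on derivatives at points of
  U.\<close>

lemma eventually_fun_upd:
  assumes "openin (Euclidean_space n) U" and "x \<in> U" and "i < n"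
  shows "\<forall>\<^sub>F t in nhds (x i). x(i := t) \<in> U"
proof -
  obtain d where d: "d > 0" "ebox n x d \<subseteq> U"
    using openin_eucl_ebox assms by metis
  have "x \<in> eucl n"
    using assms openin_subset by blast
  have "x(i := t) \<in> U" if "dist t (x i) < d" for t
    using that d fun_upd_in_eucl[OF \<open>x \<in> eucl n\<close> \<open>i < n\<close>]
    by (auto simp: ebox_def dist_real_def subset_iff)
  then show ?thesis
    unfolding eventually_nhds_metric using d(1) by blast
qed

lemma continuous_map_into_eucl:
  "continuous_map X (Euclidean_space D) u \<longleftrightarrow> continuous_map X euclidean u \<and> u \<in> topspace X \<rightarrow> eucl D"
  by (subst Euclidean_space_eq) (rule continuous_map_in_subtopology)

lemma subtopology_eucl: "S \<subseteq> eucl D \<Longrightarrow> subtopology (Euclidean_space D) S = top_of_set S"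
  by (subst Euclidean_space_eq) (simp add: subtopology_subtopology Int_absorb1)

section \<open>Functions with continuous partial derivatives\<close>

lemma partial_deriv_cong:
  assumes "openin (Euclidean_space n) U" and "x \<in> U" and "i < n" and "\<And>y. y \<in> U \<Longrightarrow> f y = g y"
  shows "partial_deriv i f x = partial_deriv i g x"
  unfolding partial_deriv_def
  by (rule deriv_cong_ev) (use eventually_fun_upd[OF assms(1-3)] in \<open>auto elim: eventually_mono simp: assms(4)\<close>)

lemma differentiable_fun_upd_cong:
  assumes "openin (Euclidean_space n) U" and "x \<in> U" and "i < n" and "\<And>y. y \<in> U \<Longrightarrow> f y = g y"
    and "(\<lambda>t. f (x(i := t)) :: real) differentiable (at (x i))"
  shows "(\<lambda>t. g (x(i := t))) differentiable (at (x i))"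
proof -
  obtain D where "((\<lambda>t. f (x(i := t))) has_derivative D) (at (x i))"
    using assms(5) differentiable_def by blast
  then have "((\<lambda>t. g (x(i := t))) has_derivative D) (at (x i))"
  proof (rule has_derivative_transform_eventually)
    show "\<forall>\<^sub>F t in at (x i). f (x(i := t)) = g (x(i := t))"
      using eventually_fun_upd[OF assms(1-3)] unfolding at_within_def
      by (auto simp: eventually_inf_principal elim!: eventually_mono intro: assms(4))
  qed (auto simp: assms(2,4))
  then show ?thesis
    using differentiable_def by blast
qed

lemma Ck_on_cong_imp:
  assumes "openin (Euclidean_space n) U" and "\<And>y. y \<in> U \<Longrightarrow> f y = g y" and "Ck_on n k U f"
  shows "Ck_on n k U g"
  using assms(2,3)
proof (induction k arbitrary: f g)
  case 0
  then show ?case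
    by (simp cong: continuous_on_cong)
next
  case (Suc k)
  have "Ck_on n k U (partial_deriv i g)" if "i < n" for i
    by (rule Suc.IH[of "partial_deriv i f"])
       (use Suc.prems that in \<open>auto intro: partial_deriv_cong[OF assms(1)]\<close>)
  moreover have "continuous_on U g"
    using Suc.prems by (simp cong: continuous_on_cong)
  ultimately show ?case
    using Suc.prems differentiable_fun_upd_cong[OF assms(1), of _ _ f g] by auto
qed

lemma Ck_on_cong:
  assumes "openin (Euclidean_space n) U" and "\<And>y. y \<in> U \<Longrightarrow> f y = g y"
  shows "Ck_on n k U f \<longleftrightarrow> Ck_on n k U g"
  using Ck_on_cong_imp assms by metis

lemma Ck_on_subset: "Ck_on n k U f \<Longrightarrow> V \<subseteq> U \<Longrightarrow> Ck_on n k V f"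
  by (induction k arbitrary: f) (auto intro: continuous_on_subset)

lemma Ck_on_imp_continuous_on: "Ck_on n k U f \<Longrightarrow> continuous_on U f"
  by (cases k) auto

lemma Ck_on_Suc_imp: "Ck_on n (Suc k) U f \<Longrightarrow> Ck_on n k U f"
proof (induction k arbitrary: f)
  case (Suc k)
  then show ?case
    unfolding Ck_on.simps(2)[of n "Suc k"] Ck_on.simps(2)[of n k] by blast
qed simp

lemma Ck_on_partial_deriv:
  assumes "Ck_on n (Suc k) U f" and "x \<in> U" and "i < n"
  shows "((\<lambda>t. f (x(i := t))) has_real_derivative partial_deriv i f x) (at (x i))"
  using assms unfolding partial_deriv_def by (simp add: DERIV_deriv_iff_real_differentiable)

text \<open>The derivative is given as a formula \<open>D\<close> that agrees with
  \<open>partial_deriv\<close> on U; inductions on the order k then apply to that formula instead of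
  to an expression with \<open>deriv\<close>.\<close>

lemma Ck_on_SucI:
  assumes "openin (Euclidean_space n) U" and "continuous_on U f"
    and "\<And>i x. i < n \<Longrightarrow> x \<in> U \<Longrightarrow> ((\<lambda>t. f (x(i := t))) has_real_derivative D i x) (at (x i))"
    and "\<And>i. i < n \<Longrightarrow> Ck_on n k U (D i)"
  shows "Ck_on n (Suc k) U f"
proof -
  have "Ck_on n k U (partial_deriv i f)" if "i < n" for i
  proof (rule Ck_on_cong_imp[OF assms(1) _ assms(4)[OF that]])
    show "D i y = partial_deriv i f y" if "y \<in> U" for y
      using assms(3)[OF \<open>i < n\<close> that] unfolding partial_deriv_def by (simp add: DERIV_imp_deriv)
  qed
  then show ?thesis
    using assms(2,3) by (auto simp: real_differentiable_def)
qed

lemma continuous_on_eucl_local: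
  assumes "U \<subseteq> eucl n"
    and "\<And>x. x \<in> U \<Longrightarrow> \<exists>V. openin (Euclidean_space n) V \<and> x \<in> V \<and> continuous_on (U \<inter> V) f"
  shows "continuous_on U f"
  unfolding continuous_on_eq_continuous_within
proof
  fix x assume "x \<in> U"
  then obtain V T where V: "x \<in> V" "continuous_on (U \<inter> V) f" "open T" "V = eucl n \<inter> T"
    using assms(2)[of x] unfolding openin_eucl_open by blast
  have "U \<inter> T = U \<inter> V"
    using V(4) assms(1) by auto
  then have "at x within U = at x within (U \<inter> V)"
    using V \<open>x \<in> U\<close> by (intro at_within_nhd[of x T]) auto
  then show "continuous (at x within U) f"
    using V(1,2) \<open>x \<in> U\<close> by (simp add: continuous_on_eq_continuous_within)
qed

text \<open>\<open>partial_deriv\<close> mentions no domain, so the neighbourhoods found for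
  \<open>f\<close> also serve for its partial derivatives, and the induction goes through with the
  same sets.\<close>

lemma Ck_on_local:
  assumes "U \<subseteq> eucl n"
    and "\<And>x. x \<in> U \<Longrightarrow> \<exists>V. openin (Euclidean_space n) V \<and> x \<in> V \<and> Ck_on n k (U \<inter> V) f"
  shows "Ck_on n k U f"
  using assms(2)
proof (induction k arbitrary: f)
  case 0
  then show ?case
    by (simp add: continuous_on_eucl_local[OF assms(1)])
next
  case (Suc k)
  have "Ck_on n k U (partial_deriv i f)" if "i < n" for i
    using Suc.prems that by (intro Suc.IH) fastforce
  moreover have "continuous_on U f"
    using Suc.prems by (intro continuous_on_eucl_local[OF assms(1)]) fastforce
  moreover have "(\<lambda>t. f (x(i := t))) differentiable (at (x i))" if "i < n" "x \<in> U" for i x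
    using Suc.prems[OF that(2)] that by auto
  ultimately show ?case
    by simp
qed

lemma Ck_on_const: "openin (Euclidean_space n) U \<Longrightarrow> Ck_on n k U (\<lambda>x. c)"
  by (induction k arbitrary: c)
     (simp, intro Ck_on_SucI[where D = "\<lambda>i x. 0"], auto)

lemma Ck_on_proj: "openin (Euclidean_space n) U \<Longrightarrow> Ck_on n k U (\<lambda>x. x j)"
proof (cases k)
  case 0
  then show ?thesis
    by (auto intro: continuous_on_subset[OF continuous_on_product_coordinates])
next
  case (Suc k')
  assume U: "openin (Euclidean_space n) U"
  have "((\<lambda>t. (x(i := t)) j) has_real_derivative (if i = j then 1 else 0)) (at (x i))" for i x
    by (cases "i = j") (auto simp: fun_upd_def)
  then show ?thesis
    unfolding Suc
    by (intro Ck_on_SucI[OF U, where D = "\<lambda>i x. if i = j then 1 else 0"] Ck_on_const[OF U])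
       (auto intro: continuous_on_subset[OF continuous_on_product_coordinates])
qed

lemma Ck_on_add:
  assumes "openin (Euclidean_space n) U" and "Ck_on n k U f" and "Ck_on n k U g"
  shows "Ck_on n k U (\<lambda>x. f x + g x)"
  using assms(2,3)
proof (induction k arbitrary: f g)
  case 0
  then show ?case
    by (simp add: continuous_on_add)
next
  case (Suc k)
  show ?case
  proof (rule Ck_on_SucI[OF assms(1), where D = "\<lambda>i x. partial_deriv i f x + partial_deriv i g x"])
    show "continuous_on U (\<lambda>x. f x + g x)"
      using Suc.prems by (auto intro: continuous_on_add)
    show "((\<lambda>t. f (x(i := t)) + g (x(i := t))) has_real_derivative
        partial_deriv i f x + partial_deriv i g x) (at (x i))" if "i < n" "x \<in> U" for i x
      using that Suc.prems by (intro DERIV_add Ck_on_partial_deriv)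
    show "Ck_on n k U (\<lambda>x. partial_deriv i f x + partial_deriv i g x)" if "i < n" for i
      using that Suc.prems by (intro Suc.IH) auto
  qed
qed

lemma Ck_on_mult:
  assumes "openin (Euclidean_space n) U" and "Ck_on n k U f" and "Ck_on n k U g"
  shows "Ck_on n k U (\<lambda>x. f x * g x)"
  using assms(2,3)
proof (induction k arbitrary: f g)
  case 0
  then show ?case
    by (simp add: continuous_on_mult)
next
  case (Suc k)
  show ?case
  proof (rule Ck_on_SucI[OF assms(1), where D = "\<lambda>i x. partial_deriv i f x * g x + partial_deriv i g x * f x"])
    show "continuous_on U (\<lambda>x. f x * g x)"
      using Suc.prems by (auto intro: continuous_on_mult)
    show "((\<lambda>t. f (x(i := t)) * g (x(i := t))) has_real_derivative
        partial_deriv i f x * g x + partial_deriv i g x * f x) (at (x i))" if "i < n" "x \<in> U" for i x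
      using that DERIV_mult[OF Ck_on_partial_deriv[OF Suc.prems(1), of x i] Ck_on_partial_deriv[OF Suc.prems(2), of x i]]
      unfolding fun_upd_triv by blast
    show "Ck_on n k U (\<lambda>x. partial_deriv i f x * g x + partial_deriv i g x * f x)" if "i < n" for i
      using that Suc.prems Ck_on_Suc_imp by (intro Suc.IH Ck_on_add[OF assms(1)]) auto
  qed
qed

lemma Ck_on_sum:
  assumes "openin (Euclidean_space n) U" and "\<And>a. a \<in> A \<Longrightarrow> Ck_on n k U (f a)"
  shows "Ck_on n k U (\<lambda>x. \<Sum>a\<in>A. f a x)"
  using assms(2)
  by (induction A rule: infinite_finite_induct)
     (auto intro: Ck_on_const[OF assms(1)] Ck_on_add[OF assms(1)])

text \<open>The outer function comes with its whole tower of derivatives \<open>h j\<close>, because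
  the derivative of \<open>h j \<circ> f\<close> involves \<open>h (Suc j)\<close>; the induction on
  k therefore runs for all j at once.\<close>

lemma Ck_on_compose_real:
  assumes "openin (Euclidean_space n) U" and "Ck_on n k U f" and "\<And>x. x \<in> U \<Longrightarrow> f x \<in> S"
    and "\<And>j t. t \<in> S \<Longrightarrow> (h j has_real_derivative h (Suc j) t) (at t)"
  shows "Ck_on n k U (\<lambda>x. h j (f x))"
  using assms(2)
proof (induction k arbitrary: j)
  have "continuous_on S (h j)" for j
    using assms(4) by (meson DERIV_isCont continuous_at_imp_continuous_on)
  then have cont: "continuous_on U (\<lambda>x. h j (f x))" if "continuous_on U f" for j
    using that assms(3) by (intro continuous_on_compose2[of S "h j" U f]) auto
  {
    case 0
    then show ?case
      using cont by simp
  next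
    case (Suc k)
    show ?case
    proof (rule Ck_on_SucI[OF assms(1), where D = "\<lambda>i x. h (Suc j) (f x) * partial_deriv i f x"])
      show "continuous_on U (\<lambda>x. h j (f x))"
        using cont Suc.prems by simp
      show "((\<lambda>t. h j (f (x(i := t)))) has_real_derivative h (Suc j) (f x) * partial_deriv i f x) (at (x i))"
        if "i < n" "x \<in> U" for i x
      proof (rule DERIV_chain2[where g = "\<lambda>t. f (x(i := t))"])
        show "(h j has_real_derivative h (Suc j) (f x)) (at (f (x(i := x i))))"
          using assms(3,4) that by simp
      qed (rule Ck_on_partial_deriv[OF Suc.prems that(2,1)])
      show "Ck_on n k U (\<lambda>x. h (Suc j) (f x) * partial_deriv i f x)" if "i < n" for i
        using that Suc.prems by (intro Ck_on_mult[OF assms(1)] Suc.IH[OF Ck_on_Suc_imp]) auto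
    qed
  }
qed

section \<open>Total derivatives and the chain rule\<close>

text \<open>Moving from \<open>a\<close> to \<open>z\<close> one coordinate at a time reduces the
  estimate to one variable: on each leg, \<open>G\<close> minus its linear part has derivative at
  most \<open>e\<close> in absolute value, by continuity of the partial derivatives.\<close>

lemma Ck_on_total_derivative:
  assumes U: "openin (Euclidean_space p) U" and a: "a \<in> U" and G: "Ck_on p 1 U G" and e: "e > 0"
  obtains d where "d > 0"
    and "\<And>z. z \<in> ebox p a d \<Longrightarrow>
          \<bar>G z - G a - (\<Sum>j<p. partial_deriv j G a * (z j - a j))\<bar> \<le> e * (\<Sum>j<p. \<bar>z j - a j\<bar>)"
proof -
  have aE: "a \<in> eucl p"
    using U a openin_subset by blast
  have "\<exists>d>0. \<forall>z\<in>ebox p a d. z \<in> U \<and> \<bar>partial_deriv j G z - partial_deriv j G a\<bar> < e" if "j < p" for j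
  proof -
    have "continuous_on U (partial_deriv j G)"
      using G that by simp
    then have "openin (Euclidean_space p) (U \<inter> partial_deriv j G -` {partial_deriv j G a - e <..< partial_deriv j G a + e})"
      by (intro openin_eucl_preimage[OF U]) auto
    moreover have "a \<in> U \<inter> partial_deriv j G -` {partial_deriv j G a - e <..< partial_deriv j G a + e}"
      using a e by simp
    ultimately obtain d where "d > 0"
      "ebox p a d \<subseteq> U \<inter> partial_deriv j G -` {partial_deriv j G a - e <..< partial_deriv j G a + e}"
      using openin_eucl_ebox by metis
    then show ?thesis
      by (intro exI[of _ d]) (auto simp: subset_iff abs_less_iff)
  qed
  then obtain dd where dd: "\<And>j. j < p \<Longrightarrow> dd j > 0"
    "\<And>j z. j < p \<Longrightarrow> z \<in> ebox p a (dd j) \<Longrightarrow> z \<in> U \<and> \<bar>partial_deriv j G z - partial_deriv j G a\<bar> < e"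
    by metis
  define d where "d = Min (insert 1 (dd ` {..<p}))"
  have d: "d > 0" "\<And>j. j < p \<Longrightarrow> d \<le> dd j"
    using dd(1) by (auto simp: d_def)
  have near: "z \<in> U \<and> \<bar>partial_deriv j G z - partial_deriv j G a\<bar> < e" if "j < p" "z \<in> ebox p a d" for j z
    using dd(2)[OF that(1), of z] that d(2)[OF that(1)] unfolding ebox_def by fastforce
  show ?thesis
  proof (rule that[OF d(1)])
    fix z assume z: "z \<in> ebox p a d"
    then have zE: "z \<in> eucl p" and zd: "\<And>i. i < p \<Longrightarrow> \<bar>z i - a i\<bar> < d"
      by (auto simp: ebox_def)
    \<comment> \<open>The corners of the path: \<open>w 0\<close> is \<open>a\<close> and
      \<open>w p\<close> is \<open>z\<close>.\<close>
    define w where "w q = (\<lambda>j. if j < q then z j else a j)" for q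
    have tele: "\<bar>G (w q) - G a - (\<Sum>j<q. partial_deriv j G a * (z j - a j))\<bar> \<le> e * (\<Sum>j<q. \<bar>z j - a j\<bar>)"
      if "q \<le> p" for q
      using that
    proof (induction q)
      case 0
      then show ?case
        by (simp add: w_def)
    next
      case (Suc q)
      then have q: "q < p"
        by simp
      define h where "h t = G ((w q)(q := t)) - partial_deriv q G a * t" for t
      define S where "S = closed_segment (a q) (z q)"
      have inb: "(w q)(q := t) \<in> ebox p a d" if "t \<in> S" for t
      proof -
        have "\<bar>t - a q\<bar> \<le> \<bar>z q - a q\<bar>"
          using that segment_bound1[of t "a q" "z q"] by (simp add: S_def)
        then have "\<bar>t - a q\<bar> < d"
          using zd[OF q] by simp
        then show ?thesis
          using zd zE aE d(1) q by (auto simp: ebox_def w_def in_eucl)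
      qed
      have "norm (h (z q) - h (a q)) \<le> e * norm (z q - a q)"
      proof (rule field_differentiable_bound)
        show "convex S" "z q \<in> S" "a q \<in> S"
          by (auto simp: S_def)
        fix t assume t: "t \<in> S"
        let ?y = "(w q)(q := t)"
        have "((\<lambda>s. G (?y(q := s))) has_real_derivative partial_deriv q G ?y) (at (?y q))"
          using near[OF q inb[OF t]] G q Ck_on_partial_deriv[of p 0 U G ?y q] by (simp del: fun_upd_apply)
        then have "((\<lambda>s. G ((w q)(q := s))) has_real_derivative partial_deriv q G ?y) (at t)"
          by simp
        then have "(h has_real_derivative partial_deriv q G ?y - partial_deriv q G a) (at t)"
          unfolding h_def by (auto intro!: derivative_eq_intros)
        then show "(h has_field_derivative partial_deriv q G ?y - partial_deriv q G a) (at t within S)"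
          by (rule has_field_derivative_at_within)
        show "norm (partial_deriv q G ?y - partial_deriv q G a) \<le> e"
          using near[OF q inb[OF t]] by simp
      qed
      moreover have "(w q)(q := z q) = w (Suc q)" "(w q)(q := a q) = w q"
        by (auto simp: w_def)
      ultimately have "\<bar>G (w (Suc q)) - G (w q) - partial_deriv q G a * (z q - a q)\<bar> \<le> e * \<bar>z q - a q\<bar>"
        by (simp add: h_def algebra_simps)
      then show ?case
        using Suc by (simp add: algebra_simps)
    qed
    have "w p = z"
      using zE aE by (auto simp: w_def in_eucl)
    with tele[of p] show "\<bar>G z - G a - (\<Sum>j<p. partial_deriv j G a * (z j - a j))\<bar> \<le> e * (\<Sum>j<p. \<bar>z j - a j\<bar>)"
      by simp
  qed
qed

text \<open>The error estimate of the total derivative is divided by \<open>t - t0\<close>. The sum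
  \<open>R\<close> of the absolute difference quotients converges, so the error is at most
  \<open>e\<close> times a bounded quantity.\<close>

lemma Ck_on_curve_derivative:
  assumes U: "openin (Euclidean_space p) U" and G: "Ck_on p 1 U G" and "y t0 \<in> U"
    and yE: "\<forall>\<^sub>F t in at t0. y t \<in> eucl p"
    and y: "\<And>j. j < p \<Longrightarrow> ((\<lambda>t. y t j) has_real_derivative y' j) (at t0)"
  shows "((\<lambda>t. G (y t)) has_real_derivative (\<Sum>j<p. partial_deriv j G (y t0) * y' j)) (at t0)"
proof -
  define a where "a = y t0"
  define Q where "Q t = (\<Sum>j<p. partial_deriv j G a * ((y t j - a j) / (t - t0)))" for t
  define R where "R t = (\<Sum>j<p. \<bar>(y t j - a j) / (t - t0)\<bar>)" for t
  have quot: "((\<lambda>t. (y t j - a j) / (t - t0)) \<longlongrightarrow> y' j) (at t0)" if "j < p" for j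
    using y[OF that] unfolding has_field_derivative_iff a_def .
  have Q: "(Q \<longlongrightarrow> (\<Sum>j<p. partial_deriv j G a * y' j)) (at t0)"
    unfolding Q_def by (intro tendsto_sum tendsto_mult quot tendsto_const) auto
  have R: "(R \<longlongrightarrow> (\<Sum>j<p. \<bar>y' j\<bar>)) (at t0)"
    unfolding R_def by (intro tendsto_sum tendsto_rabs quot) auto
  have yd: "\<forall>\<^sub>F t in at t0. y t \<in> ebox p a d" if "d > 0" for d
  proof -
    have "\<forall>\<^sub>F t in at t0. \<bar>y t j - a j\<bar> < d" if "j < p" for j
    proof -
      have "((\<lambda>t. y t j) \<longlongrightarrow> a j) (at t0)"
        using DERIV_isCont[OF y[OF that]] by (simp add: isCont_def a_def)
      then show ?thesis
        using \<open>d > 0\<close> tendstoD by (fastforce simp: dist_real_def)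
    qed
    then have "\<forall>\<^sub>F t in at t0. \<forall>j\<in>{..<p}. \<bar>y t j - a j\<bar> < d"
      by (intro eventually_ball_finite) auto
    then show ?thesis
      using yE by eventually_elim (auto simp: ebox_def)
  qed
  have "((\<lambda>t. (G (y t) - G a) / (t - t0) - Q t) \<longlongrightarrow> 0) (at t0)"
  proof (rule tendstoI)
    fix r :: real assume "r > 0"
    \<comment> \<open>\<open>B\<close> exceeds the limit of \<open>R\<close> by 1, so it bounds
      \<open>R\<close> near \<open>t0\<close>; the choice of \<open>e\<close> then makes the error
      less than r / 2.\<close>
    define B where "B = (\<Sum>j<p. \<bar>y' j\<bar>) + 1"
    have "B > 0"
      by (simp add: B_def sum_nonneg add_nonneg_pos)
    define e where "e = r / (2 * B)"
    have "e > 0"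
      using \<open>r > 0\<close> \<open>B > 0\<close> by (simp add: e_def)
    obtain d where d: "d > 0" "\<And>z. z \<in> ebox p a d \<Longrightarrow>
          \<bar>G z - G a - (\<Sum>j<p. partial_deriv j G a * (z j - a j))\<bar> \<le> e * (\<Sum>j<p. \<bar>z j - a j\<bar>)"
      using Ck_on_total_derivative[OF U _ G \<open>e > 0\<close>, of a] assms(3) unfolding a_def by blast
    have "\<forall>\<^sub>F t in at t0. R t < B"
      using R by (rule order_tendstoD) (simp add: B_def)
    moreover have "\<forall>\<^sub>F t in at t0. t \<noteq> t0"
      by (simp add: eventually_at_filter)
    ultimately show "\<forall>\<^sub>F t in at t0. dist ((G (y t) - G a) / (t - t0) - Q t) 0 < r"
      using yd[OF d(1)]
    proof eventually_elim
      case (elim t)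
      have 1: "Q t = (\<Sum>j<p. partial_deriv j G a * (y t j - a j)) / (t - t0)"
        by (simp add: Q_def sum_divide_distrib)
      have 2: "R t = (\<Sum>j<p. \<bar>y t j - a j\<bar>) / \<bar>t - t0\<bar>"
        by (simp add: R_def sum_divide_distrib abs_divide)
      have "\<bar>(G (y t) - G a) / (t - t0) - Q t\<bar> =
          \<bar>G (y t) - G a - (\<Sum>j<p. partial_deriv j G a * (y t j - a j))\<bar> / \<bar>t - t0\<bar>"
        unfolding 1 by (simp add: abs_divide flip: diff_divide_distrib)
      also have "\<dots> \<le> e * (\<Sum>j<p. \<bar>y t j - a j\<bar>) / \<bar>t - t0\<bar>"
        by (intro divide_right_mono d(2) elim) auto
      also have "\<dots> = e * R t"
        by (simp add: 2)
      also have "\<dots> < e * B"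
        using elim \<open>e > 0\<close> by simp
      also have "\<dots> < r"
        using \<open>B > 0\<close> \<open>r > 0\<close> by (simp add: e_def)
      finally show ?case
        by (simp add: dist_real_def)
    qed
  qed
  from tendsto_add[OF this Q] show ?thesis
    unfolding has_field_derivative_iff a_def[symmetric] by simp
qed

lemma partial_deriv_compose:
  assumes U: "openin (Euclidean_space p) U" and G: "Ck_on p 1 U G"
    and W: "openin (Euclidean_space n) W" and y: "\<And>j. j < p \<Longrightarrow> Ck_on n 1 W (\<lambda>x. y x j)"
    and yU: "\<And>x. x \<in> W \<Longrightarrow> y x \<in> U" and x: "x \<in> W" and i: "i < n"
  shows "((\<lambda>t. G (y (x(i := t)))) has_real_derivative
      (\<Sum>j<p. partial_deriv j G (y x) * partial_deriv i (\<lambda>x. y x j) x)) (at (x i))"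
proof -
  have "\<forall>\<^sub>F t in at (x i). y (x(i := t)) \<in> eucl p"
    using eventually_fun_upd[OF W x i] openin_subset[OF U] yU unfolding at_within_def
    by (auto simp: eventually_inf_principal elim!: eventually_mono)
  moreover have "((\<lambda>t. y (x(i := t)) j) has_real_derivative partial_deriv i (\<lambda>x. y x j) x) (at (x i))" if "j < p" for j
    using Ck_on_partial_deriv[OF _ x i, of 0 "\<lambda>x. y x j"] y[OF that] by simp
  ultimately show ?thesis
    using Ck_on_curve_derivative[OF U G, of "\<lambda>t. y (x(i := t))" "x i"] yU[OF x] by simp
qed

lemma continuous_on_into_eucl:
  assumes "\<And>j. j < p \<Longrightarrow> continuous_on W (\<lambda>x. y x j)" and "\<And>x. x \<in> W \<Longrightarrow> y x \<in> eucl p"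
  shows "continuous_on W y"
proof (rule continuous_on_coordinatewise_then_product)
  fix j
  show "continuous_on W (\<lambda>x. y x j)"
  proof (cases "j < p")
    case False
    then have "continuous_on W (\<lambda>x. y x j) \<longleftrightarrow> continuous_on W (\<lambda>x. 0 :: real)"
      using assms(2) by (intro continuous_on_cong) (auto simp: in_eucl)
    then show ?thesis
      by simp
  qed (use assms(1) in auto)
qed

text \<open>The induction keeps \<open>y\<close> and generalises \<open>G\<close>, since the chain
  rule produces the partial derivatives of \<open>G\<close> composed with the same
  \<open>y\<close>.\<close>

lemma Ck_on_compose:
  assumes U: "openin (Euclidean_space p) U" and G: "Ck_on p k U G"
    and W: "openin (Euclidean_space n) W" and y: "\<And>j. j < p \<Longrightarrow> Ck_on n k W (\<lambda>x. y x j)"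
    and yU: "\<And>x. x \<in> W \<Longrightarrow> y x \<in> U"
  shows "Ck_on n k W (\<lambda>x. G (y x))"
  using G y
proof (induction k arbitrary: G)
  have cont: "continuous_on W (\<lambda>x. G (y x))"
    if "continuous_on U G" "\<And>j. j < p \<Longrightarrow> continuous_on W (\<lambda>x. y x j)" for G :: "_ \<Rightarrow> real"
    using that yU openin_subset[OF U]
    by (intro continuous_on_compose2[of U G W y] continuous_on_into_eucl[of p]) auto
  {
    case 0
    then show ?case
      using cont by simp
  next
    case (Suc k)
    have C1: "Ck_on p 1 U G" "\<And>j. j < p \<Longrightarrow> Ck_on n 1 W (\<lambda>x. y x j)"
      using Suc.prems by (auto intro: Ck_on_imp_continuous_on)
    show ?case
    proof (rule Ck_on_SucI[OF W, where D = "\<lambda>i x. \<Sum>j<p. partial_deriv j G (y x) * partial_deriv i (\<lambda>x. y x j) x"])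
      show "continuous_on W (\<lambda>x. G (y x))"
        using Suc.prems by (intro cont[of G]) auto
      show "((\<lambda>t. G (y (x(i := t)))) has_real_derivative
        (\<Sum>j<p. partial_deriv j G (y x) * partial_deriv i (\<lambda>x. y x j) x)) (at (x i))" if "i < n" "x \<in> W" for i x
        using partial_deriv_compose[OF U C1(1) W, of y x i] C1(2) yU that by blast
      show "Ck_on n k W (\<lambda>x. \<Sum>j<p. partial_deriv j G (y x) * partial_deriv i (\<lambda>x. y x j) x)" if "i < n" for i
      proof (intro Ck_on_sum[OF W] Ck_on_mult[OF W])
        fix j assume "j \<in> {..<p}"
        then show "Ck_on n k W (\<lambda>x. partial_deriv j G (y x))"
          using Suc.prems by (intro Suc.IH[of "partial_deriv j G"] Ck_on_Suc_imp[of n k]) auto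
        show "Ck_on n k W (partial_deriv i (\<lambda>x. y x j))"
          using Suc.prems(2)[of j] \<open>j \<in> {..<p}\<close> that by simp
      qed
    qed
  }
qed

section \<open>Smooth functions\<close>

lemma smooth_fun_onD: "smooth_fun_on n U f \<Longrightarrow> Ck_on n k U f"
  by (simp add: smooth_fun_on_def)

lemma smooth_fun_on_cong:
  assumes "openin (Euclidean_space n) U" and "\<And>y. y \<in> U \<Longrightarrow> f y = g y"
  shows "smooth_fun_on n U f \<longleftrightarrow> smooth_fun_on n U g"
  using Ck_on_cong[OF assms] by (simp add: smooth_fun_on_def)

lemma smooth_fun_on_subset: "smooth_fun_on n U f \<Longrightarrow> V \<subseteq> U \<Longrightarrow> smooth_fun_on n V f"
  by (simp add: smooth_fun_on_def Ck_on_subset[of n _ U f V])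

lemma smooth_fun_on_imp_continuous_on: "smooth_fun_on n U f \<Longrightarrow> continuous_on U f"
  using smooth_fun_onD Ck_on_imp_continuous_on by blast

lemma smooth_fun_on_local:
  assumes "U \<subseteq> eucl n"
    and "\<And>x. x \<in> U \<Longrightarrow> \<exists>V. openin (Euclidean_space n) V \<and> x \<in> V \<and> smooth_fun_on n (U \<inter> V) f"
  shows "smooth_fun_on n U f"
  unfolding smooth_fun_on_def
proof (intro allI Ck_on_local[OF assms(1)])
  fix k x assume "x \<in> U"
  with assms(2) obtain V where "openin (Euclidean_space n) V" "x \<in> V" "smooth_fun_on n (U \<inter> V) f"
    by blast
  then show "\<exists>V. openin (Euclidean_space n) V \<and> x \<in> V \<and> Ck_on n k (U \<inter> V) f"
    using smooth_fun_onD by blast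
qed

lemma smooth_fun_on_const: "openin (Euclidean_space n) U \<Longrightarrow> smooth_fun_on n U (\<lambda>x. c)"
  by (simp add: smooth_fun_on_def Ck_on_const)

lemma smooth_fun_on_proj: "openin (Euclidean_space n) U \<Longrightarrow> smooth_fun_on n U (\<lambda>x. x j)"
  by (simp add: smooth_fun_on_def Ck_on_proj)

lemma smooth_fun_on_add:
  "openin (Euclidean_space n) U \<Longrightarrow> smooth_fun_on n U f \<Longrightarrow> smooth_fun_on n U g \<Longrightarrow>
    smooth_fun_on n U (\<lambda>x. f x + g x)"
  by (simp add: smooth_fun_on_def Ck_on_add)

lemma smooth_fun_on_mult:
  "openin (Euclidean_space n) U \<Longrightarrow> smooth_fun_on n U f \<Longrightarrow> smooth_fun_on n U g \<Longrightarrow>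
    smooth_fun_on n U (\<lambda>x. f x * g x)"
  by (simp add: smooth_fun_on_def Ck_on_mult)

lemma smooth_fun_on_sum:
  "openin (Euclidean_space n) U \<Longrightarrow> (\<And>a. a \<in> A \<Longrightarrow> smooth_fun_on n U (f a)) \<Longrightarrow>
    smooth_fun_on n U (\<lambda>x. \<Sum>a\<in>A. f a x)"
  by (simp add: smooth_fun_on_def Ck_on_sum)

lemma smooth_fun_on_diff:
  assumes "openin (Euclidean_space n) U" and "smooth_fun_on n U f" and "smooth_fun_on n U g"
  shows "smooth_fun_on n U (\<lambda>x. f x - g x)"
  using smooth_fun_on_add[OF assms(1,2) smooth_fun_on_mult[OF assms(1) smooth_fun_on_const[OF assms(1), of "-1"] assms(3)]]
  by simp

lemma smooth_fun_on_partial_deriv: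
  "smooth_fun_on n U f \<Longrightarrow> i < n \<Longrightarrow> smooth_fun_on n U (partial_deriv i f)"
  unfolding smooth_fun_on_def using Ck_on.simps(2) by blast

lemma smooth_fun_on_compose_real:
  assumes "openin (Euclidean_space n) U" and "smooth_fun_on n U f" and "\<And>x. x \<in> U \<Longrightarrow> f x \<in> S"
    and "\<And>j t. t \<in> S \<Longrightarrow> (h j has_real_derivative h (Suc j) t) (at t)"
  shows "smooth_fun_on n U (\<lambda>x. h 0 (f x))"
  unfolding smooth_fun_on_def
  by (intro allI Ck_on_compose_real[where h = h and j = 0 and S = S] assms(1,3,4) smooth_fun_onD[OF assms(2)])

lemma smooth_fun_on_compose:
  assumes "openin (Euclidean_space p) U" and "smooth_fun_on p U G"
    and "openin (Euclidean_space n) W" and "\<And>j. j < p \<Longrightarrow> smooth_fun_on n W (\<lambda>x. y x j)"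
    and "\<And>x. x \<in> W \<Longrightarrow> y x \<in> U"
  shows "smooth_fun_on n W (\<lambda>x. G (y x))"
  unfolding smooth_fun_on_def
  using Ck_on_compose[OF assms(1) smooth_fun_onD[OF assms(2)] assms(3) smooth_fun_onD[OF assms(4)] assms(5)]
  by blast

lemma smooth_fun_on_inverse:
  assumes "openin (Euclidean_space n) U" and "smooth_fun_on n U f" and "\<And>x. x \<in> U \<Longrightarrow> f x \<noteq> 0"
  shows "smooth_fun_on n U (\<lambda>x. inverse (f x))"
proof -
  \<comment> \<open>The j-th derivative of the reciprocal function.\<close>
  define h :: "nat \<Rightarrow> real \<Rightarrow> real" where "h j t = (-1) ^ j * fact j * inverse t ^ Suc j" for j t
  have "(h j has_real_derivative h (Suc j) t) (at t)" if "t \<in> - {0}" for j t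
    unfolding h_def using that
    using DERIV_cmult[OF DERIV_power_Suc[OF DERIV_inverse[of t UNIV], of j], of "(-1) ^ j * fact j"]
    by (simp add: mult_ac)
  then have "smooth_fun_on n U (\<lambda>x. h 0 (f x))"
    using assms(3) by (intro smooth_fun_on_compose_real[OF assms(1,2), where S = "- {0}"]) auto
  then show ?thesis
    by (simp add: h_def)
qed

lemma partial_deriv_smooth_compose:
  assumes "openin (Euclidean_space p) U" and "smooth_fun_on p U G"
    and "openin (Euclidean_space n) W" and "\<And>j. j < p \<Longrightarrow> smooth_fun_on n W (\<lambda>x. y x j)"
    and "\<And>x. x \<in> W \<Longrightarrow> y x \<in> U" and "x \<in> W" and "i < n"
  shows "partial_deriv i (\<lambda>x. G (y x)) x =
      (\<Sum>j<p. partial_deriv j G (y x) * partial_deriv i (\<lambda>x. y x j) x)"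
  using DERIV_imp_deriv[OF partial_deriv_compose[OF assms(1) smooth_fun_onD[OF assms(2)] assms(3)
      smooth_fun_onD[OF assms(4)] assms(5-7)]]
  unfolding partial_deriv_def by simp

section \<open>Double sums\<close>

lemma sum_swap4:
  "(\<Sum>i\<in>A. \<Sum>j\<in>B. \<Sum>k\<in>C. \<Sum>l\<in>D. X i j k l) = (\<Sum>k\<in>C. \<Sum>l\<in>D. \<Sum>i\<in>A. \<Sum>j\<in>B. X i j k l)"
proof -
  have "(\<Sum>i\<in>A. \<Sum>j\<in>B. \<Sum>k\<in>C. \<Sum>l\<in>D. X i j k l) = (\<Sum>i\<in>A. \<Sum>k\<in>C. \<Sum>j\<in>B. \<Sum>l\<in>D. X i j k l)"
    by (intro sum.cong refl sum.swap)
  also have "\<dots> = (\<Sum>k\<in>C. \<Sum>i\<in>A. \<Sum>j\<in>B. \<Sum>l\<in>D. X i j k l)"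
    by (rule sum.swap)
  also have "\<dots> = (\<Sum>k\<in>C. \<Sum>i\<in>A. \<Sum>l\<in>D. \<Sum>j\<in>B. X i j k l)"
    by (intro sum.cong refl sum.swap)
  also have "\<dots> = (\<Sum>k\<in>C. \<Sum>l\<in>D. \<Sum>i\<in>A. \<Sum>j\<in>B. X i j k l)"
    by (intro sum.cong refl sum.swap)
  finally show ?thesis .
qed

text \<open>\<open>J\<close> plays the role of a differential. Positivity of a metric is transported
  with this along the group action, and a vector annihilated by an isometric map is seen to have
  length zero.\<close>

lemma quadratic_form_pullback:
  fixes J h :: "nat \<Rightarrow> nat \<Rightarrow> real"
  shows "(\<Sum>i<n. \<Sum>j<n. (\<Sum>k<m. \<Sum>l<m. J k i * J l j * h k l) * v i * v j) =
    (\<Sum>k<m. \<Sum>l<m. h k l * (\<Sum>i<n. J k i * v i) * (\<Sum>j<n. J l j * v j))"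
proof -
  have "(\<Sum>i<n. \<Sum>j<n. (\<Sum>k<m. \<Sum>l<m. J k i * J l j * h k l) * v i * v j) =
      (\<Sum>i<n. \<Sum>j<n. \<Sum>k<m. \<Sum>l<m. h k l * (J k i * v i) * (J l j * v j))"
    by (simp add: sum_distrib_left sum_distrib_right mult_ac)
  also have "\<dots> = (\<Sum>k<m. \<Sum>l<m. \<Sum>i<n. \<Sum>j<n. h k l * (J k i * v i) * (J l j * v j))"
    by (rule sum_swap4)
  also have "\<dots> = (\<Sum>k<m. \<Sum>l<m. h k l * (\<Sum>i<n. J k i * v i) * (\<Sum>j<n. J l j * v j))"
    by (simp add: sum_distrib_left sum_distrib_right mult_ac)
  finally show ?thesis .
qed

text \<open>Used with three kinds of matrices: a single vector for \<open>J\<close> gives the norm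
  of a linear image, a Jacobian for \<open>J\<close> gives the pullback of a Gram tensor, and an
  orthogonal \<open>F\<close> disappears from the right-hand side.\<close>

lemma gram_matrix_compose:
  fixes F J :: "nat \<Rightarrow> nat \<Rightarrow> real"
  shows "(\<Sum>k<m. (\<Sum>a<n. F k a * J a i) * (\<Sum>b<n. F k b * J b j)) =
    (\<Sum>a<n. \<Sum>b<n. J a i * J b j * (\<Sum>k<m. F k a * F k b))"
proof -
  have "(\<Sum>k<m. (\<Sum>a<n. F k a * J a i) * (\<Sum>b<n. F k b * J b j)) =
      (\<Sum>k<m. \<Sum>a<n. \<Sum>b<n. J a i * J b j * (F k a * F k b))"
    by (simp add: sum_product mult_ac)
  also have "\<dots> = (\<Sum>a<n. \<Sum>k<m. \<Sum>b<n. J a i * J b j * (F k a * F k b))"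
    by (rule sum.swap)
  also have "\<dots> = (\<Sum>a<n. \<Sum>b<n. \<Sum>k<m. J a i * J b j * (F k a * F k b))"
    by (intro sum.cong refl sum.swap)
  finally show ?thesis
    by (simp add: sum_distrib_left)
qed

section \<open>Charts and smooth maps\<close>

context
  fixes M :: "'a manifold" and c :: "'a chart"
  assumes M: "smooth_manifold M" and c: "c \<in> atlas M"
begin

lemma chart_dom_open: "openin (mtop M) (fst c)"
  using M c by (simp add: smooth_manifold_def)

lemma chart_dom_subset: "fst c \<subseteq> mpoints M"
  using chart_dom_open openin_subset by blast

lemma chart_image_open: "openin (Euclidean_space (mdim M)) (snd c ` fst c)"
  using M c by (simp add: smooth_manifold_def)

lemma chart_image_subset: "snd c ` fst c \<subseteq> eucl (mdim M)"
  using chart_image_open openin_subset by blast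

lemma chart_homeomorphic_map:
  "homeomorphic_map (subtopology (mtop M) (fst c))
     (subtopology (Euclidean_space (mdim M)) (snd c ` fst c)) (snd c)"
  using M c by (simp add: smooth_manifold_def)

lemma chart_inj: "inj_on (snd c) (fst c)"
  using homeomorphic_imp_injective_map[OF chart_homeomorphic_map] chart_dom_subset
  by (simp add: Int_absorb1)

lemma chart_inv_left [simp]: "p \<in> fst c \<Longrightarrow> chart_inv c (snd c p) = p"
  unfolding chart_inv_def using chart_inj by (simp add: inv_into_f_f)

lemma chart_image_subset_open:
  assumes "openin (mtop M) W" and "W \<subseteq> fst c"
  shows "openin (Euclidean_space (mdim M)) (snd c ` W)"
proof -
  have "openin (subtopology (mtop M) (fst c)) W"
    using assms chart_dom_open by (simp add: openin_open_subtopology)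
  then have "openin (subtopology (Euclidean_space (mdim M)) (snd c ` fst c)) (snd c ` W)"
    using homeomorphic_imp_open_map[OF chart_homeomorphic_map] by (simp add: open_map_def)
  then show ?thesis
    using chart_image_open by (simp add: openin_open_subtopology)
qed

lemma chart_continuous: "continuous_map (subtopology (mtop M) (fst c)) (Euclidean_space (mdim M)) (snd c)"
  using homeomorphic_imp_continuous_map[OF chart_homeomorphic_map] continuous_map_into_fulltopology
  by blast

lemma chart_preimage_open:
  assumes "openin (Euclidean_space (mdim M)) U"
  shows "openin (mtop M) {p \<in> fst c. snd c p \<in> U}"
proof -
  have "openin (subtopology (mtop M) (fst c)) {p \<in> topspace (subtopology (mtop M) (fst c)). snd c p \<in> U}"
    using chart_continuous assms openin_continuous_map_preimage by blast
  moreover have "{p \<in> topspace (subtopology (mtop M) (fst c)). snd c p \<in> U} = {p \<in> fst c. snd c p \<in> U}"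
    using chart_dom_subset by auto
  ultimately show ?thesis
    using chart_dom_open by (simp add: openin_open_subtopology)
qed

end

lemma chart_inv_right [simp]: "x \<in> snd c ` fst c \<Longrightarrow> snd c (chart_inv c x) = x"
  by (simp add: chart_inv_def f_inv_into_f)

lemma chart_inv_in: "x \<in> snd c ` fst c \<Longrightarrow> chart_inv c x \<in> fst c"
  by (simp add: chart_inv_def inv_into_into)

lemma atlas_cover:
  assumes "smooth_manifold M" and "p \<in> mpoints M"
  obtains c where "c \<in> atlas M" and "p \<in> fst c"
proof -
  have "p \<in> (\<Union>c\<in>atlas M. fst c)"
    using assms by (simp add: smooth_manifold_def)
  then show ?thesis
    using that by blast
qed

lemma smooth_manifold_euclidean: "smooth_manifold (euclidean_manifold n)"
proof -
  let ?c = "(eucl n, \<lambda>x. x) :: (nat \<Rightarrow> real) chart"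
  have inv: "chart_inv ?c x = x" if "x \<in> eucl n" for x
    using inv_into_f_f[of "\<lambda>x. x" "eucl n" x] that by (simp add: chart_inv_def)
  have "smooth_fun_on n (eucl n) (\<lambda>x. chart_inv ?c x j)" for j
  proof -
    have "smooth_fun_on n (eucl n) (\<lambda>x. x j)"
      by (simp add: smooth_fun_on_proj)
    moreover have "smooth_fun_on n (eucl n) (\<lambda>x. chart_inv ?c x j) \<longleftrightarrow> smooth_fun_on n (eucl n) (\<lambda>x. x j)"
      by (rule smooth_fun_on_cong) (use inv in auto)
    ultimately show ?thesis
      by simp
  qed
  then have 1: "smooth_vec_on n n (local_dom ?c ?c (\<lambda>p. p)) (local_rep ?c ?c (\<lambda>p. p))"
    by (simp add: smooth_vec_on_def local_dom_def local_rep_def o_def)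
  have 2: "homeomorphic_map (Euclidean_space n) (Euclidean_space n) (\<lambda>x. x)"
    using homeomorphic_map_id[of "Euclidean_space n"] by (simp add: id_def)
  have 3: "second_countable (Euclidean_space n)"
  proof -
    obtain B :: "(nat \<Rightarrow> real) set set" where B: "countable B" "topological_basis B"
      using ex_countable_basis by blast
    have "\<forall>U x. openin euclidean U \<and> x \<in> U \<longrightarrow> (\<exists>V\<in>B. x \<in> V \<and> V \<subseteq> U)"
      using topological_basisE[OF B(2)] by (metis open_openin)
    then have "second_countable (euclidean :: (nat \<Rightarrow> real) topology)"
      using B(1) topological_basis_open[OF B(2)] unfolding second_countable_def
      by (intro exI[of _ B]) simp
    then show ?thesis
      unfolding Euclidean_space_def euclidean_product_topology by (rule second_countable_subtopology)
  qed
  show ?thesis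
    unfolding smooth_manifold_def euclidean_manifold_def
    using 1 2 3 by (simp add: Hausdorff_Euclidean_space)
qed

lemma local_dom_subset: "local_dom c d f \<subseteq> snd c ` fst c"
  by (auto simp: local_dom_def)

lemma open_preimage_chart:
  assumes "smooth_manifold M" and "smooth_manifold M'" and "continuous_map (mtop M) (mtop M') f"
    and "c \<in> atlas M" and "d \<in> atlas M'"
  shows "openin (mtop M) {p \<in> fst c. f p \<in> fst d}"
proof -
  have "openin (mtop M) {p \<in> mpoints M. f p \<in> fst d}"
    using assms(3) chart_dom_open[OF assms(2,5)] openin_continuous_map_preimage by blast
  moreover have "{p \<in> fst c. f p \<in> fst d} = fst c \<inter> {p \<in> mpoints M. f p \<in> fst d}"
    using chart_dom_subset[OF assms(1,4)] by auto
  ultimately show ?thesis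
    using chart_dom_open[OF assms(1,4)] by (simp add: openin_Int)
qed

lemma local_dom_open:
  assumes "smooth_manifold M" and "smooth_manifold M'" and "continuous_map (mtop M) (mtop M') f"
    and "c \<in> atlas M" and "d \<in> atlas M'"
  shows "openin (Euclidean_space (mdim M)) (local_dom c d f)"
  unfolding local_dom_def
  using chart_image_subset_open[OF assms(1,4) open_preimage_chart[OF assms]] by auto

lemma smooth_map_continuous: "smooth_map M M' f \<Longrightarrow> continuous_map (mtop M) (mtop M') f"
  by (simp add: smooth_map_def)

lemma smooth_map_in: "smooth_map M M' f \<Longrightarrow> p \<in> mpoints M \<Longrightarrow> f p \<in> mpoints M'"
  using smooth_map_continuous continuous_map_image_subset_topspace by fastforce

lemma smooth_map_local_rep:
  "smooth_map M M' f \<Longrightarrow> c \<in> atlas M \<Longrightarrow> d \<in> atlas M' \<Longrightarrow> j < mdim M' \<Longrightarrow>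
    smooth_fun_on (mdim M) (local_dom c d f) (\<lambda>x. local_rep c d f x j)"
  by (simp add: smooth_map_def smooth_vec_on_def)

section \<open>Composition of smooth maps\<close>

context
  fixes M :: "'a manifold" and M' :: "'b manifold" and M'' :: "'c manifold" and f h c d e
  assumes M: "smooth_manifold M" and M': "smooth_manifold M'" and M'': "smooth_manifold M''"
    and f: "smooth_map M M' f" and h: "smooth_map M' M'' h"
    and c: "c \<in> atlas M" and d: "d \<in> atlas M'" and e: "e \<in> atlas M''"
begin

text \<open>The part of \<open>local_dom c e (h \<circ> f)\<close> where the composite can be read
  through the middle chart \<open>d\<close>. These parts cover it as \<open>d\<close> varies, so
  smoothness of the composite is checked on each.\<close>

definition compose_dom :: "(nat \<Rightarrow> real) set" where
  "compose_dom = snd c ` {p \<in> fst c. f p \<in> fst d \<and> h (f p) \<in> fst e}"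

lemma compose_dom_open: "openin (Euclidean_space (mdim M)) compose_dom"
proof -
  have "continuous_map (mtop M) (mtop M'') (h \<circ> f)"
    by (rule continuous_map_compose[OF smooth_map_continuous[OF f] smooth_map_continuous[OF h]])
  then have "openin (mtop M) {p \<in> fst c. (h \<circ> f) p \<in> fst e}"
    by (rule open_preimage_chart[OF M M'' _ c e])
  then have "openin (mtop M) ({p \<in> fst c. (h \<circ> f) p \<in> fst e} \<inter> {p \<in> fst c. f p \<in> fst d})"
    using open_preimage_chart[OF M M' smooth_map_continuous[OF f] c d] by (rule openin_Int)
  moreover have "{p \<in> fst c. (h \<circ> f) p \<in> fst e} \<inter> {p \<in> fst c. f p \<in> fst d} =
      {p \<in> fst c. f p \<in> fst d \<and> h (f p) \<in> fst e}"
    by auto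
  ultimately have "openin (mtop M) {p \<in> fst c. f p \<in> fst d \<and> h (f p) \<in> fst e}"
    by simp
  then show ?thesis
    unfolding compose_dom_def by (rule chart_image_subset_open[OF M c]) auto
qed

lemma local_rep_in_dom:
  assumes "x \<in> compose_dom"
  shows "local_rep c d f x \<in> local_dom d e h"
  using assms chart_inv_left[OF M c] by (auto simp: compose_dom_def local_rep_def local_dom_def)

lemma local_rep_compose:
  assumes "x \<in> compose_dom"
  shows "local_rep c e (h \<circ> f) x = local_rep d e h (local_rep c d f x)"
  using assms chart_inv_left[OF M c] chart_inv_left[OF M' d] by (auto simp: compose_dom_def local_rep_def)

lemma local_rep_smooth_on_dom:
  assumes "j < mdim M'"
  shows "smooth_fun_on (mdim M) compose_dom (\<lambda>x. local_rep c d f x j)"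
  by (rule smooth_fun_on_subset[OF smooth_map_local_rep[OF f c d assms]])
    (auto simp: compose_dom_def local_dom_def)

lemma local_rep_compose_smooth:
  assumes "j < mdim M''"
  shows "smooth_fun_on (mdim M) compose_dom (\<lambda>x. local_rep c e (h \<circ> f) x j)"
proof -
  have "smooth_fun_on (mdim M) compose_dom (\<lambda>x. local_rep d e h (local_rep c d f x) j)"
    by (rule smooth_fun_on_compose[OF local_dom_open[OF M' M'' smooth_map_continuous[OF h] d e]
          smooth_map_local_rep[OF h d e assms] compose_dom_open local_rep_smooth_on_dom local_rep_in_dom])
  then show ?thesis
    using smooth_fun_on_cong[OF compose_dom_open, of "\<lambda>x. local_rep c e (h \<circ> f) x j"] local_rep_compose by simp
qed

lemma coord_jacobian_compose:
  assumes "p \<in> fst c" and "f p \<in> fst d" and "h (f p) \<in> fst e" and "k < mdim M''" and "i < mdim M"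
  shows "coord_jacobian c e (h \<circ> f) p k i =
    (\<Sum>j<mdim M'. coord_jacobian d e h (f p) k j * coord_jacobian c d f p j i)"
proof -
  have x: "snd c p \<in> compose_dom"
    using assms by (auto simp: compose_dom_def)
  have "coord_jacobian c e (h \<circ> f) p k i =
      partial_deriv i (\<lambda>x. local_rep d e h (local_rep c d f x) k) (snd c p)"
    unfolding coord_jacobian_def
    by (rule partial_deriv_cong[OF compose_dom_open x assms(5)]) (simp add: local_rep_compose)
  also have "\<dots> = (\<Sum>j<mdim M'. partial_deriv j (\<lambda>y. local_rep d e h y k) (local_rep c d f (snd c p)) *
      partial_deriv i (\<lambda>x. local_rep c d f x j) (snd c p))"
    by (rule partial_deriv_smooth_compose[OF local_dom_open[OF M' M'' smooth_map_continuous[OF h] d e]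
          smooth_map_local_rep[OF h d e assms(4)] compose_dom_open local_rep_smooth_on_dom local_rep_in_dom x assms(5)])
  also have "local_rep c d f (snd c p) = snd d (f p)"
    using assms chart_inv_left[OF M c] by (simp add: local_rep_def)
  finally show ?thesis
    by (simp only: coord_jacobian_def)
qed

end

lemma smooth_map_compose:
  assumes M: "smooth_manifold M" and M': "smooth_manifold M'" and M'': "smooth_manifold M''"
    and f: "smooth_map M M' f" and h: "smooth_map M' M'' h"
  shows "smooth_map M M'' (h \<circ> f)"
  unfolding smooth_map_def smooth_vec_on_def
proof (intro conjI ballI allI impI)
  show "continuous_map (mtop M) (mtop M'') (h \<circ> f)"
    by (rule continuous_map_compose[OF smooth_map_continuous[OF f] smooth_map_continuous[OF h]])
  fix c e j assume c: "c \<in> atlas M" and e: "e \<in> atlas M''" and j: "j < mdim M''"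
  show "smooth_fun_on (mdim M) (local_dom c e (h \<circ> f)) (\<lambda>x. local_rep c e (h \<circ> f) x j)"
  proof (rule smooth_fun_on_local)
    show "local_dom c e (h \<circ> f) \<subseteq> eucl (mdim M)"
      using local_dom_subset chart_image_subset[OF M c] by blast
    fix x assume "x \<in> local_dom c e (h \<circ> f)"
    then obtain p where p: "p \<in> fst c" "h (f p) \<in> fst e" "x = snd c p"
      by (auto simp: local_dom_def)
    then have "f p \<in> mpoints M'"
      using smooth_map_in[OF f] chart_dom_subset[OF M c] by blast
    then obtain d where d: "d \<in> atlas M'" "f p \<in> fst d"
      using atlas_cover[OF M'] by metis
    let ?V = "compose_dom f h c d e"
    have "openin (Euclidean_space (mdim M)) ?V"
      by (rule compose_dom_open[OF M M' M'' f h c d(1) e])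
    moreover have "x \<in> ?V"
      using p d unfolding compose_dom_def[OF M M' M'' f h c d(1) e] by auto
    moreover have "smooth_fun_on (mdim M) (local_dom c e (h \<circ> f) \<inter> ?V) (\<lambda>x. local_rep c e (h \<circ> f) x j)"
      by (rule smooth_fun_on_subset[OF local_rep_compose_smooth[OF M M' M'' f h c d(1) e j]]) auto
    ultimately show "\<exists>V. openin (Euclidean_space (mdim M)) V \<and> x \<in> V \<and>
        smooth_fun_on (mdim M) (local_dom c e (h \<circ> f) \<inter> V) (\<lambda>x. local_rep c e (h \<circ> f) x j)"
      by blast
  qed
qed

section \<open>Maps into Euclidean spaces\<close>

definition smooth_real :: "'a manifold \<Rightarrow> ('a \<Rightarrow> real) \<Rightarrow> bool" where
  "smooth_real M f \<longleftrightarrow>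
     (\<forall>c\<in>atlas M. smooth_fun_on (mdim M) (snd c ` fst c) (\<lambda>x. f (chart_inv c x)))"

lemma continuous_map_charts:
  assumes M: "smooth_manifold M"
    and "\<And>c. c \<in> atlas M \<Longrightarrow> continuous_on (snd c ` fst c) (\<lambda>x. u (chart_inv c x))"
  shows "continuous_map (mtop M) euclidean u"
proof (rule pasting_lemma[where I = "atlas M" and T = fst and f = "\<lambda>_. u"])
  fix c assume c: "c \<in> atlas M"
  show "openin (mtop M) (fst c)"
    by (rule chart_dom_open[OF M c])
  have "continuous_map (subtopology (mtop M) (fst c)) (top_of_set (snd c ` fst c)) (snd c)"
  proof -
    show ?thesis
      using homeomorphic_imp_continuous_map[OF chart_homeomorphic_map[OF M c]]
      by (simp only: subtopology_eucl[OF chart_image_subset[OF M c]])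
  qed
  moreover have "continuous_map (top_of_set (snd c ` fst c)) euclidean (\<lambda>x. u (chart_inv c x))"
    using assms(2)[OF c] by simp
  ultimately have "continuous_map (subtopology (mtop M) (fst c)) euclidean ((\<lambda>x. u (chart_inv c x)) \<circ> snd c)"
    by (rule continuous_map_compose)
  then show "continuous_map (subtopology (mtop M) (fst c)) euclidean u"
    by (rule continuous_map_eq) (use chart_inv_left[OF M c] in auto)
next
  fix p assume "p \<in> mpoints M"
  then show "\<exists>c. c \<in> atlas M \<and> p \<in> fst c \<and> u p = u p"
    using atlas_cover[OF M] by metis
qed auto

text \<open>The single chart of the target is global, so continuity, which \<open>smooth_map\<close>
  demands separately, follows from that of the coordinate functions.\<close>

lemma smooth_map_euclidean_iff:
  assumes M: "smooth_manifold M"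
  shows "smooth_map M (euclidean_manifold D) u \<longleftrightarrow>
    u \<in> mpoints M \<rightarrow> eucl D \<and> (\<forall>j<D. smooth_real M (\<lambda>p. u p j))"
proof -
  let ?e = "(eucl D, \<lambda>x. x) :: (nat \<Rightarrow> real) chart"
  have dom: "local_dom c ?e u = snd c ` fst c" if "c \<in> atlas M" "u \<in> mpoints M \<rightarrow> eucl D" for c
    using that chart_dom_subset[OF M that(1)] by (fastforce simp: local_dom_def)
  have rep: "local_rep c ?e u x j = u (chart_inv c x) j" for c x j
    by (simp add: local_rep_def)
  have cont: "continuous_map (mtop M) (Euclidean_space D) u"
    if "u \<in> mpoints M \<rightarrow> eucl D" "\<forall>j<D. smooth_real M (\<lambda>p. u p j)"
  proof -
    have "continuous_on (snd c ` fst c) (\<lambda>x. u (chart_inv c x))" if c: "c \<in> atlas M" for c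
    proof (rule continuous_on_into_eucl[of D])
      show "continuous_on (snd c ` fst c) (\<lambda>x. u (chart_inv c x) j)" if "j < D" for j
        using \<open>\<forall>j<D. smooth_real M (\<lambda>p. u p j)\<close> that c
        by (auto simp: smooth_real_def intro: smooth_fun_on_imp_continuous_on)
      show "u (chart_inv c x) \<in> eucl D" if "x \<in> snd c ` fst c" for x
        using chart_inv_in[OF that] chart_dom_subset[OF M c] \<open>u \<in> mpoints M \<rightarrow> eucl D\<close> by auto
    qed
    then have "continuous_map (mtop M) euclidean u"
      by (rule continuous_map_charts[OF M])
    then show ?thesis
      using that(1) by (simp add: continuous_map_into_eucl)
  qed
  show ?thesis
  proof
    assume u: "smooth_map M (euclidean_manifold D) u"
    have 1: "u \<in> mpoints M \<rightarrow> eucl D"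
      using smooth_map_in[OF u] by (auto simp: euclidean_manifold_def)
    moreover have "smooth_real M (\<lambda>p. u p j)" if "j < D" for j
      unfolding smooth_real_def
    proof
      fix c assume c: "c \<in> atlas M"
      have "smooth_fun_on (mdim M) (local_dom c ?e u) (\<lambda>x. local_rep c ?e u x j)"
        by (rule smooth_map_local_rep[OF u c]) (use that in \<open>auto simp: euclidean_manifold_def\<close>)
      then show "smooth_fun_on (mdim M) (snd c ` fst c) (\<lambda>x. u (chart_inv c x) j)"
        by (simp add: dom[OF c 1] rep)
    qed
    ultimately show "u \<in> mpoints M \<rightarrow> eucl D \<and> (\<forall>j<D. smooth_real M (\<lambda>p. u p j))"
      by blast
  next
    assume u: "u \<in> mpoints M \<rightarrow> eucl D \<and> (\<forall>j<D. smooth_real M (\<lambda>p. u p j))"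
    then show "smooth_map M (euclidean_manifold D) u"
      using cont dom rep
      by (auto simp: smooth_map_def euclidean_manifold_def smooth_vec_on_def smooth_real_def)
  qed
qed

lemma smooth_map_euclidean_continuous:
  "smooth_map M (euclidean_manifold D) u \<Longrightarrow> continuous_map (mtop M) (Euclidean_space D) u"
  using smooth_map_continuous by (fastforce simp: euclidean_manifold_def)

abbreviation eucl_chart :: "nat \<Rightarrow> (nat \<Rightarrow> real) chart" where
  "eucl_chart D \<equiv> (eucl D, \<lambda>x. x)"

lemma euclidean_manifold_simps [simp]:
  "mtop (euclidean_manifold D) = Euclidean_space D"
  "mdim (euclidean_manifold D) = D"
  "atlas (euclidean_manifold D) = {eucl_chart D}"
  by (simp_all add: euclidean_manifold_def)

lemma coord_jacobian_euclidean:
  "coord_jacobian c (S, \<lambda>x. x) u p k i = partial_deriv i (\<lambda>x. u (chart_inv c x) k) (snd c p)"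
  by (simp add: coord_jacobian_def local_rep_def)

context
  fixes M :: "'a manifold"
  assumes M: "smooth_manifold M"
begin

lemma smooth_real_const: "smooth_real M (\<lambda>p. a)"
  unfolding smooth_real_def using chart_image_open[OF M] by (auto intro: smooth_fun_on_const)

lemma smooth_real_mult: "smooth_real M f \<Longrightarrow> smooth_real M h \<Longrightarrow> smooth_real M (\<lambda>p. f p * h p)"
  unfolding smooth_real_def using chart_image_open[OF M] by (auto intro: smooth_fun_on_mult)

lemma smooth_real_sum: "(\<And>a. a \<in> A \<Longrightarrow> smooth_real M (f a)) \<Longrightarrow> smooth_real M (\<lambda>p. \<Sum>a\<in>A. f a p)"
  unfolding smooth_real_def by (intro ballI smooth_fun_on_sum chart_image_open[OF M]) auto

lemma smooth_real_compose:
  assumes "smooth_map M (euclidean_manifold n) f" and "smooth_fun_on n (eucl n) b"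
  shows "smooth_real M (\<lambda>p. b (f p))"
  unfolding smooth_real_def
proof
  fix c assume c: "c \<in> atlas M"
  show "smooth_fun_on (mdim M) (snd c ` fst c) (\<lambda>x. b (f (chart_inv c x)))"
  proof (rule smooth_fun_on_compose[OF _ assms(2) chart_image_open[OF M c]])
    show "smooth_fun_on (mdim M) (snd c ` fst c) (\<lambda>x. f (chart_inv c x) j)" if "j < n" for j
      using assms(1) c that unfolding smooth_map_euclidean_iff[OF M] smooth_real_def by blast
    show "f (chart_inv c x) \<in> eucl n" if "x \<in> snd c ` fst c" for x
      using assms(1) chart_inv_in[OF that] chart_dom_subset[OF M c]
      unfolding smooth_map_euclidean_iff[OF M] by auto
  qed simp
qed

text \<open>Made for sums whose set of non-zero terms varies with the point: near any given point
  one fixed finite sum represents the function.\<close>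

lemma smooth_real_local:
  assumes "\<And>p. p \<in> mpoints M \<Longrightarrow> \<exists>W h. openin (mtop M) W \<and> p \<in> W \<and> smooth_real M h \<and> (\<forall>q\<in>W. f q = h q)"
  shows "smooth_real M f"
  unfolding smooth_real_def
proof
  fix c assume c: "c \<in> atlas M"
  show "smooth_fun_on (mdim M) (snd c ` fst c) (\<lambda>x. f (chart_inv c x))"
  proof (rule smooth_fun_on_local[OF chart_image_subset[OF M c]])
    fix x assume x: "x \<in> snd c ` fst c"
    then have "chart_inv c x \<in> mpoints M"
      using chart_inv_in[OF x] chart_dom_subset[OF M c] by blast
    then obtain W h where W: "openin (mtop M) W" "chart_inv c x \<in> W" "smooth_real M h" "\<forall>q\<in>W. f q = h q"
      using assms[of "chart_inv c x"] by blast
    let ?V = "snd c ` (fst c \<inter> W)"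
    have V: "openin (Euclidean_space (mdim M)) ?V"
      by (rule chart_image_subset_open[OF M c]) (use W(1) chart_dom_open[OF M c] in auto)
    have "snd c (chart_inv c x) \<in> ?V"
      by (rule imageI) (use chart_inv_in[OF x] W(2) in simp)
    then have "x \<in> ?V"
      using x by simp
    have "smooth_fun_on (mdim M) ?V (\<lambda>x. h (chart_inv c x))"
    proof (rule smooth_fun_on_subset)
      show "smooth_fun_on (mdim M) (snd c ` fst c) (\<lambda>x. h (chart_inv c x))"
        using W(3) c by (simp add: smooth_real_def)
    qed blast
    moreover have "smooth_fun_on (mdim M) ?V (\<lambda>x. f (chart_inv c x)) \<longleftrightarrow> smooth_fun_on (mdim M) ?V (\<lambda>x. h (chart_inv c x))"
      by (rule smooth_fun_on_cong[OF V]) (use W(4) chart_inv_left[OF M c] in auto)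
    ultimately have "smooth_fun_on (mdim M) (snd c ` fst c \<inter> ?V) (\<lambda>x. f (chart_inv c x))"
      using smooth_fun_on_subset[OF _ Int_lower2] by simp
    then show "\<exists>V. openin (Euclidean_space (mdim M)) V \<and> x \<in> V \<and>
        smooth_fun_on (mdim M) (snd c ` fst c \<inter> V) (\<lambda>x. f (chart_inv c x))"
      using V \<open>x \<in> ?V\<close> by (intro exI[of _ ?V] conjI)
  qed
qed

end

lemma smooth_real_inverse:
  assumes M: "smooth_manifold M" and "smooth_real M f" and "\<And>p. p \<in> mpoints M \<Longrightarrow> f p \<noteq> 0"
  shows "smooth_real M (\<lambda>p. inverse (f p))"
  unfolding smooth_real_def
proof
  fix c assume c: "c \<in> atlas M"
  show "smooth_fun_on (mdim M) (snd c ` fst c) (\<lambda>x. inverse (f (chart_inv c x)))"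
  proof (rule smooth_fun_on_inverse[OF chart_image_open[OF M c]])
    show "smooth_fun_on (mdim M) (snd c ` fst c) (\<lambda>x. f (chart_inv c x))"
      using assms(2) c by (simp add: smooth_real_def)
    show "f (chart_inv c x) \<noteq> 0" if "x \<in> snd c ` fst c" for x
      using assms(3) subsetD[OF chart_dom_subset[OF M c] chart_inv_in[OF that]] by simp
  qed
qed

section \<open>Bump functions\<close>

lemma poly_times_exp_tendsto_0: "((\<lambda>s. poly p s * exp (- s)) \<longlongrightarrow> 0) at_top" for p :: "real poly"
proof -
  have "((\<lambda>s. \<Sum>i\<le>degree p. poly.coeff p i * (s ^ i / exp s)) \<longlongrightarrow> (\<Sum>i\<le>degree p. poly.coeff p i * 0)) at_top"
    by (intro tendsto_sum tendsto_mult tendsto_const tendsto_power_div_exp_0)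
  then show ?thesis
    by (simp add: poly_altdef sum_distrib_right exp_minus divide_inverse mult.assoc)
qed

text \<open>With s = 1/t, the derivative of P(s) exp(-s) in t is s^2 (P(s) - P'(s)) exp(-s);
  \<open>[:0, 0, 1:]\<close> is the factor s^2.\<close>

primrec flat_poly :: "nat \<Rightarrow> real poly" where
  "flat_poly 0 = 1"
| "flat_poly (Suc k) = [:0, 0, 1:] * (flat_poly k - pderiv (flat_poly k))"

text \<open>The \<open>k\<close>-th derivative of \<open>t \<mapsto> exp (- 1 / t)\<close>, extended by 0 to \<open>t \<le> 0\<close>.\<close>

definition flat_exp :: "nat \<Rightarrow> real \<Rightarrow> real" where
  "flat_exp k t = (if t > 0 then poly (flat_poly k) (inverse t) * exp (- inverse t) else 0)"

text \<open>Since \<open>flat_exp k\<close> vanishes at 0, this quotient is its difference quotient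
  there. From the right, division by t only raises the degree of the polynomial in 1/t, and the
  exponential still dominates.\<close>

lemma flat_exp_tendsto: "((\<lambda>t. flat_exp k t / t) \<longlongrightarrow> 0) (at 0)"
proof -
  have "((\<lambda>t. poly (pCons 0 (flat_poly k)) (inverse t) * exp (- inverse t)) \<longlongrightarrow> 0) (at_right 0)"
    by (rule filterlim_compose[OF poly_times_exp_tendsto_0 filterlim_inverse_at_top_right])
  moreover have "\<forall>\<^sub>F t in at_right 0. poly (pCons 0 (flat_poly k)) (inverse t) * exp (- inverse t) = flat_exp k t / t"
    using eventually_at_right_less[of "0 :: real"] by eventually_elim (simp add: flat_exp_def divide_inverse mult_ac)
  ultimately have "((\<lambda>t. flat_exp k t / t) \<longlongrightarrow> 0) (at_right 0)"
    by (rule Lim_transform_eventually)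
  moreover have "((\<lambda>t. flat_exp k t / t) \<longlongrightarrow> 0) (at_left 0)"
  proof (rule Lim_transform_eventually[OF tendsto_const])
    have "\<forall>\<^sub>F t::real in at_left 0. t < 0"
      by (simp add: eventually_at_filter)
    then show "\<forall>\<^sub>F t in at_left 0. 0 = flat_exp k t / t"
      by eventually_elim (simp add: flat_exp_def)
  qed
  ultimately show ?thesis
    by (simp add: filterlim_split_at)
qed

lemma flat_exp_deriv: "(flat_exp k has_real_derivative flat_exp (Suc k) t) (at t)"
proof -
  consider "t > 0" | "t = 0" | "t < 0"
    by linarith
  then show ?thesis
  proof cases
    case 1
    have "((\<lambda>s. poly (flat_poly k) (inverse s) * exp (- inverse s)) has_real_derivative flat_exp (Suc k) t) (at t)"
      using 1 unfolding flat_exp_def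
      by (auto intro!: derivative_eq_intros DERIV_chain2[OF poly_DERIV]
          simp: field_simps power2_eq_square)
    moreover have "\<forall>\<^sub>F s in nhds t. poly (flat_poly k) (inverse s) * exp (- inverse s) = flat_exp k s"
      using eventually_nhds_in_open[of "{0<..}" t] 1 by (auto simp: flat_exp_def elim!: eventually_mono)
    then have "((\<lambda>s. poly (flat_poly k) (inverse s) * exp (- inverse s)) has_real_derivative flat_exp (Suc k) t) (at t) \<longleftrightarrow>
        (flat_exp k has_real_derivative flat_exp (Suc k) t) (at t)"
      by (intro DERIV_cong_ev) auto
    ultimately show ?thesis
      by simp
  next
    case 2
    then show ?thesis
      using flat_exp_tendsto[of k] by (simp add: has_field_derivative_iff flat_exp_def[of _ 0])
  next
    case 3
    have "\<forall>\<^sub>F s in nhds t. (0 :: real) = flat_exp k s"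
      using eventually_nhds_in_open[of "{..<0}" t] 3 by (auto simp: flat_exp_def elim!: eventually_mono)
    then have "((\<lambda>s. 0) has_real_derivative flat_exp (Suc k) t) (at t) \<longleftrightarrow>
        (flat_exp k has_real_derivative flat_exp (Suc k) t) (at t)"
      by (intro DERIV_cong_ev) auto
    moreover have "flat_exp (Suc k) t = 0"
      using 3 by (simp add: flat_exp_def)
    ultimately show ?thesis
      by simp
  qed
qed

text \<open>The parameter \<open>r\<close> is the square of a radius; using the squared norm keeps
  the argument polynomial and so smooth at the centre as well.\<close>

definition bump :: "nat \<Rightarrow> real \<Rightarrow> (nat \<Rightarrow> real) \<Rightarrow> real" where
  "bump n r y = flat_exp 0 (r - (\<Sum>i<n. y i * y i))"

lemma bump_nonneg: "bump n r y \<ge> 0"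
  by (simp add: bump_def flat_exp_def)

lemma bump_pos_iff: "bump n r y > 0 \<longleftrightarrow> (\<Sum>i<n. y i * y i) < r"
  by (simp add: bump_def flat_exp_def)

lemma bump_smooth: "smooth_fun_on n (eucl n) (bump n r)"
proof -
  have *: "openin (Euclidean_space n) (eucl n)"
    by simp
  have "smooth_fun_on n (eucl n) (\<lambda>y. r - (\<Sum>i<n. y i * y i))"
    by (intro smooth_fun_on_diff[OF *] smooth_fun_on_const[OF *] smooth_fun_on_sum[OF *]
        smooth_fun_on_mult[OF *] smooth_fun_on_proj[OF *])
  then have "smooth_fun_on n (eucl n) (\<lambda>y. flat_exp 0 (r - (\<Sum>i<n. y i * y i)))"
    by (rule smooth_fun_on_compose_real[where h = flat_exp and S = UNIV, OF * _ UNIV_I flat_exp_deriv])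
  then show ?thesis
    by (simp add: bump_def[abs_def])
qed

section \<open>Isometries of Euclidean space\<close>

abbreviation origin :: "nat \<Rightarrow> real" where
  "origin \<equiv> \<lambda>_. 0"

lemma origin_in_eucl [simp]: "origin \<in> eucl m"
  by (simp add: in_eucl)

lemma euclidean_dist_nonneg [simp]: "euclidean_dist m x y \<ge> 0"
  by (simp add: euclidean_dist_def)

lemma euclidean_dist_commute: "euclidean_dist m x y = euclidean_dist m y x"
  unfolding euclidean_dist_def L2_set_def by (simp add: power2_commute)

lemma euclidean_dist_self [simp]: "euclidean_dist m x x = 0"
  by (simp add: euclidean_dist_def L2_set_def)

lemma euclidean_dist_triangle: "euclidean_dist m x z \<le> euclidean_dist m x y + euclidean_dist m y z"
  using L2_set_triangle_ineq[of "\<lambda>i. x i - y i" "\<lambda>i. y i - z i" "{..<m}"]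
  by (simp add: euclidean_dist_def)

lemma coord_le_euclidean_dist: "i < m \<Longrightarrow> \<bar>x i - y i\<bar> \<le> euclidean_dist m x y"
  unfolding euclidean_dist_def L2_set_def
  by (rule real_le_rsqrt) (use member_le_sum[of i "{..<m}" "\<lambda>i. (x i - y i)\<^sup>2"] in simp)

lemma euclidean_dist_le_sum: "euclidean_dist m x y \<le> (\<Sum>i<m. \<bar>x i - y i\<bar>)"
  unfolding euclidean_dist_def by (rule L2_set_le_sum_abs)

lemma euclidean_dist_eq_0:
  assumes "x \<in> eucl m" and "y \<in> eucl m" and "euclidean_dist m x y = 0"
  shows "x = y"
proof
  fix i
  show "x i = y i"
    using coord_le_euclidean_dist[of i m x y] assms by (cases "i < m") (auto simp: in_eucl)
qed

lemma continuous_on_coord: "continuous_on S (\<lambda>x :: nat \<Rightarrow> real. x i)"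
  by (rule continuous_on_subset[OF continuous_on_product_coordinates]) simp

lemma continuous_on_euclidean_dist: "continuous_on S (\<lambda>x. euclidean_dist m x a)"
  unfolding euclidean_dist_def L2_set_def
  by (intro continuous_intros continuous_on_coord)

lemma continuous_map_eucl_coord:
  assumes "continuous_map X (Euclidean_space k) u"
  shows "continuous_map X euclideanreal (\<lambda>x. u x i)"
proof -
  have "continuous_map (Euclidean_space k) euclideanreal (\<lambda>y. y i)"
    by (simp add: continuous_map_Euclidean_space_iff continuous_on_coord)
  then show ?thesis
    using continuous_map_compose[OF assms] by (simp add: o_def)
qed

lemma continuous_map_euclI:
  assumes "\<And>i. i < k \<Longrightarrow> continuous_map X euclideanreal (\<lambda>x. u x i)" and "u \<in> topspace X \<rightarrow> eucl k"
  shows "continuous_map X (Euclidean_space k) u"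
proof -
  have "continuous_map X (Euclidean_space k) (\<lambda>x i. if i < k then u x i else 0)"
    using assms(1) by (simp add: continuous_map_componentwise_Euclidean_space)
  then show ?thesis
  proof (rule continuous_map_eq)
    fix x assume "x \<in> topspace X"
    then have "u x \<in> eucl k"
      using assms(2) by auto
    then show "(\<lambda>i. if i < k then u x i else 0) = u x"
      by (auto simp: in_eucl fun_eq_iff)
  qed
qed

lemma continuous_map_euclidean_dist:
  assumes "continuous_map X (Euclidean_space k) u"
  shows "continuous_map X euclideanreal (\<lambda>x. euclidean_dist k (u x) a)"
proof -
  have "continuous_map (Euclidean_space k) euclideanreal (\<lambda>y. euclidean_dist k y a)"
    by (simp add: continuous_map_Euclidean_space_iff continuous_on_euclidean_dist)
  then show ?thesis
    using continuous_map_compose[OF assms] by (simp add: o_def)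
qed

lemma compactin_bounded:
  assumes "compactin X K" and "continuous_map X (Euclidean_space k) u"
  obtains C where "\<And>x. x \<in> K \<Longrightarrow> euclidean_dist k (u x) a \<le> C"
proof -
  have "compactin euclideanreal ((\<lambda>x. euclidean_dist k (u x) a) ` K)"
    using continuous_map_euclidean_dist[OF assms(2)] assms(1) by (rule image_compactin[rotated])
  then have "bdd_above ((\<lambda>x. euclidean_dist k (u x) a) ` K)"
    by (intro bounded_imp_bdd_above compact_imp_bounded) simp
  then obtain C where "\<forall>v\<in>(\<lambda>x. euclidean_dist k (u x) a) ` K. v \<le> C"
    unfolding bdd_above_def by blast
  then show ?thesis
    using that by blast
qed

lemma openin_euclidean_ball: "openin (Euclidean_space m) {x \<in> eucl m. euclidean_dist m x a < r}"
proof -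
  have "openin (Euclidean_space m) (eucl m \<inter> (\<lambda>x. euclidean_dist m x a) -` {..<r})"
    by (rule openin_eucl_preimage[OF _ continuous_on_euclidean_dist]) auto
  moreover have "eucl m \<inter> (\<lambda>x. euclidean_dist m x a) -` {..<r} = {x \<in> eucl m. euclidean_dist m x a < r}"
    by auto
  ultimately show ?thesis
    by simp
qed

lemma closed_eucl: "closed (eucl m)"
  using closedin_Euclidean_imp_closed[of m "eucl m"] by simp

lemma closed_euclidean_cball: "closed {x \<in> eucl m. euclidean_dist m x a \<le> r}"
proof -
  have "closed (eucl m \<inter> (\<lambda>x. euclidean_dist m x a) -` {..r})"
    by (rule continuous_closed_preimage[OF continuous_on_euclidean_dist closed_eucl]) auto
  moreover have "eucl m \<inter> (\<lambda>x. euclidean_dist m x a) -` {..r} = {x \<in> eucl m. euclidean_dist m x a \<le> r}"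
    by auto
  ultimately show ?thesis
    by simp
qed

text \<open>A closed subset of a product of compact intervals whose factors are the point 0 from
  index m on.\<close>

lemma compact_euclidean_cball: "compact {x \<in> eucl m. euclidean_dist m x a \<le> r}"
proof -
  let ?B = "Pi\<^sub>E UNIV (\<lambda>i. if i < m then {a i - r..a i + r} else {0}) :: (nat \<Rightarrow> real) set"
  have "compactin (product_topology (\<lambda>_. euclidean) UNIV) ?B"
    by (simp add: compactin_PiE)
  then have "compact ?B"
    by (simp add: euclidean_product_topology)
  moreover have "{x \<in> eucl m. euclidean_dist m x a \<le> r} \<subseteq> ?B"
  proof
    fix x assume x: "x \<in> {x \<in> eucl m. euclidean_dist m x a \<le> r}"
    then have "\<bar>x i - a i\<bar> \<le> r" if "i < m" for i
      using coord_le_euclidean_dist[OF that, of x a] by simp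
    then show "x \<in> ?B"
      using x by (auto simp: PiE_iff in_eucl abs_le_iff algebra_simps)
  qed
  ultimately show ?thesis
    using compact_Int_closed[OF _ closed_euclidean_cball, of ?B m a r] by (simp add: Int_absorb1)
qed

section \<open>Isometries are affine\<close>

lemma euclidean_isometriesD:
  assumes "f \<in> euclidean_isometries m"
  shows "f \<in> Bij (eucl m)" and "x \<in> eucl m \<Longrightarrow> f x \<in> eucl m"
    and "x \<in> eucl m \<Longrightarrow> y \<in> eucl m \<Longrightarrow> euclidean_dist m (f x) (f y) = euclidean_dist m x y"
proof -
  show "f \<in> Bij (eucl m)"
    using assms by (simp add: euclidean_isometries_def)
  then show "f x \<in> eucl m" if "x \<in> eucl m"
    using that by (auto simp: Bij_def bij_betw_def)
  show "euclidean_dist m (f x) (f y) = euclidean_dist m x y" if "x \<in> eucl m" "y \<in> eucl m"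
    using assms that by (simp add: euclidean_isometries_def)
qed

text \<open>The vectors \<open>f e\<^sub>i - f 0\<close> are the columns of \<open>A\<close>. They are orthonormal by polarization, and
  \<open>f x - f 0 - A x\<close> has norm 0 by expanding its inner product with itself.\<close>

lemma euclidean_isometry_affine:
  assumes "f \<in> euclidean_isometries m"
  obtains A where "\<And>i j. i < m \<Longrightarrow> j < m \<Longrightarrow> (\<Sum>k<m. A k i * A k j) = (if i = j then 1 else 0)"
    and "\<And>x k. x \<in> eucl m \<Longrightarrow> k < m \<Longrightarrow> f x k = f origin k + (\<Sum>i<m. A k i * x i)"
proof -
  define F where "F x k = f x k - f origin k" for x k
  have sq: "(\<Sum>k<m. (F x k - F y k)\<^sup>2) = (\<Sum>k<m. (x k - y k)\<^sup>2)" if "x \<in> eucl m" "y \<in> eucl m" for x y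
    using euclidean_isometriesD(3)[OF assms that]
    by (simp add: F_def euclidean_dist_def L2_set_def)
  have F0: "F origin k = 0" for k
    by (simp add: F_def)
  have nrm: "(\<Sum>k<m. (F x k)\<^sup>2) = (\<Sum>k<m. (x k)\<^sup>2)" if "x \<in> eucl m" for x
    using sq[OF that, of origin] by (simp add: F0)
  have ip: "(\<Sum>k<m. F x k * F y k) = (\<Sum>k<m. x k * y k)" if "x \<in> eucl m" "y \<in> eucl m" for x y
  proof -
    have exp: "(\<Sum>k<m. (p k - q k)\<^sup>2) = (\<Sum>k<m. (p k)\<^sup>2) + (\<Sum>k<m. (q k)\<^sup>2) - 2 * (\<Sum>k<m. p k * q k)"
      for p q :: "nat \<Rightarrow> real"
      by (simp add: power2_diff sum.distrib sum_subtractf sum_distrib_left mult.assoc)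
    show ?thesis
      using sq[OF that] nrm[OF that(1)] nrm[OF that(2)] exp[of "F x" "F y"] exp[of x y] by simp
  qed
  define e where "e i = (\<lambda>k. if k = i then 1 else 0 :: real)" for i :: nat
  have e: "e i \<in> eucl m" if "i < m" for i
    using that by (auto simp: e_def in_eucl)
  have xe: "(\<Sum>k<m. x k * e i k) = x i" if "i < m" for x :: "nat \<Rightarrow> real" and i
    using that by (simp add: e_def if_distrib[of "(*) _"] cong: if_cong)
  define A where "A k i = F (e i) k" for k i
  have orth: "(\<Sum>k<m. A k i * A k j) = (if i = j then 1 else 0)" if "i < m" "j < m" for i j
    using ip[OF e[OF that(1)] e[OF that(2)]] xe[OF that(2), of "e i"] by (simp add: A_def) (simp add: e_def)
  have aff: "f x k = f origin k + (\<Sum>i<m. A k i * x i)" if x: "x \<in> eucl m" and k: "k < m" for x k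
  proof -
    define S where "S k = (\<Sum>i<m. A k i * x i)" for k
    have 1: "(\<Sum>k<m. F x k * S k) = (\<Sum>i<m. x i * x i)"
    proof -
      have "(\<Sum>k<m. F x k * S k) = (\<Sum>k<m. \<Sum>i<m. x i * (F x k * F (e i) k))"
        by (simp add: S_def A_def sum_distrib_left mult_ac)
      also have "\<dots> = (\<Sum>i<m. \<Sum>k<m. x i * (F x k * F (e i) k))"
        by (rule sum.swap)
      also have "\<dots> = (\<Sum>i<m. x i * (\<Sum>k<m. F x k * F (e i) k))"
        by (simp add: sum_distrib_left)
      also have "\<dots> = (\<Sum>i<m. x i * x i)"
        by (intro sum.cong refl) (simp add: ip[OF x e] xe)
      finally show ?thesis .
    qed
    have 2: "(\<Sum>k<m. S k * S k) = (\<Sum>i<m. x i * x i)"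
    proof -
      have "(\<Sum>k<m. S k * S k) = (\<Sum>a<m. \<Sum>b<m. x a * x b * (\<Sum>k<m. A k a * A k b))"
        unfolding S_def by (rule gram_matrix_compose[where J = "\<lambda>a _. x a"])
      also have "\<dots> = (\<Sum>a<m. \<Sum>b<m. x a * x b * (if a = b then 1 else 0))"
        by (intro sum.cong refl) (simp add: orth)
      also have "\<dots> = (\<Sum>i<m. x i * x i)"
        by (simp add: if_distrib[of "(*) _"] cong: if_cong)
      finally show ?thesis .
    qed
    have 3: "(\<Sum>k<m. F x k * F x k) = (\<Sum>i<m. x i * x i)"
      by (rule ip[OF x x])
    have "(\<Sum>k<m. (F x k - S k)\<^sup>2) = (\<Sum>k<m. F x k * F x k) - 2 * (\<Sum>k<m. F x k * S k) + (\<Sum>k<m. S k * S k)"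
      by (simp add: power2_eq_square algebra_simps sum.distrib sum_subtractf sum_distrib_left)
    then have "(\<Sum>k<m. (F x k - S k)\<^sup>2) = 0"
      by (simp add: 1 2 3)
    then have "(F x k - S k)\<^sup>2 = 0"
      using k by (subst (asm) sum_nonneg_eq_0_iff) auto
    then show ?thesis
      by (simp add: F_def S_def)
  qed
  show ?thesis
    using that orth aff by blast
qed

lemma euclidean_isometry_continuous:
  assumes "f \<in> euclidean_isometries m"
  shows "continuous_map (Euclidean_space m) (Euclidean_space m) f"
proof -
  obtain A where A: "\<And>x k. x \<in> eucl m \<Longrightarrow> k < m \<Longrightarrow> f x k = f origin k + (\<Sum>i<m. A k i * x i)"
    using euclidean_isometry_affine[OF assms] by metis
  have "continuous_on (eucl m) f"
  proof (rule continuous_on_into_eucl[of m])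
    show "continuous_on (eucl m) (\<lambda>x. f x k)" if "k < m" for k
    proof -
      have "continuous_on (eucl m) (\<lambda>x. f origin k + (\<Sum>i<m. A k i * x i))"
        by (intro continuous_intros continuous_on_coord)
      then show ?thesis
        by (rule continuous_on_eq) (rule A[OF _ that, symmetric])
    qed
  qed (rule euclidean_isometriesD(2)[OF assms])
  then show ?thesis
    using euclidean_isometriesD(2)[OF assms]
    by (simp add: continuous_map_into_eucl continuous_map_Euclidean_space_iff Pi_iff)
qed

lemma isom_hom_action:
  assumes "group G" and "\<rho> \<in> hom G (isom_group m)"
  shows "group_action G (eucl m) \<rho>"
proof -
  have "\<rho> g \<in> euclidean_isometries m" if "g \<in> carrier G" for g
    using assms(2) that by (auto simp: hom_def isom_group_def)
  then have 1: "\<rho> g \<in> Bij (eucl m)" if "g \<in> carrier G" for g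
    using that euclidean_isometriesD(1) by blast
  have "\<rho> \<in> hom G (BijGroup (eucl m))"
  proof (rule homI)
    show "\<rho> g \<in> carrier (BijGroup (eucl m))" if "g \<in> carrier G" for g
      using 1[OF that] by (simp add: BijGroup_def)
    show "\<rho> (g \<otimes>\<^bsub>G\<^esub> h) = \<rho> g \<otimes>\<^bsub>BijGroup (eucl m)\<^esub> \<rho> h" if "g \<in> carrier G" "h \<in> carrier G" for g h
      using hom_mult[OF assms(2) that] by (simp add: isom_group_def)
  qed
  then show ?thesis
    using assms(1) group_BijGroup by (simp add: group_action_def group_hom_def group_hom_axioms_def)
qed

lemma hom_isom_group_in:
  "\<rho> \<in> hom G (isom_group m) \<Longrightarrow> g \<in> carrier G \<Longrightarrow> \<rho> g \<in> euclidean_isometries m"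
  by (auto simp: hom_def isom_group_def)

section \<open>Orbits and the quotient topology\<close>

lemma (in group_action) orbit_image:
  assumes "g \<in> carrier G" and "x \<in> E"
  shows "orbit G \<phi> (\<phi> g x) = orbit G \<phi> x"
proof -
  have E: "\<phi> g x \<in> E"
    using element_image assms by blast
  have 1: "\<phi> g x \<in> orbit G \<phi> x"
    using assms by (auto simp: orbit_def)
  then have 2: "x \<in> orbit G \<phi> (\<phi> g x)"
    using orbit_sym assms(2) E by blast
  have in_E: "z \<in> E" if "z \<in> orbit G \<phi> y" "y \<in> E" for y z
    using that element_image by (auto simp: orbit_def)
  show ?thesis
  proof (intro equalityI subsetI)
    show "z \<in> orbit G \<phi> x" if "z \<in> orbit G \<phi> (\<phi> g x)" for z
      using orbit_trans[OF assms(2) E in_E[OF that E] 1 that] .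
    show "z \<in> orbit G \<phi> (\<phi> g x)" if "z \<in> orbit G \<phi> x" for z
      using orbit_trans[OF E assms(2) in_E[OF that assms(2)] 2 that] .
  qed
qed

lemma topspace_quotient_topology: "topspace (quotient_topology T q) = q ` topspace T"
proof
  show "topspace (quotient_topology T q) \<subseteq> q ` topspace T"
    using openin_topspace[of "quotient_topology T q"] unfolding openin_quotient_topology by blast
  have "{x \<in> topspace T. q x \<in> q ` topspace T} = topspace T"
    by auto
  then have "openin (quotient_topology T q) (q ` topspace T)"
    unfolding openin_quotient_topology by simp
  then show "q ` topspace T \<subseteq> topspace (quotient_topology T q)"
    by (rule openin_subset)
qed

lemma (in group_action) orbit_eqD:
  assumes "x \<in> E" and "y \<in> E" and "orbit G \<phi> x = orbit G \<phi> y"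
  obtains g where "g \<in> carrier G" and "y = \<phi> g x"
proof -
  have "y \<in> orbit G \<phi> x"
    using orbit_refl[OF assms(2)] assms(3) by simp
  then show ?thesis
    using that by (auto simp: orbit_def)
qed

lemma orbit_preimage:
  assumes act: "group_action G (topspace T) \<phi>" and U: "U \<subseteq> topspace T"
  shows "{x \<in> topspace T. orbit G \<phi> x \<in> orbit G \<phi> ` U} =
    (\<Union>g\<in>carrier G. {x \<in> topspace T. \<phi> g x \<in> U})"
proof -
  interpret group_action G "topspace T" \<phi>
    by (rule act)
  show ?thesis
  proof (intro equalityI subsetI)
    fix x assume "x \<in> {x \<in> topspace T. orbit G \<phi> x \<in> orbit G \<phi> ` U}"
    then obtain y where y: "x \<in> topspace T" "y \<in> U" "orbit G \<phi> x = orbit G \<phi> y"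
      by blast
    have "y \<in> topspace T"
      using U y(2) by blast
    then obtain g where "g \<in> carrier G" "y = \<phi> g x"
      by (rule orbit_eqD[OF y(1) _ y(3)])
    then show "x \<in> (\<Union>g\<in>carrier G. {x \<in> topspace T. \<phi> g x \<in> U})"
      using y by blast
  next
    fix x assume "x \<in> (\<Union>g\<in>carrier G. {x \<in> topspace T. \<phi> g x \<in> U})"
    then obtain g where g: "g \<in> carrier G" "x \<in> topspace T" "\<phi> g x \<in> U"
      by blast
    then have "orbit G \<phi> (\<phi> g x) = orbit G \<phi> x"
      by (intro orbit_image)
    then show "x \<in> {x \<in> topspace T. orbit G \<phi> x \<in> orbit G \<phi> ` U}"
      using g imageI[of "\<phi> g x" U "orbit G \<phi>"] by simp
  qed
qed

text \<open>The saturation of U is the union of the preimages of U under the group elements, which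
  are open by continuity.\<close>

lemma orbit_map_open:
  assumes "group_action G (topspace T) \<phi>"
    and "\<And>g. g \<in> carrier G \<Longrightarrow> continuous_map T T (\<phi> g)" and U: "openin T U"
  shows "openin (quotient_topology T (orbit G \<phi>)) (orbit G \<phi> ` U)"
  unfolding openin_quotient_topology orbit_preimage[OF assms(1) openin_subset[OF U]]
  using openin_subset[OF U] openin_continuous_map_preimage[OF assms(2) U] by auto

text \<open>Images of an increasing open exhaustion cover the compact quotient, so a single one of
  them does. With balls for \<open>U k\<close>, every orbit meets one fixed ball; this is the form
  in which cocompactness is used, in \<open>\<real>\<^sup>m\<close> as well as in
  \<open>M\<close>.\<close>

lemma cocompact_exhaustion:
  assumes coc: "cocompact_action G T \<phi>" and act: "group_action G (topspace T) \<phi>"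
    and cont: "\<And>g. g \<in> carrier G \<Longrightarrow> continuous_map T T (\<phi> g)"
    and U: "\<And>k::nat. openin T (U k)" "\<And>k. U k \<subseteq> U (Suc k)" "topspace T \<subseteq> (\<Union>k. U k)"
  obtains k where "\<And>x. x \<in> topspace T \<Longrightarrow> \<exists>g\<in>carrier G. \<phi> g x \<in> U k"
proof -
  let ?q = "orbit G \<phi>"
  note pre = orbit_preimage[OF act openin_subset[OF U(1)]]
  note op = orbit_map_open[OF act cont U(1)]
  have "compactin (quotient_topology T ?q) (?q ` topspace T)"
    using coc by (simp add: cocompact_action_def compact_space_def topspace_quotient_topology)
  moreover have "?q ` topspace T \<subseteq> \<Union>(range (\<lambda>k. ?q ` U k))"
    using U(3) by blast
  moreover have "\<forall>W\<in>range (\<lambda>k. ?q ` U k). openin (quotient_topology T ?q) W"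
    using op by blast
  ultimately obtain \<F> where \<F>: "finite \<F>" "\<F> \<subseteq> range (\<lambda>k. ?q ` U k)" "?q ` topspace T \<subseteq> \<Union>\<F>"
    unfolding compactin_def by meson
  then obtain I where I: "finite I" "\<F> = (\<lambda>k. ?q ` U k) ` I"
    using finite_subset_image[OF \<F>(1,2)] by auto
  have mono: "U i \<subseteq> U j" if "i \<le> j" for i j
    using lift_Suc_mono_le[of U] U(2) that by blast
  show ?thesis
  \<comment> \<open>For empty I there is no point \<open>x\<close> at all, so the unspecified
    \<open>Max {}\<close> is harmless.\<close>
  proof (rule that[of "Max I"])
    fix x assume x: "x \<in> topspace T"
    then obtain i where i: "i \<in> I" "?q x \<in> ?q ` U i"
      using \<F>(3) I(2) by blast
    then have "?q x \<in> ?q ` U (Max I)"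
      using mono[of i "Max I"] I(1) by auto
    then show "\<exists>g\<in>carrier G. \<phi> g x \<in> U (Max I)"
      using pre[of "Max I"] x by blast
  qed
qed

section \<open>Bieberbach groups acting on Euclidean space\<close>

text \<open>Discreteness is given in the topology of pointwise convergence; what the later arguments
  want is a count: finitely many elements move the origin by a bounded amount. With that count an
  element fixing a point has finite order, and torsion-freeness makes the action free. Cocompactness
  becomes a ball meeting every orbit.\<close>

lemma bieberbach_group_action:
  assumes "bieberbach_group G"
  obtains m \<rho> where "\<rho> \<in> hom G (isom_group m)"
    and "\<And>g x. g \<in> carrier G \<Longrightarrow> x \<in> eucl m \<Longrightarrow> \<rho> g x = x \<Longrightarrow> g = \<one>\<^bsub>G\<^esub>"
    and "\<And>r. finite {g \<in> carrier G. euclidean_dist m (\<rho> g origin) origin \<le> r}"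
    and "\<exists>r. \<forall>x\<in>eucl m. \<exists>g\<in>carrier G. euclidean_dist m (\<rho> g x) origin < r"
proof -
  obtain m H where G: "group G" and H: "subgroup H (isom_group m)"
    and tf: "torsion_free (isom_group m \<lparr>carrier := H\<rparr>)"
    and disc: "subtopology (isom_topology m) H = discrete_topology H"
    and coc: "cocompact_action (isom_group m \<lparr>carrier := H\<rparr>) (Euclidean_space m) (\<lambda>h. h)"
    and iso: "G \<cong> isom_group m \<lparr>carrier := H\<rparr>"
    using assms unfolding bieberbach_group_def by blast
  let ?K = "isom_group m \<lparr>carrier := H\<rparr>"
  obtain \<rho> where \<rho>: "\<rho> \<in> iso G ?K"
    using iso unfolding is_iso_def by blast
  have HE: "H \<subseteq> euclidean_isometries m"
    using subgroup.subset[OF H] by (simp add: isom_group_def)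
  have inj: "inj_on \<rho> (carrier G)" and img: "\<rho> ` carrier G = H"
    using \<rho> by (auto simp: iso_def bij_betw_def)
  have homK: "\<rho> \<in> hom G ?K"
    using \<rho> by (simp add: iso_def)
  have hom: "\<rho> \<in> hom G (isom_group m)"
    using homK HE by (auto simp: hom_def isom_group_def)
  interpret G: group G
    by (rule G)
  interpret A: group_action G "eucl m" \<rho>
    by (rule isom_hom_action[OF G hom])
  have one: "\<rho> \<one>\<^bsub>G\<^esub> = (\<lambda>x\<in>eucl m. x)"
    using A.id_eq_one by simp
  note isoD = euclidean_isometriesD[OF hom_isom_group_in[OF hom]]
  \<comment> \<open>Comparing two elements is the same as measuring the displacement by their
    quotient, which brings in neighbourhoods of the identity.\<close>
  have shift: "euclidean_dist m (\<rho> (inv\<^bsub>G\<^esub> h \<otimes>\<^bsub>G\<^esub> g) x) x = euclidean_dist m (\<rho> g x) (\<rho> h x)"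
    if "g \<in> carrier G" "h \<in> carrier G" "x \<in> eucl m" for g h x
  proof -
    have "\<rho> (inv\<^bsub>G\<^esub> h) (\<rho> h x) = x"
      by (rule A.orbit_sym_aux[OF that(2,3) refl])
    moreover have "\<rho> (inv\<^bsub>G\<^esub> h \<otimes>\<^bsub>G\<^esub> g) x = \<rho> (inv\<^bsub>G\<^esub> h) (\<rho> g x)"
      using A.composition_rule that by simp
    ultimately have "euclidean_dist m (\<rho> (inv\<^bsub>G\<^esub> h \<otimes>\<^bsub>G\<^esub> g) x) x =
        euclidean_dist m (\<rho> (inv\<^bsub>G\<^esub> h) (\<rho> g x)) (\<rho> (inv\<^bsub>G\<^esub> h) (\<rho> h x))"
      by simp
    also have "\<dots> = euclidean_dist m (\<rho> g x) (\<rho> h x)"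
      using isoD(3)[of "inv\<^bsub>G\<^esub> h" "\<rho> g x" "\<rho> h x"] isoD(2) that by simp
    finally show ?thesis .
  qed
  \<comment> \<open>An open set that isolates the identity in \<open>H\<close> contains a basic one,
    and this restricts the images of a finite set \<open>X\<close> only; \<delta> is a common
    tolerance for these points.\<close>
  obtain X \<delta> where X: "finite X" "X \<subseteq> eucl m" and \<delta>: "\<delta> > 0"
    and near: "\<And>g. g \<in> carrier G \<Longrightarrow> (\<And>x. x \<in> X \<Longrightarrow> euclidean_dist m (\<rho> g x) x < \<delta>) \<Longrightarrow> g = \<one>\<^bsub>G\<^esub>"
  proof -
    have "\<rho> \<one>\<^bsub>G\<^esub> \<in> H"
      using img by auto
    then have "openin (subtopology (isom_topology m) H) {\<rho> \<one>\<^bsub>G\<^esub>}"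
      using disc by simp
    then obtain U where U: "openin (product_topology (\<lambda>_. Euclidean_space m) (eucl m)) U"
      "{\<rho> \<one>\<^bsub>G\<^esub>} = U \<inter> (euclidean_isometries m \<inter> H)"
      unfolding isom_topology_def subtopology_subtopology openin_subtopology by auto
    then have "\<rho> \<one>\<^bsub>G\<^esub> \<in> U"
      by blast
    then obtain V where V: "finite {x \<in> eucl m. V x \<noteq> eucl m}" "\<And>x. x \<in> eucl m \<Longrightarrow> openin (Euclidean_space m) (V x)"
      "\<rho> \<one>\<^bsub>G\<^esub> \<in> Pi\<^sub>E (eucl m) V" "Pi\<^sub>E (eucl m) V \<subseteq> U"
      using U(1) unfolding openin_product_topology_alt by meson
    let ?X = "{x \<in> eucl m. V x \<noteq> eucl m}"
    have "\<exists>d>0. \<forall>y\<in>eucl m. euclidean_dist m y x < d \<longrightarrow> y \<in> V x" if x: "x \<in> ?X" for x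
    proof -
      have "x \<in> V x"
        using V(3) x one by (auto simp: PiE_iff)
      then obtain d where "d > 0" "ebox m x d \<subseteq> V x"
        using openin_eucl_ebox[OF V(2)] x by blast
      moreover have "y \<in> ebox m x d" if "y \<in> eucl m" "euclidean_dist m y x < d" for y
        using that coord_le_euclidean_dist[of _ m y x] by (fastforce simp: ebox_def)
      ultimately show ?thesis
        by blast
    qed
    then have "\<forall>x\<in>?X. \<exists>d>0. \<forall>y\<in>eucl m. euclidean_dist m y x < d \<longrightarrow> y \<in> V x"
      by blast
    from bchoice[OF this] obtain d where d: "\<And>x. x \<in> ?X \<Longrightarrow> d x > 0"
      "\<And>x y. x \<in> ?X \<Longrightarrow> y \<in> eucl m \<Longrightarrow> euclidean_dist m y x < d x \<Longrightarrow> y \<in> V x"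
      by blast
    define \<delta> where "\<delta> = Min (insert 1 (d ` ?X))"
    have \<delta>: "\<delta> > 0" "\<And>x. x \<in> ?X \<Longrightarrow> \<delta> \<le> d x"
      using V(1) d(1) by (auto simp: \<delta>_def)
    show ?thesis
    proof (rule that[OF V(1) _ \<delta>(1)])
      fix g assume g: "g \<in> carrier G" and close: "\<And>x. x \<in> ?X \<Longrightarrow> euclidean_dist m (\<rho> g x) x < \<delta>"
      have "\<rho> g x \<in> V x" if x: "x \<in> eucl m" for x
      proof (cases "x \<in> ?X")
        case True
        then show ?thesis
          using close[OF True] \<delta>(2)[OF True] isoD(2)[OF g x] by (intro d(2)) auto
      qed (use isoD(2)[OF g x] x in auto)
      moreover have "\<rho> g \<in> extensional (eucl m)"
        using isoD(1)[OF g] by (simp add: Bij_def)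
      ultimately have "\<rho> g \<in> Pi\<^sub>E (eucl m) V"
        by (simp only: PiE_iff) blast
      then have "\<rho> g \<in> U"
        using V(4) by blast
      moreover have "\<rho> g \<in> H" "\<rho> g \<in> euclidean_isometries m"
        using img g HE by auto
      ultimately have "\<rho> g = \<rho> \<one>\<^bsub>G\<^esub>"
        using U(2) by blast
      then show "g = \<one>\<^bsub>G\<^esub>"
        using inj_onD[OF inj] g by simp
    qed auto
  qed
  have fin: "finite {g \<in> carrier G. euclidean_dist m (\<rho> g origin) origin \<le> r}" for r
  proof -
    define S where "S = {g \<in> carrier G. euclidean_dist m (\<rho> g origin) origin \<le> r}"
    \<comment> \<open>The mesh of a grid. Two elements whose values lie in the same cells at every
      point of \<open>X\<close> differ there by at most m \<eta> < \<delta>, so they are equal.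
      \<open>B\<close> bounds all coordinates, so only finitely many patterns of cells
      occur.\<close>
    define \<eta> where "\<eta> = \<delta> / (real m + 1)"
    have \<eta>: "\<eta> > 0"
      using \<delta> by (simp add: \<eta>_def)
    define B where "B = r + (\<Sum>x\<in>X. euclidean_dist m x origin)"
    define code where "code g = (\<lambda>(x, k)\<in>X \<times> {..<m}. \<lfloor>\<rho> g x k / \<eta>\<rfloor>)" for g
    have "code g \<in> Pi\<^sub>E (X \<times> {..<m}) (\<lambda>_. {\<lfloor>- B / \<eta>\<rfloor>..\<lfloor>B / \<eta>\<rfloor>})" if g: "g \<in> S" for g
    proof -
      have "\<lfloor>\<rho> g x k / \<eta>\<rfloor> \<in> {\<lfloor>- B / \<eta>\<rfloor>..\<lfloor>B / \<eta>\<rfloor>}" if x: "x \<in> X" and k: "k < m" for x k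
      proof -
        have gG: "g \<in> carrier G" and xE: "x \<in> eucl m"
          using g x X(2) by (auto simp: S_def)
        have "\<bar>\<rho> g x k\<bar> \<le> euclidean_dist m (\<rho> g x) origin"
          using coord_le_euclidean_dist[OF k, of "\<rho> g x" origin] by simp
        also have "\<dots> \<le> euclidean_dist m (\<rho> g x) (\<rho> g origin) + euclidean_dist m (\<rho> g origin) origin"
          by (rule euclidean_dist_triangle)
        also have "\<dots> \<le> euclidean_dist m x origin + r"
          using isoD(3)[OF gG xE origin_in_eucl] g by (simp add: S_def)
        also have "\<dots> \<le> B"
          using member_le_sum[OF x _ X(1), of "\<lambda>x. euclidean_dist m x origin"] by (simp add: B_def)
        finally have "- B \<le> \<rho> g x k" "\<rho> g x k \<le> B"
          by linarith+
        then have "- B / \<eta> \<le> \<rho> g x k / \<eta>" "\<rho> g x k / \<eta> \<le> B / \<eta>"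
          using \<eta> by (intro divide_right_mono; simp)+
        then show ?thesis
          by (auto intro: floor_mono)
      qed
      then show ?thesis
        by (auto simp: code_def)
    qed
    moreover have "finite (Pi\<^sub>E (X \<times> {..<m}) (\<lambda>_. {\<lfloor>- B / \<eta>\<rfloor>..\<lfloor>B / \<eta>\<rfloor>}))"
      using X(1) by (intro finite_PiE) auto
    ultimately have "finite (code ` S)"
      by (meson finite_subset image_subsetI)
    moreover have "inj_on code S"
    proof (rule inj_onI)
      fix g h assume g: "g \<in> S" and h: "h \<in> S" and eq: "code g = code h"
      then have gG: "g \<in> carrier G" and hG: "h \<in> carrier G"
        by (auto simp: S_def)
      have "euclidean_dist m (\<rho> (inv\<^bsub>G\<^esub> h \<otimes>\<^bsub>G\<^esub> g) x) x < \<delta>" if x: "x \<in> X" for x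
      proof -
        have "\<bar>\<rho> g x k - \<rho> h x k\<bar> \<le> \<eta>" if k: "k < m" for k
        proof -
          have "\<lfloor>\<rho> g x k / \<eta>\<rfloor> = \<lfloor>\<rho> h x k / \<eta>\<rfloor>"
            using fun_cong[OF eq, of "(x, k)"] x k by (simp add: code_def)
          then have "\<bar>\<rho> g x k / \<eta> - \<rho> h x k / \<eta>\<bar> \<le> 1"
            by linarith
          then show ?thesis
            using \<eta> by (simp add: abs_le_iff field_simps)
        qed
        then have "(\<Sum>k<m. \<bar>\<rho> g x k - \<rho> h x k\<bar>) \<le> (\<Sum>k<m. \<eta>)"
          by (intro sum_mono) auto
        also have "\<dots> < \<delta>"
          using \<delta> by (simp add: \<eta>_def field_simps)
        finally have "euclidean_dist m (\<rho> g x) (\<rho> h x) < \<delta>"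
          using euclidean_dist_le_sum[of m "\<rho> g x" "\<rho> h x"] by linarith
        then show ?thesis
          using shift[OF gG hG] X(2) x by auto
      qed
      then have "inv\<^bsub>G\<^esub> h \<otimes>\<^bsub>G\<^esub> g = \<one>\<^bsub>G\<^esub>"
        using gG hG by (intro near) auto
      then show "g = h"
        using gG hG G.inv_equality G.inv_inv by (metis G.inv_closed)
    qed
    ultimately have "finite S"
      by (rule finite_imageD)
    then show ?thesis
      by (simp add: S_def)
  qed
  have powK: "\<rho> (g [^]\<^bsub>G\<^esub> k) = \<rho> g [^]\<^bsub>?K\<^esub> k" if "g \<in> carrier G" for g and k :: nat
  proof (induction k)
    case 0
    show ?case
      using one by (simp add: nat_pow_def isom_group_def BijGroup_def)
  next
    case (Suc k)
    have "\<rho> (g [^]\<^bsub>G\<^esub> Suc k) = \<rho> (g [^]\<^bsub>G\<^esub> k) \<otimes>\<^bsub>?K\<^esub> \<rho> g"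
      using hom_mult[OF homK, of "g [^]\<^bsub>G\<^esub> k" g] that by simp
    also have "\<dots> = \<rho> g [^]\<^bsub>?K\<^esub> k \<otimes>\<^bsub>?K\<^esub> \<rho> g"
      by (simp only: Suc.IH)
    also have "\<dots> = \<rho> g [^]\<^bsub>?K\<^esub> Suc k"
      by (simp add: nat_pow_def)
    finally show ?case .
  qed
  \<comment> \<open>All powers of \<open>g\<close> fix \<open>x\<close>, hence move the origin by at
    most twice its distance to \<open>x\<close>. Only finitely many elements do this, so two powers
    coincide and \<open>g\<close> has finite order.\<close>
  have free: "g = \<one>\<^bsub>G\<^esub>" if g: "g \<in> carrier G" and x: "x \<in> eucl m" and fx: "\<rho> g x = x" for g x
  proof -
    have fix_pow: "\<rho> (g [^]\<^bsub>G\<^esub> k) x = x" for k :: nat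
    proof (induction k)
      case 0
      show ?case
        using one x by simp
    next
      case (Suc k)
      then show ?case
        using A.composition_rule[OF x, of "g [^]\<^bsub>G\<^esub> k" g] g fx by simp
    qed
    have "euclidean_dist m (\<rho> (g [^]\<^bsub>G\<^esub> k) origin) origin \<le> 2 * euclidean_dist m x origin" for k :: nat
    proof -
      have "euclidean_dist m (\<rho> (g [^]\<^bsub>G\<^esub> k) origin) x = euclidean_dist m origin x"
        using isoD(3)[of "g [^]\<^bsub>G\<^esub> k" origin x] g x fix_pow[of k] by simp
      then show ?thesis
        using euclidean_dist_triangle[of m "\<rho> (g [^]\<^bsub>G\<^esub> k) origin" origin x] euclidean_dist_commute[of m origin x]
        by linarith
    qed
    then have "range (\<lambda>k::nat. g [^]\<^bsub>G\<^esub> k) \<subseteq>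
        {g \<in> carrier G. euclidean_dist m (\<rho> g origin) origin \<le> 2 * euclidean_dist m x origin}"
      using g by auto
    then have "finite (range (\<lambda>k::nat. g [^]\<^bsub>G\<^esub> k))"
      using fin finite_subset by blast
    then have "\<not> inj (\<lambda>k::nat. g [^]\<^bsub>G\<^esub> k)"
      using finite_imageD by blast
    then obtain a b :: nat where ab: "a < b" "g [^]\<^bsub>G\<^esub> a = g [^]\<^bsub>G\<^esub> b"
      unfolding inj_def by (metis linorder_neqE_nat)
    have "g [^]\<^bsub>G\<^esub> a \<otimes>\<^bsub>G\<^esub> g [^]\<^bsub>G\<^esub> (b - a) = g [^]\<^bsub>G\<^esub> a \<otimes>\<^bsub>G\<^esub> \<one>\<^bsub>G\<^esub>"
      using G.nat_pow_mult[OF g, of a "b - a"] ab g by (simp del: G.nat_pow_mult)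
    then have "g [^]\<^bsub>G\<^esub> (b - a) = \<one>\<^bsub>G\<^esub>"
      using G.Units_l_cancel[of "g [^]\<^bsub>G\<^esub> a" "g [^]\<^bsub>G\<^esub> (b - a)" "\<one>\<^bsub>G\<^esub>"] g by (simp add: G.Units_eq)
    then have "\<rho> g [^]\<^bsub>?K\<^esub> (b - a) = \<one>\<^bsub>?K\<^esub>"
      using powK[OF g, of "b - a"] one by (simp add: isom_group_def BijGroup_def)
    moreover have "\<rho> g \<in> carrier ?K"
      using g img by auto
    ultimately have "\<rho> g = \<one>\<^bsub>?K\<^esub>"
      using tf ab(1) unfolding torsion_free_def by (metis zero_less_diff)
    then have "\<rho> g = \<rho> \<one>\<^bsub>G\<^esub>"
      using one by (simp add: isom_group_def BijGroup_def)
    then show ?thesis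
      using inj_onD[OF inj] g by simp
  qed
  have "orbit ?K (\<lambda>h. h) x = orbit G \<rho> x" for x
    using img by (auto simp: orbit_def)
  then have "orbit ?K (\<lambda>h. h) = orbit G \<rho>"
    by (rule ext)
  then have coc': "cocompact_action G (Euclidean_space m) \<rho>"
    using coc by (simp add: cocompact_action_def)
  define U where "U k = {x \<in> eucl m. euclidean_dist m x origin < real k}" for k
  have U1: "openin (Euclidean_space m) (U k)" and U2: "U k \<subseteq> U (Suc k)" for k
    using openin_euclidean_ball[of m origin] by (auto simp: U_def)
  have U3: "eucl m \<subseteq> (\<Union>k. U k)"
  proof
    fix x assume "x \<in> eucl m"
    moreover obtain k :: nat where "euclidean_dist m x origin < real k"
      using reals_Archimedean2 by blast
    ultimately show "x \<in> (\<Union>k. U k)"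
      by (auto simp: U_def)
  qed
  have "\<exists>k. \<forall>x\<in>eucl m. \<exists>g\<in>carrier G. \<rho> g x \<in> U k"
  proof (rule cocompact_exhaustion[OF coc' A.group_action_axioms
        euclidean_isometry_continuous[OF hom_isom_group_in[OF hom]] U1 U2 U3])
    fix k assume "\<And>x. x \<in> eucl m \<Longrightarrow> \<exists>g\<in>carrier G. \<rho> g x \<in> U k"
    then show "\<exists>k. \<forall>x\<in>eucl m. \<exists>g\<in>carrier G. \<rho> g x \<in> U k"
      by (intro exI ballI)
  qed
  then have "\<exists>r. \<forall>x\<in>eucl m. \<exists>g\<in>carrier G. euclidean_dist m (\<rho> g x) origin < r"
    unfolding U_def by blast
  with that hom free fin show ?thesis
    by blast
qed

section \<open>An equivariant smooth map by averaging\<close>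

text \<open>One group with two actions: \<phi> on \<open>M\<close>, identified with
  \<open>\<real>\<^sup>n\<close> by \<open>f\<close> and \<open>f'\<close>, and \<rho> on
  \<open>\<real>\<^sup>m\<close>. The Bieberbach property enters through \<rho>: freeness,
  properness at the origin, and a ball that meets every orbit.\<close>

locale euclidean_group_pair =
  fixes M :: "'a manifold" and G :: "('g, 'b) monoid_scheme" (structure) and \<phi> :: "'g \<Rightarrow> 'a \<Rightarrow> 'a"
    and n :: nat and f :: "'a \<Rightarrow> nat \<Rightarrow> real" and f' :: "(nat \<Rightarrow> real) \<Rightarrow> 'a"
    and m :: nat and \<rho> :: "'g \<Rightarrow> (nat \<Rightarrow> real) \<Rightarrow> nat \<Rightarrow> real"
  assumes M: "smooth_manifold M"
    and f: "smooth_map M (euclidean_manifold n) f"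
    and f': "continuous_map (Euclidean_space n) (mtop M) f'"
    and f'_f: "\<And>p. p \<in> mpoints M \<Longrightarrow> f' (f p) = p"
    and f_f': "\<And>y. y \<in> eucl n \<Longrightarrow> f (f' y) = y"
    and act: "group_action G (mpoints M) \<phi>"
    and smooth_act: "\<And>\<gamma>. \<gamma> \<in> carrier G \<Longrightarrow> smooth_map M M (\<phi> \<gamma>)"
    and proper_act: "properly_discontinuous_action G (mtop M) \<phi>"
    and coc_act: "cocompact_action G (mtop M) \<phi>"
    and hom: "\<rho> \<in> hom G (isom_group m)"
    and rho_free: "\<And>\<gamma> x. \<gamma> \<in> carrier G \<Longrightarrow> x \<in> eucl m \<Longrightarrow> \<rho> \<gamma> x = x \<Longrightarrow> \<gamma> = \<one>"
    and rho_proper: "\<And>r. finite {\<gamma> \<in> carrier G. euclidean_dist m (\<rho> \<gamma> origin) origin \<le> r}"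
    and rho_coc: "\<exists>r. \<forall>x\<in>eucl m. \<exists>\<gamma>\<in>carrier G. euclidean_dist m (\<rho> \<gamma> x) origin < r"
begin

sublocale A: group_action G "mpoints M" \<phi>
  by (rule act)

sublocale G: group G
  using A.group_hom group_hom.axioms(1) by auto

sublocale R: group_action G "eucl m" \<rho>
  by (rule isom_hom_action[OF G.group_axioms hom])

lemmas rho_isom = hom_isom_group_in[OF hom]
lemmas rho_in = euclidean_isometriesD(2)[OF rho_isom]
lemmas rho_dist = euclidean_isometriesD(3)[OF rho_isom]

lemma phi_in: "\<gamma> \<in> carrier G \<Longrightarrow> p \<in> mpoints M \<Longrightarrow> \<phi> \<gamma> p \<in> mpoints M"
  using A.element_image by blast

lemma phi_continuous: "\<gamma> \<in> carrier G \<Longrightarrow> continuous_map (mtop M) (mtop M) (\<phi> \<gamma>)"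
  using smooth_act smooth_map_continuous by blast

lemma f_in: "p \<in> mpoints M \<Longrightarrow> f p \<in> eucl n"
  using smooth_map_in[OF f] by simp

lemma f_continuous: "continuous_map (mtop M) (Euclidean_space n) f"
  by (rule smooth_map_euclidean_continuous[OF f])

lemma f'_in: "y \<in> eucl n \<Longrightarrow> f' y \<in> mpoints M"
  using continuous_map_image_subset_topspace[OF f'] by blast

text \<open>Balls of \<open>\<real>\<^sup>n\<close> seen through \<open>f\<close>, unrelated to any
  Riemannian metric of \<open>M\<close>; they exhaust \<open>M\<close>, and the closed ones are
  compact.\<close>

definition oball :: "real \<Rightarrow> 'a set" where
  "oball r = {p \<in> mpoints M. euclidean_dist n (f p) origin < r}"

definition kball :: "real \<Rightarrow> 'a set" where
  "kball r = {p \<in> mpoints M. euclidean_dist n (f p) origin \<le> r}"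

lemma oball_open: "openin (mtop M) (oball r)"
proof -
  have "openin (mtop M) {p \<in> mpoints M. f p \<in> {y \<in> eucl n. euclidean_dist n y origin < r}}"
    by (rule openin_continuous_map_preimage[OF f_continuous openin_euclidean_ball])
  moreover have "{p \<in> mpoints M. f p \<in> {y \<in> eucl n. euclidean_dist n y origin < r}} = oball r"
    using f_in by (auto simp: oball_def)
  ultimately show ?thesis
    by simp
qed

lemma kball_compact: "compactin (mtop M) (kball r)"
proof -
  let ?B = "{y \<in> eucl n. euclidean_dist n y origin \<le> r}"
  have "compactin (Euclidean_space n) ?B"
    using compact_euclidean_cball[of n origin r] by (subst Euclidean_space_eq) (simp add: compactin_subtopology)
  then have "compactin (mtop M) (f' ` ?B)"
    using f' image_compactin by blast
  moreover have "f' ` ?B = kball r"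
  proof (intro equalityI subsetI)
    fix p assume "p \<in> f' ` ?B"
    then obtain y where y: "p = f' y" "y \<in> eucl n" "euclidean_dist n y origin \<le> r"
      by blast
    then show "p \<in> kball r"
      using f'_in[OF y(2)] f_f'[OF y(2)] by (simp add: kball_def)
  next
    fix p assume p: "p \<in> kball r"
    then have pM: "p \<in> mpoints M"
      by (simp add: kball_def)
    have "f p \<in> ?B"
      using p f_in[OF pM] by (simp add: kball_def)
    then have "f' (f p) \<in> f' ` ?B"
      by (rule imageI)
    then show "p \<in> f' ` ?B"
      by (simp only: f'_f[OF pM])
  qed
  ultimately show ?thesis
    by simp
qed

lemma compact_in_kball:
  assumes "compactin (mtop M) K"
  obtains r where "K \<subseteq> kball r"
proof -
  obtain r where "\<And>p. p \<in> K \<Longrightarrow> euclidean_dist n (f p) origin \<le> r"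
    using compactin_bounded[OF assms f_continuous, of origin] by blast
  then have "K \<subseteq> kball r"
    using compactin_subset_topspace[OF assms] by (auto simp: kball_def)
  then show ?thesis
    by (rule that)
qed

lemma point_in_oball: "p \<in> mpoints M \<Longrightarrow> p \<in> oball (euclidean_dist n (f p) origin + 1)"
  by (simp add: oball_def)

lemma oball_subset_kball: "oball r \<subseteq> kball r"
  by (auto simp: oball_def kball_def)

lemma orbit_meets_oball: "\<exists>r>0. \<forall>p\<in>mpoints M. \<exists>\<gamma>\<in>carrier G. \<phi> \<gamma> p \<in> oball r"
proof -
  have U2: "oball (real k) \<subseteq> oball (real (Suc k))" for k
    by (auto simp: oball_def)
  have U3: "mpoints M \<subseteq> (\<Union>k. oball (real k))"
  proof
    fix p assume "p \<in> mpoints M"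
    moreover obtain k :: nat where "euclidean_dist n (f p) origin < real k"
      using reals_Archimedean2 by blast
    ultimately show "p \<in> (\<Union>k. oball (real k))"
      by (auto simp: oball_def)
  qed
  show ?thesis
  proof (rule cocompact_exhaustion[OF coc_act act phi_continuous oball_open U2 U3])
    fix k assume k: "\<And>p. p \<in> mpoints M \<Longrightarrow> \<exists>\<gamma>\<in>carrier G. \<phi> \<gamma> p \<in> oball (real k)"
    \<comment> \<open>The radius is enlarged by 1 to have it positive also for k = 0.\<close>
    have "oball (real k) \<subseteq> oball (real k + 1)"
      by (auto simp: oball_def)
    then show ?thesis
      using k by (intro exI[of _ "real k + 1"]) fastforce
  qed
qed

text \<open>Proper discontinuity speaks of one compact set; it is applied to the union of the
  two.\<close>

lemma finite_meeting:
  assumes "compactin (mtop M) K" and "compactin (mtop M) L"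
  shows "finite {\<gamma> \<in> carrier G. \<exists>p\<in>K. \<phi> \<gamma> p \<in> L}"
proof -
  have "compactin (mtop M) (K \<union> L)"
    using assms by (rule compactin_Un)
  then have "finite {\<gamma> \<in> carrier G. \<phi> \<gamma> ` (K \<union> L) \<inter> (K \<union> L) \<noteq> {}}"
    using proper_act by (simp add: properly_discontinuous_action_def)
  then show ?thesis
    by (rule finite_subset[rotated]) blast
qed

text \<open>\<open>F p\<close> is the mean of the points \<open>\<rho> (inv \<gamma>) origin\<close>
  with weights \<open>\<beta> (\<phi> \<gamma> p)\<close>. The inverse is what yields equivariance:
  passing from \<open>p\<close> to \<open>\<phi> \<delta> p\<close> replaces \<gamma> by
  \<open>\<gamma> \<otimes> inv \<delta>\<close>, whose inverse is
  \<open>\<delta> \<otimes> inv \<gamma>\<close>, and \<open>\<rho> \<delta>\<close>, being affine,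
  comes out of the mean.\<close>

lemma ex_equivariant_map:
  obtains F where "smooth_map M (euclidean_manifold m) F"
    and "\<And>\<gamma> p. \<gamma> \<in> carrier G \<Longrightarrow> p \<in> mpoints M \<Longrightarrow> F (\<phi> \<gamma> p) = \<rho> \<gamma> (F p)"
proof -
  obtain r where r: "r > 0" "\<And>p. p \<in> mpoints M \<Longrightarrow> \<exists>\<gamma>\<in>carrier G. \<phi> \<gamma> p \<in> oball r"
    using orbit_meets_oball by blast
  \<comment> \<open>With parameter \<open>r\<^sup>2\<close> this is positive on
    \<open>oball r\<close> and zero on the rest of \<open>M\<close>, so every orbit contains a point
    of positive weight.\<close>
  define \<beta> where "\<beta> p = bump n (r\<^sup>2) (f p)" for p
  have chi_nonneg: "\<beta> p \<ge> 0" for p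
    by (simp add: \<beta>_def bump_nonneg)
  have chi_pos: "\<beta> p > 0 \<longleftrightarrow> euclidean_dist n (f p) origin < r" for p
    unfolding \<beta>_def bump_pos_iff euclidean_dist_def L2_set_def
    using r(1) real_sqrt_less_iff[of "\<Sum>i<n. (f p i)\<^sup>2" "r\<^sup>2"] by (simp add: power2_eq_square)
  have chi_0: "\<phi> \<gamma> p \<in> kball r" if "\<gamma> \<in> carrier G" "p \<in> mpoints M" "\<beta> (\<phi> \<gamma> p) \<noteq> 0" for \<gamma> p
  proof -
    have "\<beta> (\<phi> \<gamma> p) > 0"
      using chi_nonneg[of "\<phi> \<gamma> p"] that(3) by simp
    then show ?thesis
      using phi_in[OF that(1,2)] chi_pos[of "\<phi> \<gamma> p"] by (simp add: kball_def)
  qed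
  define supp where "supp p = {\<gamma> \<in> carrier G. \<beta> (\<phi> \<gamma> p) \<noteq> 0}" for p
  have fin: "finite {\<gamma> \<in> carrier G. \<exists>p\<in>K. \<beta> (\<phi> \<gamma> p) \<noteq> 0}" if "compactin (mtop M) K" for K
    by (rule finite_subset[OF _ finite_meeting[OF that kball_compact[of r]]])
      (use chi_0 compactin_subset_topspace[OF that] in blast)
  have supp_fin: "finite (supp p)" if "p \<in> mpoints M" for p
    using fin[of "{p}"] that by (simp add: supp_def)
  define avg where "avg w p = (\<Sum>\<gamma>\<in>supp p. \<beta> (\<phi> \<gamma> p) * w \<gamma>)" for w :: "'g \<Rightarrow> real" and p
  have avg_smooth: "smooth_real M (avg w)" for w
  proof (rule smooth_real_local[OF M])
    fix p assume p: "p \<in> mpoints M"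
    define s where "s = euclidean_dist n (f p) origin + 1"
    \<comment> \<open>The set of non-zero terms changes from point to point; \<open>B\<close>
      collects all elements that matter anywhere on the ball of radius \<open>s\<close> and gives
      one finite sum valid there.\<close>
    define B where "B = {\<gamma> \<in> carrier G. \<exists>p\<in>kball s. \<beta> (\<phi> \<gamma> p) \<noteq> 0}"
    have B: "finite B" "B \<subseteq> carrier G"
      using fin[OF kball_compact] by (auto simp: B_def)
    have "smooth_real M (\<lambda>p. \<Sum>\<gamma>\<in>B. \<beta> (\<phi> \<gamma> p) * w \<gamma>)"
    proof (intro smooth_real_sum[OF M] smooth_real_mult[OF M] smooth_real_const[OF M])
      fix \<gamma> assume "\<gamma> \<in> B"
      then have "smooth_map M (euclidean_manifold n) (f \<circ> \<phi> \<gamma>)"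
        using B(2) by (intro smooth_map_compose[OF M M smooth_manifold_euclidean _ f] smooth_act) blast
      from smooth_real_compose[OF M this bump_smooth] show "smooth_real M (\<lambda>p. \<beta> (\<phi> \<gamma> p))"
        by (simp add: \<beta>_def)
    qed
    moreover have "avg w q = (\<Sum>\<gamma>\<in>B. \<beta> (\<phi> \<gamma> q) * w \<gamma>)" if q: "q \<in> oball s" for q
      unfolding avg_def
    proof (rule sum.mono_neutral_left[OF B(1)])
      show "supp q \<subseteq> B"
        using q oball_subset_kball by (auto simp: supp_def B_def)
      show "\<forall>\<gamma>\<in>B - supp q. \<beta> (\<phi> \<gamma> q) * w \<gamma> = 0"
        using B(2) by (auto simp: supp_def)
    qed
    ultimately show "\<exists>W h. openin (mtop M) W \<and> p \<in> W \<and> smooth_real M h \<and> (\<forall>q\<in>W. avg w q = h q)"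
      using oball_open[of s] point_in_oball[OF p]
      by (intro exI[of _ "oball s"] exI[of _ "\<lambda>p. \<Sum>\<gamma>\<in>B. \<beta> (\<phi> \<gamma> p) * w \<gamma>"]) (simp add: s_def)
  qed
  have avg_shift: "avg w (\<phi> \<delta> p) = avg (\<lambda>\<gamma>. w (\<gamma> \<otimes> inv \<delta>)) p"
    if d: "\<delta> \<in> carrier G" and p: "p \<in> mpoints M" for w \<delta> p
    unfolding avg_def
  proof (rule sum.reindex_bij_witness[of _ "\<lambda>\<gamma>. \<gamma> \<otimes> inv \<delta>" "\<lambda>\<gamma>. \<gamma> \<otimes> \<delta>"])
    fix \<gamma> assume g: "\<gamma> \<in> supp (\<phi> \<delta> p)"
    then have gG: "\<gamma> \<in> carrier G"
      by (simp add: supp_def)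
    have eq: "\<phi> (\<gamma> \<otimes> \<delta>) p = \<phi> \<gamma> (\<phi> \<delta> p)"
      by (rule A.composition_rule[OF p gG d])
    show "\<gamma> \<otimes> \<delta> \<otimes> inv \<delta> = \<gamma>"
      using gG d by (simp add: G.m_assoc)
    then show "\<beta> (\<phi> (\<gamma> \<otimes> \<delta>) p) * w (\<gamma> \<otimes> \<delta> \<otimes> inv \<delta>) = \<beta> (\<phi> \<gamma> (\<phi> \<delta> p)) * w \<gamma>"
      by (simp add: eq)
    show "\<gamma> \<otimes> \<delta> \<in> supp p"
      using g gG d eq by (simp add: supp_def)
  next
    fix \<gamma> assume g: "\<gamma> \<in> supp p"
    then have gG: "\<gamma> \<in> carrier G"
      by (simp add: supp_def)
    show "\<gamma> \<otimes> inv \<delta> \<otimes> \<delta> = \<gamma>"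
      using gG d by (simp add: G.m_assoc)
    then have "\<phi> \<gamma> p = \<phi> (\<gamma> \<otimes> inv \<delta>) (\<phi> \<delta> p)"
      using A.composition_rule[OF p, of "\<gamma> \<otimes> inv \<delta>" \<delta>] gG d by simp
    then show "\<gamma> \<otimes> inv \<delta> \<in> supp (\<phi> \<delta> p)"
      using g gG d by (simp add: supp_def)
  qed
  define F where "F p k = avg (\<lambda>\<gamma>. \<rho> (inv \<gamma>) origin k) p * inverse (avg (\<lambda>_. 1) p)" for p k
  have avg_pos: "avg (\<lambda>_. 1) p > 0" if p: "p \<in> mpoints M" for p
  proof -
    obtain \<gamma> where g: "\<gamma> \<in> carrier G" "\<phi> \<gamma> p \<in> oball r"
      using r(2)[OF p] by blast
    then have "\<beta> (\<phi> \<gamma> p) > 0"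
      by (simp add: chi_pos oball_def)
    then have "\<gamma> \<in> supp p" "\<beta> (\<phi> \<gamma> p) * 1 > 0"
      using g by (auto simp: supp_def)
    then show ?thesis
      unfolding avg_def using supp_fin[OF p] chi_nonneg by (intro sum_pos2[of _ \<gamma>]) auto
  qed
  have F_in: "F p \<in> eucl m" for p
  proof -
    have "avg (\<lambda>\<gamma>. \<rho> (inv \<gamma>) origin k) p = 0" if "k \<ge> m" for k
      unfolding avg_def
    proof (intro sum.neutral ballI)
      fix \<gamma> assume "\<gamma> \<in> supp p"
      then have "\<rho> (inv \<gamma>) origin \<in> eucl m"
        by (intro rho_in) (auto simp: supp_def)
      then show "\<beta> (\<phi> \<gamma> p) * \<rho> (inv \<gamma>) origin k = 0"
        using that by (simp add: in_eucl)
    qed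
    then show ?thesis
      by (simp add: in_eucl F_def)
  qed
  have smooth: "smooth_map M (euclidean_manifold m) F"
    unfolding smooth_map_euclidean_iff[OF M]
  proof (intro conjI allI impI)
    show "F \<in> mpoints M \<rightarrow> eucl m"
      using F_in by simp
    fix k
    show "smooth_real M (\<lambda>p. F p k)"
      unfolding F_def using avg_pos
      by (intro smooth_real_mult[OF M] smooth_real_inverse[OF M] avg_smooth) (simp add: less_imp_neq[symmetric])
  qed
  have equi: "F (\<phi> \<delta> p) = \<rho> \<delta> (F p)" if d: "\<delta> \<in> carrier G" and p: "p \<in> mpoints M" for \<delta> p
  proof
    fix k
    show "F (\<phi> \<delta> p) k = \<rho> \<delta> (F p) k"
    proof (cases "k < m")
      case False
      then show ?thesis
        using F_in[of "\<phi> \<delta> p"] rho_in[OF d F_in] by (simp add: in_eucl)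
    next
      case k: True
      obtain A where A: "\<And>x k. x \<in> eucl m \<Longrightarrow> k < m \<Longrightarrow> \<rho> \<delta> x k = \<rho> \<delta> origin k + (\<Sum>i<m. A k i * x i)"
        using euclidean_isometry_affine[OF rho_isom[OF d]] by metis
      let ?S = "avg (\<lambda>_. 1) p"
      have S: "avg (\<lambda>_. 1) (\<phi> \<delta> p) = ?S"
        by (rule avg_shift[OF d p])
      have "avg (\<lambda>\<gamma>. \<rho> (inv \<gamma>) origin k) (\<phi> \<delta> p) = avg (\<lambda>\<gamma>. \<rho> (inv (\<gamma> \<otimes> inv \<delta>)) origin k) p"
        by (rule avg_shift[OF d p])
      also have "\<dots> = avg (\<lambda>\<gamma>. \<rho> \<delta> origin k + (\<Sum>i<m. A k i * \<rho> (inv \<gamma>) origin i)) p"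
        unfolding avg_def
      proof (intro sum.cong refl)
        fix \<gamma> assume "\<gamma> \<in> supp p"
        then have g: "\<gamma> \<in> carrier G"
          by (simp add: supp_def)
        have "\<rho> (inv (\<gamma> \<otimes> inv \<delta>)) origin = \<rho> \<delta> (\<rho> (inv \<gamma>) origin)"
          using R.composition_rule[of origin \<delta> "inv \<gamma>"] g d by (simp add: G.inv_mult_group)
        then show "\<beta> (\<phi> \<gamma> p) * \<rho> (inv (\<gamma> \<otimes> inv \<delta>)) origin k =
            \<beta> (\<phi> \<gamma> p) * (\<rho> \<delta> origin k + (\<Sum>i<m. A k i * \<rho> (inv \<gamma>) origin i))"
          using A[OF rho_in k, of "inv \<gamma>" origin] g by simp
      qed
      \<comment> \<open>The translation part of \<open>\<rho> \<delta>\<close> gets multiplied by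
        the total weight, which the denominator of \<open>F\<close> removes again.\<close>
      also have "\<dots> = \<rho> \<delta> origin k * ?S + (\<Sum>i<m. A k i * avg (\<lambda>\<gamma>. \<rho> (inv \<gamma>) origin i) p)"
      proof -
        have "(\<Sum>\<gamma>\<in>supp p. \<Sum>i<m. \<beta> (\<phi> \<gamma> p) * (A k i * \<rho> (inv \<gamma>) origin i)) =
            (\<Sum>i<m. \<Sum>\<gamma>\<in>supp p. \<beta> (\<phi> \<gamma> p) * (A k i * \<rho> (inv \<gamma>) origin i))"
          by (rule sum.swap)
        then show ?thesis
          by (simp add: avg_def distrib_left sum.distrib sum_distrib_left mult_ac)
      qed
      finally have *: "avg (\<lambda>\<gamma>. \<rho> (inv \<gamma>) origin k) (\<phi> \<delta> p) =
          \<rho> \<delta> origin k * ?S + (\<Sum>i<m. A k i * avg (\<lambda>\<gamma>. \<rho> (inv \<gamma>) origin i) p)" .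
      have "F (\<phi> \<delta> p) k = \<rho> \<delta> origin k + (\<Sum>i<m. A k i * F p i)"
      proof -
        have "?S * inverse ?S = 1"
          using avg_pos[OF p] by simp
        then have "(\<rho> \<delta> origin k * ?S) * inverse ?S = \<rho> \<delta> origin k"
          by (simp only: mult.assoc mult_1_right)
        then show ?thesis
          unfolding F_def S * by (simp only: distrib_right sum_distrib_right mult.assoc)
      qed
      then show ?thesis
        using A[OF F_in k] by simp
    qed
  qed
  show ?thesis
    using that smooth equi by blast
qed

end

section \<open>Comparison of dimensions\<close>

definition normalize_vec :: "nat \<Rightarrow> (nat \<Rightarrow> real) \<Rightarrow> nat \<Rightarrow> real" where
  "normalize_vec k y = (\<lambda>i. y i / euclidean_dist k y origin)"

lemma euclidean_dist_origin: "euclidean_dist k y origin = sqrt (\<Sum>i<k. (y i)\<^sup>2)"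
  by (simp add: euclidean_dist_def L2_set_def)

lemma nsphere_iff: "x \<in> topspace (nsphere k) \<longleftrightarrow> x \<in> eucl (Suc k) \<and> euclidean_dist (Suc k) x origin = 1"
  by (simp add: nsphere_def euclidean_dist_origin lessThan_Suc_atMost)

lemma euclidean_dist_scale:
  "euclidean_dist k (\<lambda>i. c * y i) origin = \<bar>c\<bar> * euclidean_dist k y origin"
  by (simp add: euclidean_dist_origin power_mult_distrib real_sqrt_mult flip: sum_distrib_left)

lemma continuous_map_normalize:
  assumes u: "continuous_map X (Euclidean_space (Suc k)) u"
    and nz: "\<And>x. x \<in> topspace X \<Longrightarrow> euclidean_dist (Suc k) (u x) origin > 0"
  shows "continuous_map X (nsphere k) (\<lambda>x. normalize_vec (Suc k) (u x))"
proof -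
  have uE: "u x \<in> eucl (Suc k)" if "x \<in> topspace X" for x
    using continuous_map_image_subset_topspace[OF u] that by blast
  have in_sphere: "normalize_vec (Suc k) (u x) \<in> topspace (nsphere k)" if "x \<in> topspace X" for x
  proof -
    have "normalize_vec (Suc k) (u x) = (\<lambda>i. inverse (euclidean_dist (Suc k) (u x) origin) * u x i)"
      by (simp add: normalize_vec_def divide_inverse mult.commute)
    then have "euclidean_dist (Suc k) (normalize_vec (Suc k) (u x)) origin = 1"
      using nz[OF that] by (simp add: euclidean_dist_scale)
    moreover have "normalize_vec (Suc k) (u x) \<in> eucl (Suc k)"
      using uE[OF that] by (simp add: normalize_vec_def in_eucl)
    ultimately show ?thesis
      by (simp add: nsphere_iff)
  qed
  have "continuous_map X (Euclidean_space (Suc k)) (\<lambda>x. normalize_vec (Suc k) (u x))"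
  proof (rule continuous_map_euclI)
    show "continuous_map X euclideanreal (\<lambda>x. normalize_vec (Suc k) (u x) i)" for i
      unfolding normalize_vec_def
      by (intro continuous_map_real_divide continuous_map_eucl_coord[OF u] continuous_map_euclidean_dist[OF u])
        (use nz in fastforce)
    show "(\<lambda>x. normalize_vec (Suc k) (u x)) \<in> topspace X \<rightarrow> eucl (Suc k)"
      using in_sphere nsphere_iff by blast
  qed
  then show ?thesis
    using in_sphere unfolding nsphere_def continuous_map_in_subtopology by auto
qed

text \<open>Homotopies of sphere maps are obtained by radial projection, so the point to check for
  each of them is that the origin is avoided.\<close>

lemma homotopic_normalize:
  fixes h :: "real \<times> 'x \<Rightarrow> nat \<Rightarrow> real"
  assumes h: "continuous_map (prod_topology (top_of_set {0..1}) X) (Euclidean_space (Suc k)) h"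
    and nz: "\<And>t x. t \<in> {0..1} \<Longrightarrow> x \<in> topspace X \<Longrightarrow> euclidean_dist (Suc k) (h (t, x)) origin > 0"
    and "\<And>x. x \<in> topspace X \<Longrightarrow> normalize_vec (Suc k) (h (0, x)) = a x"
    and "\<And>x. x \<in> topspace X \<Longrightarrow> normalize_vec (Suc k) (h (1, x)) = b x"
  shows "homotopic_with (\<lambda>_. True) X (nsphere k) a b"
proof -
  have "continuous_map (prod_topology (top_of_set {0..1}) X) (nsphere k) (\<lambda>z. normalize_vec (Suc k) (h z))"
    by (rule continuous_map_normalize[OF h]) (use nz in auto)
  then have "\<exists>h. continuous_map (prod_topology (top_of_set {0..1::real}) X) (nsphere k) h \<and>
      (\<forall>x\<in>topspace X. h (0, x) = a x) \<and> (\<forall>x\<in>topspace X. h (1, x) = b x)"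
    using assms(3,4) by (intro exI[of _ "\<lambda>z. normalize_vec (Suc k) (h z)"] conjI ballI) auto
  then show ?thesis
    by (subst homotopic_with) auto
qed

text \<open>In degree p the reduced homology of \<open>nsphere p\<close> is non-trivial and that of
  \<open>nsphere q\<close> trivial, so the identity on the former cannot pass through the latter.
  Here \<open>nsphere k\<close> is the sphere of dimension k in
  \<open>\<real>\<^sup>k\<^sup>+\<^sup>1\<close>.\<close>

lemma nsphere_not_factor:
  assumes "q \<noteq> p" and a: "continuous_map (nsphere p) (nsphere q) a"
    and b: "continuous_map (nsphere q) (nsphere p) b"
    and hom: "homotopic_with (\<lambda>_. True) (nsphere p) (nsphere p) (b \<circ> a) id"
  shows False
proof -
  let ?R = "reduced_homology_group (int p) (nsphere p)"
  have triv: "carrier (reduced_homology_group (int p) (nsphere q)) = {\<one>\<^bsub>reduced_homology_group (int p) (nsphere q)\<^esub>}"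
    using trivial_reduced_homology_group_nsphere[of "int p" q] assms(1) by (simp add: trivial_group_def)
  have "c = \<one>\<^bsub>?R\<^esub>" if c: "c \<in> carrier ?R" for c
  proof -
    have "c \<in> carrier (homology_group (int p) (nsphere p))"
      using c carrier_reduced_homology_group_subset by blast
    then have "c = hom_induced (int p) (nsphere p) {} (nsphere p) {} id c"
      by (simp add: hom_induced_id)
    also have "\<dots> = hom_induced (int p) (nsphere p) {} (nsphere p) {} (b \<circ> a) c"
      using homology_homotopy_empty[OF hom] by simp
    also have "\<dots> = hom_induced (int p) (nsphere q) {} (nsphere p) {} b
        (hom_induced (int p) (nsphere p) {} (nsphere q) {} a c)"
      by (simp add: hom_induced_compose_empty[OF a b])
    also have "hom_induced (int p) (nsphere p) {} (nsphere q) {} a c = \<one>\<^bsub>reduced_homology_group (int p) (nsphere q)\<^esub>"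
      using hom_induced_reduced[OF c, of "nsphere q" a] triv by blast
    also have "hom_induced (int p) (nsphere q) {} (nsphere p) {} b \<one>\<^bsub>reduced_homology_group (int p) (nsphere q)\<^esub> = \<one>\<^bsub>?R\<^esub>"
      using hom_one[OF hom_induced_reduced_hom] by simp
    finally show ?thesis .
  qed
  then have "trivial_group ?R"
    using monoid.one_closed[OF group.is_monoid[OF group_reduced_homology_group]] by (auto simp: trivial_group_def)
  then show False
    by (simp add: trivial_reduced_homology_group_nsphere)
qed

section \<open>Equivariant maps from \<open>\<real>\<^sup>m\<close> to \<open>M\<close>\<close>

context euclidean_group_pair
begin

text \<open>Changing the base point from the origin to \<open>x\<close> and the target to
  \<open>y\<close> alters the distances by a bounded amount, as \<rho> acts by isometries.\<close>

lemma rho_finite_near: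
  assumes x: "x \<in> eucl m"
  shows "finite {\<gamma> \<in> carrier G. euclidean_dist m (\<rho> \<gamma> x) y \<le> r}"
proof (rule finite_subset[OF _ rho_proper[of "euclidean_dist m origin x + r + euclidean_dist m y origin"]])
  show "{\<gamma> \<in> carrier G. euclidean_dist m (\<rho> \<gamma> x) y \<le> r} \<subseteq>
    {\<gamma> \<in> carrier G. euclidean_dist m (\<rho> \<gamma> origin) origin \<le> euclidean_dist m origin x + r + euclidean_dist m y origin}"
  proof
    fix \<gamma> assume "\<gamma> \<in> {\<gamma> \<in> carrier G. euclidean_dist m (\<rho> \<gamma> x) y \<le> r}"
    then have g: "\<gamma> \<in> carrier G" "euclidean_dist m (\<rho> \<gamma> x) y \<le> r"
      by auto
    have "euclidean_dist m (\<rho> \<gamma> origin) (\<rho> \<gamma> x) = euclidean_dist m origin x"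
      by (rule rho_dist[OF g(1) origin_in_eucl x])
    then show "\<gamma> \<in> {\<gamma> \<in> carrier G. euclidean_dist m (\<rho> \<gamma> origin) origin \<le> euclidean_dist m origin x + r + euclidean_dist m y origin}"
      using g euclidean_dist_triangle[of m "\<rho> \<gamma> origin" origin "\<rho> \<gamma> x"]
        euclidean_dist_triangle[of m "\<rho> \<gamma> x" origin y] by simp
  qed
qed

text \<open>Only finitely many elements move \<open>x\<close> by at most 1, and the non-trivial ones
  among them move it by a positive amount.\<close>

lemma rho_separated:
  assumes x: "x \<in> eucl m"
  obtains \<delta> where "\<delta> > 0" and "\<And>\<gamma>. \<gamma> \<in> carrier G \<Longrightarrow> euclidean_dist m (\<rho> \<gamma> x) x < \<delta> \<Longrightarrow> \<gamma> = \<one>"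
proof -
  define S where "S = {\<gamma> \<in> carrier G. euclidean_dist m (\<rho> \<gamma> x) x \<le> 1} - {\<one>}"
  have S: "finite S"
    using rho_finite_near[OF x] by (simp add: S_def)
  define \<delta> where "\<delta> = Min (insert 1 ((\<lambda>\<gamma>. euclidean_dist m (\<rho> \<gamma> x) x) ` S))"
  have "euclidean_dist m (\<rho> \<gamma> x) x > 0" if "\<gamma> \<in> S" for \<gamma>
  proof -
    have "\<gamma> \<in> carrier G" "\<gamma> \<noteq> \<one>"
      using that by (auto simp: S_def)
    then have "euclidean_dist m (\<rho> \<gamma> x) x \<noteq> 0"
      using rho_free[OF _ x] euclidean_dist_eq_0[OF rho_in[OF _ x] x] by blast
    then show ?thesis
      using euclidean_dist_nonneg[of m "\<rho> \<gamma> x" x] by linarith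
  qed
  then have "\<delta> > 0"
    using S by (simp add: \<delta>_def)
  moreover have "\<gamma> = \<one>" if g: "\<gamma> \<in> carrier G" "euclidean_dist m (\<rho> \<gamma> x) x < \<delta>" for \<gamma>
  proof (rule ccontr)
    assume "\<gamma> \<noteq> \<one>"
    have "\<delta> \<le> 1"
      using S by (simp add: \<delta>_def)
    then have "\<gamma> \<in> S"
      using g \<open>\<gamma> \<noteq> \<one>\<close> by (simp add: S_def)
    then have "\<delta> \<le> euclidean_dist m (\<rho> \<gamma> x) x"
      using S by (simp add: \<delta>_def)
    then show False
      using g(2) by simp
  qed
  ultimately show ?thesis
    using that by blast
qed

lemma rho_inv_left: "\<gamma> \<in> carrier G \<Longrightarrow> x \<in> eucl m \<Longrightarrow> \<rho> (inv \<gamma>) (\<rho> \<gamma> x) = x"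
  using R.orbit_sym_aux by blast

lemma rho_continuous_on: "\<gamma> \<in> carrier G \<Longrightarrow> continuous_on (eucl m) (\<rho> \<gamma>)"
  using euclidean_isometry_continuous[OF rho_isom, of \<gamma>] continuous_map_into_eucl[of "Euclidean_space m" m]
  by (simp add: continuous_map_Euclidean_space_iff)

text \<open>Partial equivariant maps are kept on closed invariant sets, because both Tietze
  extension and pasting over a locally finite family work with closed pieces.\<close>

definition equivariant_on :: "(nat \<Rightarrow> real) set \<Rightarrow> ((nat \<Rightarrow> real) \<Rightarrow> 'a) \<Rightarrow> bool" where
  "equivariant_on S s \<longleftrightarrow> closed S \<and> S \<subseteq> eucl m \<and> (\<forall>\<gamma>\<in>carrier G. \<forall>x\<in>S. \<rho> \<gamma> x \<in> S) \<and>
     continuous_map (top_of_set S) (mtop M) s \<and>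
     (\<forall>\<gamma>\<in>carrier G. \<forall>x\<in>S. s (\<rho> \<gamma> x) = \<phi> \<gamma> (s x))"

text \<open>Since \<open>M\<close> is homeomorphic to a Euclidean space, Tietze's theorem extends \<open>s\<close> to a small ball;
  the translates of the ball are disjoint, so the extension propagates equivariantly.\<close>

lemma equivariant_extension:
  assumes s: "equivariant_on S s" and x0: "x0 \<in> eucl m" and e: "e > 0"
    and sep: "\<And>\<gamma>. \<gamma> \<in> carrier G \<Longrightarrow> euclidean_dist m (\<rho> \<gamma> x0) x0 < 3 * e \<Longrightarrow> \<gamma> = \<one>"
  obtains s' where "equivariant_on (S \<union> (\<Union>\<gamma>\<in>carrier G. \<rho> \<gamma> ` {x \<in> eucl m. euclidean_dist m x x0 \<le> e})) s'"
proof -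
  define B where "B = {x \<in> eucl m. euclidean_dist m x x0 \<le> e}"
  have B: "compact B" "closed B" "B \<subseteq> eucl m"
    using compact_euclidean_cball[of m x0 e] closed_euclidean_cball[of m x0 e] by (auto simp: B_def)
  have S: "closed S" "S \<subseteq> eucl m" "\<And>\<gamma> x. \<gamma> \<in> carrier G \<Longrightarrow> x \<in> S \<Longrightarrow> \<rho> \<gamma> x \<in> S"
    and s_cont: "continuous_map (top_of_set S) (mtop M) s"
    and s_equi: "\<And>\<gamma> x. \<gamma> \<in> carrier G \<Longrightarrow> x \<in> S \<Longrightarrow> s (\<rho> \<gamma> x) = \<phi> \<gamma> (s x)"
    using s by (auto simp: equivariant_on_def)
  have s_in: "s x \<in> mpoints M" if "x \<in> S" for x
    using continuous_map_image_subset_topspace[OF s_cont] that by auto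
  \<comment> \<open>If two translates of the ball meet, then
    \<open>inv \<delta> \<otimes> \<gamma>\<close> moves the centre by at most 2 e, which is less
    than 3 e.\<close>
  have B_disj: "\<gamma> = \<delta>" if g: "\<gamma> \<in> carrier G" "\<delta> \<in> carrier G" and b: "b \<in> B" "b' \<in> B" and eq: "\<rho> \<gamma> b = \<rho> \<delta> b'"
    for \<gamma> \<delta> b b'
  proof -
    have bE: "b \<in> eucl m" "b' \<in> eucl m"
      using b B(3) by auto
    let ?g = "inv \<delta> \<otimes> \<gamma>"
    have gG: "?g \<in> carrier G"
      using g by simp
    have "\<rho> ?g b = \<rho> (inv \<delta>) (\<rho> \<delta> b')"
      using R.composition_rule[OF bE(1), of "inv \<delta>" \<gamma>] g eq by simp
    then have gb: "\<rho> ?g b = b'"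
      using rho_inv_left[OF g(2) bE(2)] by simp
    have "euclidean_dist m (\<rho> ?g x0) (\<rho> ?g b) = euclidean_dist m x0 b"
      by (rule rho_dist[OF gG x0 bE(1)])
    then have "euclidean_dist m (\<rho> ?g x0) x0 \<le> euclidean_dist m x0 b + euclidean_dist m b' x0"
      using euclidean_dist_triangle[of m "\<rho> ?g x0" x0 "\<rho> ?g b"] gb by simp
    also have "\<dots> < 3 * e"
      using b e euclidean_dist_commute[of m x0 b] by (simp add: B_def)
    finally have "?g = \<one>"
      using sep[OF gG] by blast
    then have "\<delta> \<otimes> ?g = \<delta>"
      using g by simp
    then show ?thesis
      using g by (simp add: G.m_assoc[symmetric])
  qed
  obtain t where t_cont: "continuous_map (top_of_set B) (mtop M) t" and t_s: "\<And>x. x \<in> S \<inter> B \<Longrightarrow> t x = s x"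
  proof -
    have fs: "continuous_map (top_of_set S) (Euclidean_space n) (f \<circ> s)"
      by (rule continuous_map_compose[OF s_cont f_continuous])
    \<comment> \<open>The extension takes place coordinate by coordinate after \<open>f\<close>; any
      values are admissible, since \<open>f'\<close> is defined on all of
      \<open>\<real>\<^sup>n\<close>.\<close>
    have "\<exists>g. continuous_on B g \<and> (\<forall>x\<in>S \<inter> B. g x = f (s x) i)" for i
    proof -
      have "continuous_map (top_of_set S) euclideanreal (\<lambda>x. (f \<circ> s) x i)"
        by (rule continuous_map_eucl_coord[OF fs])
      then have "continuous_on S (\<lambda>x. f (s x) i)"
        by simp
      then have "continuous_on (S \<inter> B) (\<lambda>x. f (s x) i)"
        by (rule continuous_on_subset) blast
      moreover have "closedin (top_of_set B) (S \<inter> B)"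
        using closedin_closed_Int[OF S(1), of B] by (simp add: Int_commute)
      ultimately show ?thesis
        using Tietze_unbounded[of "S \<inter> B" "\<lambda>x. f (s x) i" B] by metis
    qed
    then obtain g where g: "\<And>i. continuous_on B (g i)" "\<And>i x. x \<in> S \<inter> B \<Longrightarrow> g i x = f (s x) i"
      by metis
    define y where "y x i = (if i < n then g i x else 0)" for x i
    have "continuous_map (top_of_set B) (Euclidean_space n) y"
      using g(1) by (intro continuous_map_euclI) (auto simp: y_def in_eucl)
    then have "continuous_map (top_of_set B) (mtop M) (f' \<circ> y)"
      using f' continuous_map_compose by blast
    moreover have "(f' \<circ> y) x = s x" if x: "x \<in> S \<inter> B" for x
    proof -
      have "s x \<in> mpoints M"
        using s_in x by blast
      then have "y x = f (s x)"
        using f_in[of "s x"] g(2)[OF x] by (auto simp: y_def in_eucl fun_eq_iff)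
      then show ?thesis
        using f'_f[OF \<open>s x \<in> mpoints M\<close>] by simp
    qed
    ultimately show ?thesis
      by (rule that)
  qed
  have t_in: "t x \<in> mpoints M" if "x \<in> B" for x
    using continuous_map_image_subset_topspace[OF t_cont] that by auto
  define S' where "S' = S \<union> (\<Union>\<gamma>\<in>carrier G. \<rho> \<gamma> ` B)"
  \<comment> \<open>\<open>None\<close> stands for the old domain \<open>S\<close>,
    \<open>Some \<gamma>\<close> for the translate of the ball by \<gamma>.\<close>
  define I where "I = insert None (Some ` carrier G)"
  define T where "T i = (case i of None \<Rightarrow> S | Some \<gamma> \<Rightarrow> \<rho> \<gamma> ` B)" for i
  define h where "h i = (case i of None \<Rightarrow> s | Some \<gamma> \<Rightarrow> \<phi> \<gamma> \<circ> t \<circ> \<rho> (inv \<gamma>))" for i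
  have TB_closed: "closed (\<rho> \<gamma> ` B)" if "\<gamma> \<in> carrier G" for \<gamma>
    using compact_continuous_image[OF continuous_on_subset[OF rho_continuous_on[OF that] B(3)] B(1)]
    by (rule compact_imp_closed)
  have T_closed: "closed (T i)" if "i \<in> I" for i
    using that S(1) TB_closed by (auto simp: I_def T_def)
  have T_sub: "T i \<subseteq> eucl m" if "i \<in> I" for i
    using that S(2) B(3) rho_in by (fastforce simp: I_def T_def)
  have S'_T: "S' = (\<Union>i\<in>I. T i)"
    by (simp add: S'_def I_def T_def)
  have S'_sub: "S' \<subseteq> eucl m"
    using T_sub unfolding S'_T by blast
  have h_B: "h (Some \<gamma>) (\<rho> \<gamma> b) = \<phi> \<gamma> (t b)" if "\<gamma> \<in> carrier G" "b \<in> B" for \<gamma> b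
    using rho_inv_left[of \<gamma> b] that B(3) by (auto simp: h_def)
  \<comment> \<open>A translate that meets the unit ball around \<open>x\<close> has its centre
    within e + 1 of \<open>x\<close>, and only finitely many group elements carry \<open>x0\<close>
    that close.\<close>
  have loc_fin: "\<exists>V. openin (Euclidean_space m) V \<and> x \<in> V \<and> finite {i \<in> I. T i \<inter> V \<noteq> {}}" if x: "x \<in> eucl m" for x
  proof -
    let ?V = "{y \<in> eucl m. euclidean_dist m y x < 1}"
    have "{i \<in> I. T i \<inter> ?V \<noteq> {}} \<subseteq> insert None (Some ` {\<gamma> \<in> carrier G. euclidean_dist m (\<rho> \<gamma> x0) x \<le> e + 1})"
    proof
      fix i assume i: "i \<in> {i \<in> I. T i \<inter> ?V \<noteq> {}}"
      show "i \<in> insert None (Some ` {\<gamma> \<in> carrier G. euclidean_dist m (\<rho> \<gamma> x0) x \<le> e + 1})"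
      proof (cases i)
        case (Some \<gamma>)
        then obtain b where g: "\<gamma> \<in> carrier G" "b \<in> B" "euclidean_dist m (\<rho> \<gamma> b) x < 1"
          using i by (auto simp: I_def T_def)
        then have bE: "b \<in> eucl m"
          using B(3) by blast
        have "euclidean_dist m (\<rho> \<gamma> x0) (\<rho> \<gamma> b) \<le> e"
          using rho_dist[OF g(1) x0 bE] g(2) euclidean_dist_commute[of m x0 b] by (simp add: B_def)
        then have "euclidean_dist m (\<rho> \<gamma> x0) x \<le> e + 1"
          using euclidean_dist_triangle[of m "\<rho> \<gamma> x0" x "\<rho> \<gamma> b"] g(3) by linarith
        then show ?thesis
          using Some g(1) by blast
      qed simp
    qed
    moreover have "finite (insert None (Some ` {\<gamma> \<in> carrier G. euclidean_dist m (\<rho> \<gamma> x0) x \<le> e + 1}))"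
      using rho_finite_near[OF x0] by simp
    ultimately have "finite {i \<in> I. T i \<inter> ?V \<noteq> {}}"
      by (rule finite_subset)
    moreover have "openin (Euclidean_space m) ?V" "x \<in> ?V"
      using openin_euclidean_ball[of m x 1] x by auto
    ultimately show ?thesis
      by blast
  qed
  have S'_closed: "closed S'"
  proof -
    have "closedin (Euclidean_space m) (\<Union>(T ` I))"
    proof (rule closedin_locally_finite_Union)
      show "closedin (Euclidean_space m) A" if "A \<in> T ` I" for A
        using that T_closed T_sub by (auto simp: closedin_Euclidean_space_iff)
      show "locally_finite_in (Euclidean_space m) (T ` I)"
        unfolding locally_finite_in_def
      proof (intro conjI ballI)
        show "\<Union>(T ` I) \<subseteq> eucl m"
          using T_sub by blast
        fix x assume "x \<in> eucl m"
        then obtain V where V: "openin (Euclidean_space m) V" "x \<in> V" "finite {i \<in> I. T i \<inter> V \<noteq> {}}"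
          using loc_fin by blast
        have "{A \<in> T ` I. A \<inter> V \<noteq> {}} \<subseteq> T ` {i \<in> I. T i \<inter> V \<noteq> {}}"
          by blast
        then have "finite {A \<in> T ` I. A \<inter> V \<noteq> {}}"
          using V(3) finite_surj by blast
        then show "\<exists>V. openin (Euclidean_space m) V \<and> x \<in> V \<and> finite {A \<in> T ` I. A \<inter> V \<noteq> {}}"
          using V(1,2) by blast
      qed
    qed
    then show ?thesis
      unfolding S'_T by (rule closedin_Euclidean_imp_closed)
  qed
  \<comment> \<open>Since \<open>S\<close> is invariant, \<open>b\<close> itself lies in
    \<open>S\<close>, where \<open>t\<close> agrees with \<open>s\<close>.\<close>
  have agree_SB: "s (\<rho> \<gamma> b) = \<phi> \<gamma> (t b)" if g: "\<gamma> \<in> carrier G" "b \<in> B" and "\<rho> \<gamma> b \<in> S" for \<gamma> b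
  proof -
    have bE: "b \<in> eucl m"
      using g B(3) by blast
    have "b \<in> S"
      using S(3)[of "inv \<gamma>" "\<rho> \<gamma> b"] rho_inv_left[OF g(1) bE] that by simp
    then show ?thesis
      using s_equi[OF g(1)] t_s[of b] g(2) by simp
  qed
  have agree: "h i x = h j x" if "i \<in> I" "j \<in> I" "x \<in> T i" "x \<in> T j" for i j x
  proof -
    have *: "h None x = h (Some \<gamma>) x" if g: "\<gamma> \<in> carrier G" and x: "x \<in> S" "x \<in> \<rho> \<gamma> ` B" for \<gamma> x
    proof -
      obtain b where b: "b \<in> B" "x = \<rho> \<gamma> b"
        using x(2) by blast
      then show ?thesis
        using agree_SB[OF g b(1)] h_B[OF g b(1)] x(1) by (simp add: h_def)
    qed
    show ?thesis
    proof (cases i)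
      case None
      then show ?thesis
        using * that by (cases j) (auto simp: I_def T_def)
    next
      case (Some \<gamma>)
      show ?thesis
      proof (cases j)
        case None
        then show ?thesis
          using *[of \<gamma> x] that Some by (auto simp: I_def T_def)
      next
        case (Some \<delta>)
        then have "\<gamma> = \<delta>"
          using that \<open>i = Some \<gamma>\<close> B_disj by (auto simp: I_def T_def)
        then show ?thesis
          using Some \<open>i = Some \<gamma>\<close> by simp
      qed
    qed
  qed
  \<comment> \<open>Any piece containing \<open>x\<close> may be used, as the pieces agree on
    overlaps.\<close>
  define s' where "s' x = h (SOME i. i \<in> I \<and> x \<in> T i) x" for x
  have s'_eq: "s' x = h i x" if "i \<in> I" "x \<in> T i" for i x
  proof -
    have "(SOME i. i \<in> I \<and> x \<in> T i) \<in> I \<and> x \<in> T (SOME i. i \<in> I \<and> x \<in> T i)"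
      using that by (intro someI[of "\<lambda>i. i \<in> I \<and> x \<in> T i" i]) simp
    then show ?thesis
      unfolding s'_def using agree that by blast
  qed
  have s'_S: "s' x = s x" if "x \<in> S" for x
    using s'_eq[of None x] that by (simp add: I_def T_def h_def)
  have s'_B: "s' (\<rho> \<gamma> b) = \<phi> \<gamma> (t b)" if "\<gamma> \<in> carrier G" "b \<in> B" for \<gamma> b
    using s'_eq[of "Some \<gamma>" "\<rho> \<gamma> b"] h_B[OF that] that by (simp add: I_def T_def)
  have "equivariant_on S' s'"
    unfolding equivariant_on_def
  proof (intro conjI ballI)
    show "closed S'" "S' \<subseteq> eucl m"
      by (fact S'_closed, fact S'_sub)
    fix \<gamma> x assume g: "\<gamma> \<in> carrier G" and x: "x \<in> S'"
    consider "x \<in> S" | \<delta> b where "\<delta> \<in> carrier G" "b \<in> B" "x = \<rho> \<delta> b"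
      using x by (auto simp: S'_def)
    then have "\<rho> \<gamma> x \<in> S' \<and> s' (\<rho> \<gamma> x) = \<phi> \<gamma> (s' x)"
    proof cases
      case 1
      then show ?thesis
        using S(3)[OF g] s'_S s_equi[OF g] by (simp add: S'_def)
    next
      case 2
      have "b \<in> eucl m"
        using 2 B(3) by blast
      then have 3: "\<rho> \<gamma> x = \<rho> (\<gamma> \<otimes> \<delta>) b"
        using R.composition_rule g 2 by simp
      then have "s' (\<rho> \<gamma> x) = \<phi> (\<gamma> \<otimes> \<delta>) (t b)"
        using s'_B[of "\<gamma> \<otimes> \<delta>" b] g 2 by simp
      also have "\<dots> = \<phi> \<gamma> (s' x)"
        using A.composition_rule[OF t_in[OF 2(2)] g 2(1)] s'_B[OF 2(1,2)] 2(3) by simp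
      finally show ?thesis
        using 3 2(2) G.m_closed[OF g 2(1)] by (auto simp: S'_def)
    qed
    then show "\<rho> \<gamma> x \<in> S'" "s' (\<rho> \<gamma> x) = \<phi> \<gamma> (s' x)"
      by auto
  next
    show "continuous_map (top_of_set S') (mtop M) s'"
    proof (rule pasting_lemma_locally_finite[where I = I and T = T and f = h])
      fix x assume "x \<in> topspace (top_of_set S')"
      then have x: "x \<in> S'"
        by simp
      then obtain V where V: "openin (Euclidean_space m) V" "x \<in> V" "finite {i \<in> I. T i \<inter> V \<noteq> {}}"
        using loc_fin S'_sub by blast
      obtain O' where "open O'" "V = eucl m \<inter> O'"
        using V(1) openin_eucl_open by auto
      then have "S' \<inter> V = S' \<inter> O'"
        using S'_sub by blast
      then have "openin (top_of_set S') (S' \<inter> V)"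
        using openin_open_Int[OF \<open>open O'\<close>, of S'] by simp
      moreover have "finite {i \<in> I. T i \<inter> (S' \<inter> V) \<noteq> {}}"
        by (rule finite_subset[OF _ V(3)]) blast
      ultimately show "\<exists>V. openin (top_of_set S') V \<and> x \<in> V \<and> finite {i \<in> I. T i \<inter> V \<noteq> {}}"
        using x V(2) by blast
      show "\<exists>j. j \<in> I \<and> x \<in> T j \<and> s' x = h j x"
        using x s'_eq unfolding S'_T by blast
    next
      fix i assume i: "i \<in> I"
      then have "T i \<subseteq> S'"
        unfolding S'_T by blast
      then show "closedin (top_of_set S') (T i)"
        using T_closed[OF i] by (simp add: closed_subset)
      have sub: "subtopology (top_of_set S') (T i) = top_of_set (T i)"
        using \<open>T i \<subseteq> S'\<close> by (simp add: subtopology_subtopology Int_absorb1)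
      show "continuous_map (subtopology (top_of_set S') (T i)) (mtop M) (h i)"
      proof (cases i)
        case None
        then show ?thesis
          unfolding sub using s_cont by (simp add: T_def h_def)
      next
        case (Some \<gamma>)
        then have g: "\<gamma> \<in> carrier G"
          using i by (auto simp: I_def)
        have "\<rho> (inv \<gamma>) x \<in> B" if "x \<in> \<rho> \<gamma> ` B" for x
          using that rho_inv_left[OF g] B(3) by auto
        moreover have "continuous_on (\<rho> \<gamma> ` B) (\<rho> (inv \<gamma>))"
          using rho_continuous_on[of "inv \<gamma>"] T_sub[OF i] g Some by (auto simp: T_def intro: continuous_on_subset)
        ultimately have "continuous_map (top_of_set (\<rho> \<gamma> ` B)) (top_of_set B) (\<rho> (inv \<gamma>))"
          by (simp add: continuous_map_in_subtopology)
        then have "continuous_map (top_of_set (\<rho> \<gamma> ` B)) (mtop M) (t \<circ> \<rho> (inv \<gamma>))"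
          using t_cont by (rule continuous_map_compose)
        then have "continuous_map (top_of_set (\<rho> \<gamma> ` B)) (mtop M) (\<phi> \<gamma> \<circ> (t \<circ> \<rho> (inv \<gamma>)))"
          using phi_continuous[OF g] by (rule continuous_map_compose)
        then show ?thesis
          unfolding sub using Some by (simp add: T_def h_def o_assoc)
      qed
    next
      show "h i x = h j x" if "i \<in> I" "j \<in> I" "x \<in> topspace (top_of_set S') \<inter> T i \<inter> T j" for i j x
        using agree[OF that(1,2)] that(3) by blast
    qed
  qed
  then show ?thesis
    using that unfolding S'_def B_def by blast
qed

text \<open>Starting from the empty set, the domain is enlarged by one orbit of small balls at a
  time. Finitely many steps suffice: a compact ball \<open>C\<close> that meets every orbit is
  covered by finitely many of the small balls.\<close>

lemma ex_equivariant_section: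
  obtains s where "continuous_map (Euclidean_space m) (mtop M) s"
    and "\<And>\<gamma> x. \<gamma> \<in> carrier G \<Longrightarrow> x \<in> eucl m \<Longrightarrow> s (\<rho> \<gamma> x) = \<phi> \<gamma> (s x)"
proof -
  have "\<exists>e>0. \<forall>\<gamma>\<in>carrier G. euclidean_dist m (\<rho> \<gamma> x) x < 3 * e \<longrightarrow> \<gamma> = \<one>" if x: "x \<in> eucl m" for x
  proof (rule rho_separated[OF x])
    fix \<delta> :: real assume d: "\<delta> > 0" "\<And>\<gamma>. \<gamma> \<in> carrier G \<Longrightarrow> euclidean_dist m (\<rho> \<gamma> x) x < \<delta> \<Longrightarrow> \<gamma> = \<one>"
    then show ?thesis
      by (intro exI[of _ "\<delta> / 3"]) auto
  qed
  then have "\<forall>x\<in>eucl m. \<exists>e>0. \<forall>\<gamma>\<in>carrier G. euclidean_dist m (\<rho> \<gamma> x) x < 3 * e \<longrightarrow> \<gamma> = \<one>"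
    by blast
  from bchoice[OF this] obtain e where e: "\<And>x. x \<in> eucl m \<Longrightarrow> e x > 0"
    "\<And>x \<gamma>. x \<in> eucl m \<Longrightarrow> \<gamma> \<in> carrier G \<Longrightarrow> euclidean_dist m (\<rho> \<gamma> x) x < 3 * e x \<Longrightarrow> \<gamma> = \<one>"
    by blast
  define B where "B x = {y \<in> eucl m. euclidean_dist m y x \<le> e x}" for x
  have ext: "\<exists>S s. equivariant_on S s \<and> (\<forall>x\<in>D. \<forall>\<gamma>\<in>carrier G. \<rho> \<gamma> ` B x \<subseteq> S)"
    if "finite D" "D \<subseteq> eucl m" for D
    using that
  proof (induction D)
    case empty
    have "equivariant_on {} s" for s
      by (simp add: equivariant_on_def)
    then show ?case
      by blast
  next
    case (insert x D)
    then obtain S s where S: "equivariant_on S s" "\<forall>x\<in>D. \<forall>\<gamma>\<in>carrier G. \<rho> \<gamma> ` B x \<subseteq> S"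
      by auto
    have x: "x \<in> eucl m"
      using insert by simp
    obtain s' where "equivariant_on (S \<union> (\<Union>\<gamma>\<in>carrier G. \<rho> \<gamma> ` B x)) s'"
      unfolding B_def by (rule equivariant_extension[OF S(1) x e(1)[OF x] e(2)[OF x]])
    moreover have "\<forall>y\<in>insert x D. \<forall>\<gamma>\<in>carrier G. \<rho> \<gamma> ` B y \<subseteq> S \<union> (\<Union>\<gamma>\<in>carrier G. \<rho> \<gamma> ` B x)"
      using S(2) by blast
    ultimately show ?case
      by blast
  qed
  obtain r where r: "\<And>x. x \<in> eucl m \<Longrightarrow> \<exists>\<gamma>\<in>carrier G. euclidean_dist m (\<rho> \<gamma> x) origin < r"
    using rho_coc by blast
  define C where "C = {x \<in> eucl m. euclidean_dist m x origin \<le> r}"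
  have "compactin (Euclidean_space m) C"
    unfolding C_def using compact_euclidean_cball[of m origin r]
    by (subst Euclidean_space_eq) (simp add: compactin_subtopology)
  moreover have "\<forall>U\<in>(\<lambda>x. {y \<in> eucl m. euclidean_dist m y x < e x}) ` C. openin (Euclidean_space m) U"
    using openin_euclidean_ball by blast
  moreover have "C \<subseteq> \<Union>((\<lambda>x. {y \<in> eucl m. euclidean_dist m y x < e x}) ` C)"
    using e(1) by (auto simp: C_def)
  ultimately obtain \<F> where \<F>: "finite \<F>" "\<F> \<subseteq> (\<lambda>x. {y \<in> eucl m. euclidean_dist m y x < e x}) ` C" "C \<subseteq> \<Union>\<F>"
    unfolding compactin_def by meson
  then obtain D where D: "finite D" "D \<subseteq> C" "\<F> = (\<lambda>x. {y \<in> eucl m. euclidean_dist m y x < e x}) ` D"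
    using finite_subset_image[OF \<F>(1,2)] by auto
  have "D \<subseteq> eucl m"
    using D(2) by (auto simp: C_def)
  then obtain S s where S: "equivariant_on S s" "\<forall>x\<in>D. \<forall>\<gamma>\<in>carrier G. \<rho> \<gamma> ` B x \<subseteq> S"
    using ext[OF D(1)] by blast
  have "S = eucl m"
  proof
    show "S \<subseteq> eucl m"
      using S(1) by (simp add: equivariant_on_def)
    show "eucl m \<subseteq> S"
    proof
      fix x assume x: "x \<in> eucl m"
      then obtain \<gamma> where g: "\<gamma> \<in> carrier G" "euclidean_dist m (\<rho> \<gamma> x) origin < r"
        using r by blast
      then have "\<rho> \<gamma> x \<in> C"
        using rho_in[OF g(1) x] by (simp add: C_def)
      then obtain U where U: "U \<in> \<F>" "\<rho> \<gamma> x \<in> U"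
        using \<F>(3) by blast
      then obtain y where y: "y \<in> D" "U = {z \<in> eucl m. euclidean_dist m z y < e y}"
        using D(3) by blast
      have "\<rho> \<gamma> x \<in> B y"
        using U(2) unfolding y(2) by (simp add: B_def)
      then have "\<rho> (inv \<gamma>) (\<rho> \<gamma> x) \<in> S"
        using S(2) G.inv_closed[OF g(1)] y(1) by blast
      then show "x \<in> S"
        using rho_inv_left[OF g(1) x] by simp
    qed
  qed
  then have "continuous_map (Euclidean_space m) (mtop M) s"
    using S(1) by (subst Euclidean_space_eq) (simp add: equivariant_on_def)
  moreover have "s (\<rho> \<gamma> x) = \<phi> \<gamma> (s x)" if "\<gamma> \<in> carrier G" "x \<in> eucl m" for \<gamma> x
    using S(1) that \<open>S = eucl m\<close> by (simp add: equivariant_on_def)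
  ultimately show ?thesis
    by (rule that)
qed

end

section \<open>The inequality of dimensions\<close>

text \<open>With m = p + 1 > n, the map \<open>x \<mapsto> F (s x)\<close> on a large sphere of
  \<open>\<real>\<^sup>m\<close> is homotopic to the inclusion away from the origin, and it passes
  through points of \<open>M\<close> that \<open>f\<close> sends to large norm, where
  \<open>F\<close> does not vanish. After radial projection this is a factorization through a sphere
  of dimension n - 1 < p.\<close>

lemma (in euclidean_group_pair) dimension_le: "m \<le> n"
proof (rule ccontr)
  assume "\<not> m \<le> n"
  then obtain p where m: "m = Suc p" and "n \<le> p"
    by (metis Suc_leI le_Suc_ex not_le_imp_less add_Suc le_add1)
  obtain F where F: "smooth_map M (euclidean_manifold m) F"
    and F_equi: "\<And>\<gamma> p. \<gamma> \<in> carrier G \<Longrightarrow> p \<in> mpoints M \<Longrightarrow> F (\<phi> \<gamma> p) = \<rho> \<gamma> (F p)"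
    using ex_equivariant_map by blast
  obtain s where s: "continuous_map (Euclidean_space m) (mtop M) s"
    and s_equi: "\<And>\<gamma> x. \<gamma> \<in> carrier G \<Longrightarrow> x \<in> eucl m \<Longrightarrow> s (\<rho> \<gamma> x) = \<phi> \<gamma> (s x)"
    using ex_equivariant_section by blast
  have F_cont: "continuous_map (mtop M) (Euclidean_space m) F"
    by (rule smooth_map_euclidean_continuous[OF F])
  have F_in: "F q \<in> eucl m" if "q \<in> mpoints M" for q
    using smooth_map_in[OF F that] by simp
  have s_in: "s x \<in> mpoints M" if "x \<in> eucl m" for x
    using continuous_map_image_subset_topspace[OF s] that by blast
  obtain r1 where r1: "r1 > 0" "\<And>q. q \<in> mpoints M \<Longrightarrow> \<exists>\<gamma>\<in>carrier G. \<phi> \<gamma> q \<in> oball r1"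
    using orbit_meets_oball by blast
  obtain C1 where C1: "\<And>q. q \<in> kball r1 \<Longrightarrow> euclidean_dist m (F q) origin \<le> C1"
    using compactin_bounded[OF kball_compact F_cont] by metis
  \<comment> \<open>The zeros of \<open>F\<close> form a bounded set: if \<open>F\<close> vanishes
    at a point that \<gamma> carries into \<open>kball r1\<close>, then
    \<open>\<rho> \<gamma> origin\<close> is a value of \<open>F\<close> on \<open>kball r1\<close>,
    so \<gamma> lies in the finite set \<open>J\<close> and the point in the compact set
    \<open>L\<close>.\<close>
  define J where "J = {\<gamma> \<in> carrier G. euclidean_dist m (\<rho> \<gamma> origin) origin \<le> C1}"
  have J: "finite J" "J \<subseteq> carrier G"
    using rho_proper by (auto simp: J_def)
  define L where "L = (\<Union>\<gamma>\<in>J. \<phi> (inv \<gamma>) ` kball r1)"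
  have "compactin (mtop M) L"
    unfolding L_def
  proof (rule compactin_Union[OF finite_imageI[OF J(1)]])
    fix K assume "K \<in> (\<lambda>\<gamma>. \<phi> (inv \<gamma>) ` kball r1) ` J"
    then show "compactin (mtop M) K"
      using J(2) image_compactin[OF kball_compact phi_continuous] by auto
  qed
  then obtain r0' where r0': "L \<subseteq> kball r0'"
    by (rule compact_in_kball)
  define r0 where "r0 = max r0' 0 + 1"
  have r0: "r0 > 0" "r0' < r0"
    by (auto simp: r0_def)
  have F_nz: "euclidean_dist m (F (f' y)) origin > 0" if y: "y \<in> eucl n" "euclidean_dist n y origin \<ge> r0" for y
  proof (rule ccontr)
    assume "\<not> euclidean_dist m (F (f' y)) origin > 0"
    then have "euclidean_dist m (F (f' y)) origin = 0"
      using euclidean_dist_nonneg[of m "F (f' y)" origin] by linarith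
    then have F0: "F (f' y) = origin"
      using euclidean_dist_eq_0[OF F_in[OF f'_in[OF y(1)]] origin_in_eucl] by blast
    obtain \<gamma> where g: "\<gamma> \<in> carrier G" "\<phi> \<gamma> (f' y) \<in> oball r1"
      using r1(2)[OF f'_in[OF y(1)]] by blast
    then have k: "\<phi> \<gamma> (f' y) \<in> kball r1"
      using oball_subset_kball by blast
    have "euclidean_dist m (\<rho> \<gamma> origin) origin \<le> C1"
      using C1[OF k] F_equi[OF g(1) f'_in[OF y(1)]] F0 by simp
    then have "\<gamma> \<in> J"
      using g(1) by (simp add: J_def)
    moreover have "f' y = \<phi> (inv \<gamma>) (\<phi> \<gamma> (f' y))"
      using A.orbit_sym_aux[OF g(1) f'_in[OF y(1)] refl] by simp
    ultimately have "f' y \<in> L"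
      unfolding L_def using k by blast
    then have "euclidean_dist n (f (f' y)) origin \<le> r0'"
      using r0' by (auto simp: kball_def)
    then show False
      using f_f'[OF y(1)] y(2) r0(2) by simp
  qed
  obtain r where r: "\<And>x. x \<in> eucl m \<Longrightarrow> \<exists>\<gamma>\<in>carrier G. euclidean_dist m (\<rho> \<gamma> x) origin < r"
    using rho_coc by blast
  have Fs: "continuous_map (Euclidean_space m) (Euclidean_space m) (\<lambda>x. F (s x))"
    using continuous_map_compose[OF s F_cont] by (simp add: o_def)
  \<comment> \<open>The distance from \<open>F (s x)\<close> to \<open>x\<close> does not change
    along orbits, so its bound on a ball that meets every orbit holds everywhere.\<close>
  obtain C where C: "\<And>x. x \<in> eucl m \<Longrightarrow> euclidean_dist m (F (s x)) x \<le> C"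
  proof -
    have D: "continuous_map (Euclidean_space m) (Euclidean_space m) (\<lambda>x i. F (s x) i - x i)"
      by (intro continuous_map_Euclidean_space_diff Fs) (simp add: continuous_map_id[unfolded id_def])
    have K: "compactin (Euclidean_space m) {x \<in> eucl m. euclidean_dist m x origin \<le> r}"
      using compact_euclidean_cball[of m origin r] by (subst Euclidean_space_eq) (simp add: compactin_subtopology)
    obtain C where C': "\<And>x. x \<in> {x \<in> eucl m. euclidean_dist m x origin \<le> r} \<Longrightarrow>
        euclidean_dist m (\<lambda>i. F (s x) i - x i) origin \<le> C"
      using compactin_bounded[OF K D, of origin] by blast
    have C: "euclidean_dist m (F (s x)) x \<le> C" if "x \<in> eucl m" "euclidean_dist m x origin \<le> r" for x
      using C'[of x] that by (simp add: euclidean_dist_def)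
    show ?thesis
    proof (rule that[of C])
      fix x assume x: "x \<in> eucl m"
      then obtain \<gamma> where g: "\<gamma> \<in> carrier G" "euclidean_dist m (\<rho> \<gamma> x) origin < r"
        using r by blast
      have "F (s (\<rho> \<gamma> x)) = \<rho> \<gamma> (F (s x))"
        using s_equi[OF g(1) x] F_equi[OF g(1) s_in[OF x]] by simp
      then have "euclidean_dist m (F (s x)) x = euclidean_dist m (F (s (\<rho> \<gamma> x))) (\<rho> \<gamma> x)"
        using rho_dist[OF g(1) F_in[OF s_in[OF x]] x] by simp
      also have "\<dots> \<le> C"
        using C[OF rho_in[OF g(1) x]] g(2) by simp
      finally show "euclidean_dist m (F (s x)) x \<le> C" .
    qed
  qed
  obtain C2 where C2: "\<And>q. q \<in> kball r0 \<Longrightarrow> euclidean_dist m (F q) origin \<le> C2"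
    using compactin_bounded[OF kball_compact F_cont] by metis
  \<comment> \<open>\<open>R > C\<close> keeps the segment from \<open>F (s (X x))\<close> to
    \<open>X x\<close> away from the origin. \<open>R > C + C2\<close> forces \<open>s (X x)\<close>
    out of \<open>kball r0\<close>, on which \<open>F\<close> has norm at most
    \<open>C2\<close>.\<close>
  define R where "R = \<bar>C\<bar> + \<bar>C2\<bar> + 1"
  have R: "R > 0" "C < R" "C + C2 < R"
    by (auto simp: R_def)
  define X where "X x = (\<lambda>i. R * x i)" for x :: "nat \<Rightarrow> real"
  have sphere: "x \<in> eucl m" "euclidean_dist m x origin = 1" if "x \<in> topspace (nsphere p)" for x
    using that by (simp_all add: nsphere_iff m)
  have XE: "X x \<in> eucl m" if "x \<in> topspace (nsphere p)" for x
    using sphere(1)[OF that] by (simp add: X_def in_eucl)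
  have X_norm: "euclidean_dist m (X x) origin = R" if "x \<in> topspace (nsphere p)" for x
    using sphere(2)[OF that] R(1) by (simp add: X_def euclidean_dist_scale)
  have incl: "continuous_map (nsphere p) (Euclidean_space m) (\<lambda>x. x)"
    unfolding nsphere_def m by (simp add: continuous_map_from_subtopology continuous_map_id[unfolded id_def])
  have X_cont: "continuous_map (nsphere p) (Euclidean_space m) X"
    unfolding X_def using sphere(1)
    by (intro continuous_map_euclI continuous_map_real_mult continuous_map_eucl_coord[OF incl] continuous_map_const[THEN iffD2])
      (auto simp: in_eucl)
  define z where "z x = f (s (X x))" for x
  have z_cont: "continuous_map (nsphere p) (Euclidean_space n) z"
    using continuous_map_compose[OF continuous_map_compose[OF X_cont s] f_continuous] by (simp add: z_def[abs_def] o_def)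
  have zE: "z x \<in> eucl n" if "x \<in> topspace (nsphere p)" for x
    using f_in[OF s_in[OF XE[OF that]]] by (simp add: z_def)
  have z_norm: "euclidean_dist n (z x) origin > r0" if x: "x \<in> topspace (nsphere p)" for x
  proof (rule ccontr)
    assume "\<not> euclidean_dist n (z x) origin > r0"
    then have "s (X x) \<in> kball r0"
      using s_in[OF XE[OF x]] by (simp add: kball_def z_def)
    then have "euclidean_dist m (F (s (X x))) origin \<le> C2"
      by (rule C2)
    then show False
      using euclidean_dist_triangle[of m "X x" origin "F (s (X x))"] C[OF XE[OF x]] X_norm[OF x] R(3)
        euclidean_dist_commute[of m "X x" "F (s (X x))"] by linarith
  qed
  show False
  proof (cases n)
    \<comment> \<open>There is no sphere of dimension n - 1 to pass through here, but neither can a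
      point of \<open>\<real>\<^sup>0\<close> have norm above \<open>r0\<close>.\<close>
    case 0
    then show False
      using z_norm[OF in_topspace_nsphere[of p]] r0(1) by (simp add: euclidean_dist_def)
  next
    case n: (Suc q)
    define a where "a x = normalize_vec (Suc q) (z x)" for x
    define b where "b y = normalize_vec (Suc p) (F (f' (\<lambda>i. r0 * y i)))" for y
    have Ff': "continuous_map (Euclidean_space n) (Euclidean_space m) (F \<circ> f')"
      by (rule continuous_map_compose[OF f' F_cont])
    have a_cont: "continuous_map (nsphere p) (nsphere q) a"
      unfolding a_def
    proof (rule continuous_map_normalize)
      show "continuous_map (nsphere p) (Euclidean_space (Suc q)) z"
        using z_cont by (simp add: n)
      show "euclidean_dist (Suc q) (z x) origin > 0" if "x \<in> topspace (nsphere p)" for x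
        using z_norm[OF that] r0(1) by (simp add: n)
    qed
    have b_cont: "continuous_map (nsphere q) (nsphere p) b"
      unfolding b_def
    proof (rule continuous_map_normalize)
      have incl': "continuous_map (nsphere q) (Euclidean_space n) (\<lambda>y. y)"
        unfolding nsphere_def n by (simp add: continuous_map_from_subtopology continuous_map_id[unfolded id_def])
      have "continuous_map (nsphere q) (Euclidean_space n) (\<lambda>y i. r0 * y i)"
        by (intro continuous_map_euclI continuous_map_real_mult continuous_map_eucl_coord[OF incl'] continuous_map_const[THEN iffD2])
          (auto simp: nsphere_iff n in_eucl)
      then show "continuous_map (nsphere q) (Euclidean_space (Suc p)) (\<lambda>y. F (f' (\<lambda>i. r0 * y i)))"
        using continuous_map_compose[OF _ Ff'] by (fastforce simp: o_def m)
      fix y assume y: "y \<in> topspace (nsphere q)"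
      then have "(\<lambda>i. r0 * y i) \<in> eucl n" "euclidean_dist n (\<lambda>i. r0 * y i) origin = r0"
        using r0(1) by (auto simp: nsphere_iff n in_eucl euclidean_dist_scale)
      then show "euclidean_dist (Suc p) (F (f' (\<lambda>i. r0 * y i))) origin > 0"
        using F_nz by (simp add: m)
    qed
    let ?P = "prod_topology (top_of_set {0..1::real}) (nsphere p)"
    have fst_cont: "continuous_map ?P euclideanreal fst"
      using continuous_map_fst continuous_map_into_fulltopology by blast
    define Fs where "Fs x = normalize_vec (Suc p) (F (s (X x)))" for x
    have "homotopic_with (\<lambda>_. True) (nsphere p) (nsphere p) (b \<circ> a) Fs"
    proof (rule homotopic_normalize)
      \<comment> \<open>Radial motion from a point of norm \<open>r0\<close> at t = 0 to
        \<open>z x\<close> itself at t = 1; the norm stays at least \<open>r0\<close> throughout,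
        where \<open>F \<circ> f'\<close> has no zero.\<close>
      define w where "w tx = (\<lambda>i. ((1 - fst tx) * (r0 / euclidean_dist n (z (snd tx)) origin) + fst tx) * z (snd tx) i)"
        for tx :: "real \<times> (nat \<Rightarrow> real)"
      let ?h = "\<lambda>tx. F (f' (w tx))"
      have zs: "continuous_map ?P (Euclidean_space n) (\<lambda>tx. z (snd tx))"
        using continuous_map_compose[OF continuous_map_snd z_cont] by (simp add: o_def)
      have wE: "w (t, x) \<in> eucl n" if "x \<in> topspace (nsphere p)" for t x
        using zE[OF that] by (simp add: w_def in_eucl)
      have "continuous_map ?P (Euclidean_space n) w"
      proof (rule continuous_map_euclI)
        show "continuous_map ?P euclideanreal (\<lambda>tx. w tx i)" for i
          unfolding w_def
          by (intro continuous_map_real_mult continuous_map_add continuous_map_diff continuous_map_real_divide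
              continuous_map_euclidean_dist[OF zs] continuous_map_eucl_coord[OF zs] fst_cont
              continuous_map_const[THEN iffD2]) (use z_norm r0(1) in fastforce)+
        show "w \<in> topspace ?P \<rightarrow> eucl n"
          using wE by auto
      qed
      from continuous_map_compose[OF this Ff'] show "continuous_map ?P (Euclidean_space (Suc p)) ?h"
        by (simp add: o_def m)
      show "euclidean_dist (Suc p) (?h (t, x)) origin > 0" if t: "t \<in> {0..1}" and x: "x \<in> topspace (nsphere p)" for t x
      proof -
        let ?d = "euclidean_dist n (z x) origin"
        have d: "?d > r0"
          by (rule z_norm[OF x])
        have "euclidean_dist n (w (t, x)) origin = \<bar>(1 - t) * (r0 / ?d) + t\<bar> * ?d"
          by (simp add: w_def euclidean_dist_scale)
        also have "\<dots> = (1 - t) * r0 + t * ?d"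
        proof -
          have "?d > 0"
            using d r0(1) by linarith
          then have "(1 - t) * (r0 / ?d) + t \<ge> 0"
            using t r0(1) by simp
          then show ?thesis
            using \<open>?d > 0\<close> by (simp add: abs_of_nonneg distrib_right)
        qed
        also have "\<dots> \<ge> (1 - t) * r0 + t * r0"
          using t d by (intro add_left_mono mult_left_mono) auto
        finally have "euclidean_dist n (w (t, x)) origin \<ge> r0"
          by (simp add: algebra_simps)
        then show ?thesis
          using F_nz[OF wE[OF x]] by (simp add: m)
      qed
      show "normalize_vec (Suc p) (?h (0, x)) = (b \<circ> a) x" for x
        by (simp add: w_def a_def b_def normalize_vec_def n)
      show "normalize_vec (Suc p) (?h (1, x)) = Fs x" if "x \<in> topspace (nsphere p)" for x
        using f'_f[OF s_in[OF XE[OF that]]] by (simp add: w_def Fs_def z_def)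
    qed
    moreover have "homotopic_with (\<lambda>_. True) (nsphere p) (nsphere p) Fs id"
    proof (rule homotopic_normalize)
      \<comment> \<open>The straight line from \<open>F (s (X x))\<close> to \<open>X x\<close>; its
        points stay within C of \<open>X x\<close>, whose norm is R.\<close>
      let ?h = "\<lambda>tx i. (1 - fst tx) * F (s (X (snd tx))) i + fst tx * X (snd tx) i"
      have FsX: "continuous_map ?P (Euclidean_space m) (\<lambda>tx. F (s (X (snd tx))))"
        using continuous_map_compose[OF continuous_map_compose[OF continuous_map_snd X_cont] Fs] by (simp add: o_def)
      have Xs: "continuous_map ?P (Euclidean_space m) (\<lambda>tx. X (snd tx))"
        using continuous_map_compose[OF continuous_map_snd X_cont] by (simp add: o_def)
      show "continuous_map ?P (Euclidean_space (Suc p)) ?h"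
      proof (rule continuous_map_euclI)
        show "continuous_map ?P euclideanreal (\<lambda>tx. ?h tx i)" for i
          by (intro continuous_map_real_mult continuous_map_add continuous_map_diff
              continuous_map_eucl_coord[OF FsX] continuous_map_eucl_coord[OF Xs] fst_cont
              continuous_map_const[THEN iffD2]) auto
        show "?h \<in> topspace ?P \<rightarrow> eucl (Suc p)"
          using F_in[OF s_in[OF XE]] XE by (auto simp: in_eucl m)
      qed
      show "euclidean_dist (Suc p) (?h (t, x)) origin > 0" if t: "t \<in> {0..1}" and x: "x \<in> topspace (nsphere p)" for t x
      proof -
        let ?y = "F (s (X x))"
        have "euclidean_dist m (X x) (?h (t, x)) = euclidean_dist m (\<lambda>i. (1 - t) * (X x i - ?y i)) origin"
          by (simp add: euclidean_dist_def algebra_simps)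
        also have "\<dots> = \<bar>1 - t\<bar> * euclidean_dist m (\<lambda>i. X x i - ?y i) origin"
          by (rule euclidean_dist_scale)
        also have "euclidean_dist m (\<lambda>i. X x i - ?y i) origin = euclidean_dist m ?y (X x)"
          by (subst euclidean_dist_commute) (simp add: euclidean_dist_def)
        also have "\<bar>1 - t\<bar> * euclidean_dist m ?y (X x) \<le> 1 * euclidean_dist m ?y (X x)"
          using t by (intro mult_right_mono) auto
        also have "\<dots> \<le> C"
          using C[OF XE[OF x]] by simp
        finally show ?thesis
          using euclidean_dist_triangle[of m "X x" origin "?h (t, x)"] X_norm[OF x] R(2) by (simp add: m)
      qed
      show "normalize_vec (Suc p) (?h (0, x)) = Fs x" for x
        by (simp add: Fs_def)
      show "normalize_vec (Suc p) (?h (1, x)) = id x" if "x \<in> topspace (nsphere p)" for x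
        using X_norm[OF that] R(1) by (simp add: normalize_vec_def m X_def)
    qed
    ultimately have "homotopic_with (\<lambda>_. True) (nsphere p) (nsphere p) (b \<circ> a) id"
      by (rule homotopic_with_trans)
    then show False
      using nsphere_not_factor[OF _ a_cont b_cont] \<open>n \<le> p\<close> n by simp
  qed
qed

section \<open>Quadratic forms\<close>

text \<open>The minimum over the compact unit sphere is positive, and homogeneity of degree 2
  extends the bound to all vectors.\<close>

lemma quadratic_form_bounded_below:
  fixes a :: "nat \<Rightarrow> nat \<Rightarrow> real"
  assumes pos: "\<And>v. \<exists>i<d. v i \<noteq> 0 \<Longrightarrow> 0 < (\<Sum>i<d. \<Sum>j<d. a i j * v i * v j)"
  obtains l where "l > 0" and "\<And>v. l * (\<Sum>i<d. (v i)\<^sup>2) \<le> (\<Sum>i<d. \<Sum>j<d. a i j * v i * v j)"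
proof -
  define Q where "Q v = (\<Sum>i<d. \<Sum>j<d. a i j * v i * v j)" for v
  define S where "S = {v \<in> eucl d. euclidean_dist d v origin \<le> 1} \<inter> (\<lambda>v. euclidean_dist d v origin) -` {1}"
  have "closed ((\<lambda>v. euclidean_dist d v origin) -` {1})"
    using continuous_closed_preimage[OF continuous_on_euclidean_dist[of UNIV d origin], of "{1}"] by simp
  then have S: "compact S"
    unfolding S_def by (intro compact_Int_closed compact_euclidean_cball)
  have nonzero: "\<exists>i<d. v i \<noteq> 0" if "euclidean_dist d v origin \<noteq> 0" for v
  proof (rule ccontr)
    assume "\<not> (\<exists>i<d. v i \<noteq> 0)"
    then have "(\<Sum>i<d. (v i)\<^sup>2) = 0"
      by (intro sum.neutral) auto
    then show False
      using that by (simp only: euclidean_dist_origin real_sqrt_zero)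
  qed
  have Q_nonneg: "Q v \<ge> 0" for v
  proof (cases "\<exists>i<d. v i \<noteq> 0")
    case True
    then show ?thesis
      using pos[of v] by (simp add: Q_def)
  next
    case False
    then have "Q v = 0"
      unfolding Q_def by (intro sum.neutral ballI) auto
    then show ?thesis
      by simp
  qed
  have scale: "\<exists>w\<in>S. Q v = Q w * (\<Sum>i<d. (v i)\<^sup>2)" if "(\<Sum>i<d. (v i)\<^sup>2) \<noteq> 0" for v
  proof -
    define t where "t = euclidean_dist d v origin"
    have t2: "t\<^sup>2 = (\<Sum>i<d. (v i)\<^sup>2)"
      by (simp add: t_def euclidean_dist_origin sum_nonneg)
    then have t: "t > 0"
    proof -
      have "t \<noteq> 0"
        using that t2 by auto
      moreover have "t \<ge> 0"
        by (simp add: t_def)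
      ultimately show ?thesis
        by simp
    qed
    define w where "w = (\<lambda>i. if i < d then v i / t else 0)"
    have "(\<Sum>i<d. (w i)\<^sup>2) = (\<Sum>i<d. (v i)\<^sup>2 / t\<^sup>2)"
      by (intro sum.cong refl) (simp add: w_def power_divide)
    also have "\<dots> = t\<^sup>2 / t\<^sup>2"
      by (simp only: t2 sum_divide_distrib)
    also have "\<dots> = 1"
      using t by simp
    finally have "w \<in> S"
      by (simp add: S_def euclidean_dist_origin w_def in_eucl)
    moreover have "Q w = (\<Sum>i<d. \<Sum>j<d. (a i j * v i * v j) / t\<^sup>2)"
      unfolding Q_def by (intro sum.cong refl) (simp add: w_def power2_eq_square)
    then have "Q w = Q v / t\<^sup>2"
      by (simp add: Q_def sum_divide_distrib)
    then have "Q v = Q w * t\<^sup>2"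
      using t by simp
    ultimately show ?thesis
      using t2 by auto
  qed
  show ?thesis
  proof (cases "S = {}")
    \<comment> \<open>This is the case d = 0, in which there are no unit vectors and every positive
      \<open>l\<close> works.\<close>
    case True
    then have "(\<Sum>i<d. (v i)\<^sup>2) = 0" for v :: "nat \<Rightarrow> real"
      using scale[of v] by (metis empty_iff)
    then show ?thesis
      using Q_nonneg by (intro that[of 1]) (auto simp: Q_def)
  next
    case False
    have "continuous_on S Q"
      unfolding Q_def by (intro continuous_intros continuous_on_coord)
    then obtain w0 where w0: "w0 \<in> S" "\<And>w. w \<in> S \<Longrightarrow> Q w0 \<le> Q w"
      using continuous_attains_inf[OF S False] by blast
    have "\<exists>i<d. w0 i \<noteq> 0"
      by (rule nonzero) (use w0(1) in \<open>simp add: S_def\<close>)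
    then have "Q w0 > 0"
      using pos by (simp add: Q_def)
    moreover have "Q w0 * (\<Sum>i<d. (v i)\<^sup>2) \<le> Q v" for v
    proof (cases "(\<Sum>i<d. (v i)\<^sup>2) = 0")
      case True
      then show ?thesis
        using Q_nonneg by simp
    next
      case False
      then obtain w where "w \<in> S" "Q v = Q w * (\<Sum>i<d. (v i)\<^sup>2)"
        using scale by blast
      then show ?thesis
        using w0(2) by (simp add: mult_right_mono sum_nonneg)
    qed
    ultimately show ?thesis
      using that[of "Q w0"] by (simp add: Q_def)
  qed
qed

text \<open>By 2 |x y| \<le> x^2 + y^2 each term splits into two squares; each square is then summed
  over one idle index, which produces the factor d.\<close>

lemma quadratic_form_abs_le:
  fixes b :: "nat \<Rightarrow> nat \<Rightarrow> real"
  assumes b: "\<And>i j. i < d \<Longrightarrow> j < d \<Longrightarrow> \<bar>b i j\<bar> \<le> B"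
  shows "\<bar>\<Sum>i<d. \<Sum>j<d. b i j * v i * v j\<bar> \<le> B * real d * (\<Sum>i<d. (v i)\<^sup>2)"
proof -
  have "\<bar>b i j * v i * v j\<bar> \<le> B / 2 * (v i)\<^sup>2 + B / 2 * (v j)\<^sup>2" if ij: "i < d" "j < d" for i j
  proof -
    have B: "B \<ge> 0"
      using b[OF ij] by linarith
    have "(\<bar>v i\<bar> - \<bar>v j\<bar>)\<^sup>2 \<ge> 0"
      by simp
    then have *: "\<bar>v i\<bar> * \<bar>v j\<bar> \<le> ((v i)\<^sup>2 + (v j)\<^sup>2) / 2"
      by (simp add: power2_diff)
    have "\<bar>b i j * v i * v j\<bar> = \<bar>b i j\<bar> * (\<bar>v i\<bar> * \<bar>v j\<bar>)"
      by (simp add: abs_mult)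
    also have "\<dots> \<le> B * (((v i)\<^sup>2 + (v j)\<^sup>2) / 2)"
      by (rule mult_mono[OF b[OF ij] * B]) simp
    finally show ?thesis
      by (simp add: algebra_simps)
  qed
  then have "(\<Sum>i<d. \<Sum>j<d. \<bar>b i j * v i * v j\<bar>) \<le> (\<Sum>i<d. \<Sum>j<d. B / 2 * (v i)\<^sup>2 + B / 2 * (v j)\<^sup>2)"
    by (intro sum_mono) auto
  also have "\<dots> = B * real d * (\<Sum>i<d. (v i)\<^sup>2)"
  proof -
    define K where "K = (\<Sum>j<d. (v j)\<^sup>2)"
    have "(\<Sum>i<d. \<Sum>j<d. B / 2 * (v i)\<^sup>2 + B / 2 * (v j)\<^sup>2) =
        (\<Sum>i<d. (real d * (B / 2)) * (v i)\<^sup>2 + B / 2 * K)"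
      by (simp only: K_def sum.distrib sum_distrib_left[symmetric] sum_constant card_lessThan)
        (simp add: mult_ac)
    also have "\<dots> = (real d * (B / 2)) * K + real d * (B / 2 * K)"
      by (simp only: sum.distrib sum_constant card_lessThan) (simp only: K_def sum_distrib_left)
    finally show ?thesis
      by (simp add: K_def)
  qed
  finally have "(\<Sum>i<d. \<Sum>j<d. \<bar>b i j * v i * v j\<bar>) \<le> B * real d * (\<Sum>i<d. (v i)\<^sup>2)" .
  moreover have "\<bar>\<Sum>i<d. \<Sum>j<d. b i j * v i * v j\<bar> \<le> (\<Sum>i<d. \<Sum>j<d. \<bar>b i j * v i * v j\<bar>)"
    by (rule order_trans[OF sum_abs]) (intro sum_mono sum_abs)
  ultimately show ?thesis
    by linarith
qed

section \<open>Shrinking the metric\<close>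

text \<open>The pullback of the flat metric by \<open>u\<close>, kept as a tensor of its own so that
  a multiple of it can be subtracted from \<open>g\<close>.\<close>

definition gram :: "nat \<Rightarrow> ('a \<Rightarrow> nat \<Rightarrow> real) \<Rightarrow> 'a metric_tensor" where
  "gram D u c p i j =
     (\<Sum>k<D. coord_jacobian c (eucl_chart D) u p k i * coord_jacobian c (eucl_chart D) u p k j)"

lemma pulls_back_flat_iff:
  assumes "u \<in> mpoints M \<rightarrow> eucl D" and "\<And>c. c \<in> atlas M \<Longrightarrow> fst c \<subseteq> mpoints M"
  shows "pulls_back_to M g (euclidean_manifold D) flat_metric u \<longleftrightarrow>
    (\<forall>c\<in>atlas M. \<forall>p\<in>fst c. \<forall>i<mdim M. \<forall>j<mdim M. g c p i j = gram D u c p i j)"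
proof -
  have "(\<Sum>l<D. x l * flat_metric c y k l) = x k" if "k < D" for c y k and x :: "nat \<Rightarrow> real"
    using that by (simp add: flat_metric_def if_distrib[of "(*) _"] cong: if_cong)
  then have "(\<Sum>k<D. \<Sum>l<D. J k i * J l j * flat_metric c y k l) = (\<Sum>k<D. J k i * J k j)" for J c y and i j :: nat
    by (intro sum.cong refl) (simp add: mult.assoc flip: sum_distrib_left)
  moreover have "u p \<in> eucl D" if "c \<in> atlas M" "p \<in> fst c" for c p
    using assms that by blast
  ultimately show ?thesis
    unfolding pulls_back_to_def gram_def by simp
qed

lemma gram_compose:
  assumes M: "smooth_manifold M" and \<psi>: "smooth_map M M \<psi>" and F: "smooth_map M (euclidean_manifold m) F"
    and c: "c \<in> atlas M" and d: "d \<in> atlas M" and p: "p \<in> fst c" "\<psi> p \<in> fst d"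
    and ij: "i < mdim M" "j < mdim M"
  shows "gram m (F \<circ> \<psi>) c p i j = (\<Sum>a<mdim M. \<Sum>b<mdim M.
    coord_jacobian c d \<psi> p a i * coord_jacobian c d \<psi> p b j * gram m F d (\<psi> p) a b)"
proof -
  have "F (\<psi> p) \<in> eucl m"
    using smooth_map_in[OF F smooth_map_in[OF \<psi>]] p(1) chart_dom_subset[OF M c] by auto
  then have "coord_jacobian c (eucl_chart m) (F \<circ> \<psi>) p k i =
      (\<Sum>a<mdim M. coord_jacobian d (eucl_chart m) F (\<psi> p) k a * coord_jacobian c d \<psi> p a i)"
    if "k < m" "i < mdim M" for k i
    by (intro coord_jacobian_compose[OF M M smooth_manifold_euclidean \<psi> F c d]) (use p that in auto)
  then have "gram m (F \<circ> \<psi>) c p i j = (\<Sum>k<m.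
      (\<Sum>a<mdim M. coord_jacobian d (eucl_chart m) F (\<psi> p) k a * coord_jacobian c d \<psi> p a i) *
      (\<Sum>b<mdim M. coord_jacobian d (eucl_chart m) F (\<psi> p) k b * coord_jacobian c d \<psi> p b j))"
    unfolding gram_def using ij by simp
  then show ?thesis
    unfolding gram_matrix_compose gram_def .
qed

lemma partial_deriv_affine:
  assumes U: "openin (Euclidean_space n) U" and f: "\<And>l. l < m \<Longrightarrow> smooth_fun_on n U (f l)"
    and x: "x \<in> U" and i: "i < n"
  shows "partial_deriv i (\<lambda>x. b + (\<Sum>l<m. a l * f l x)) x = (\<Sum>l<m. a l * partial_deriv i (f l) x)"
proof -
  have D: "((\<lambda>t. f l (x(i := t))) has_real_derivative partial_deriv i (f l) x) (at (x i))" if "l < m" for l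
    by (rule Ck_on_partial_deriv[OF smooth_fun_onD[OF f[OF that]] x i])
  have "((\<lambda>t. \<Sum>l<m. a l * f l (x(i := t))) has_real_derivative (\<Sum>l<m. a l * partial_deriv i (f l) x)) (at (x i))"
    by (intro DERIV_sum DERIV_cmult D) auto
  then have "((\<lambda>t. b + (\<Sum>l<m. a l * f l (x(i := t)))) has_real_derivative (\<Sum>l<m. a l * partial_deriv i (f l) x)) (at (x i))"
    using DERIV_add[OF DERIV_const[of b]] by fastforce
  then show ?thesis
    unfolding partial_deriv_def[of i "\<lambda>x. b + (\<Sum>l<m. a l * f l x)"] by (rule DERIV_imp_deriv)
qed

text \<open>A Gram matrix does not see an orthogonal factor on the left, and the translation part of
  \<open>R\<close> is lost on differentiation. \<open>F'\<close> is prescribed on \<open>M\<close>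
  only, so the coordinate functions are compared on the open image of the chart.\<close>

lemma gram_isometry:
  assumes M: "smooth_manifold M" and F: "smooth_map M (euclidean_manifold m) F"
    and R: "R \<in> euclidean_isometries m" and F': "\<And>p. p \<in> mpoints M \<Longrightarrow> F' p = R (F p)"
    and c: "c \<in> atlas M" and p: "p \<in> fst c" and ij: "i < mdim M" "j < mdim M"
  shows "gram m F' c p i j = gram m F c p i j"
proof -
  obtain A where orth: "\<And>i j. i < m \<Longrightarrow> j < m \<Longrightarrow> (\<Sum>k<m. A k i * A k j) = (if i = j then 1 else 0)"
    and aff: "\<And>x k. x \<in> eucl m \<Longrightarrow> k < m \<Longrightarrow> R x k = R origin k + (\<Sum>i<m. A k i * x i)"
    using euclidean_isometry_affine[OF R] by blast
  have F_in: "F q \<in> eucl m" if "q \<in> mpoints M" for q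
    using smooth_map_in[OF F that] by simp
  let ?J = "coord_jacobian c (eucl_chart m) F p"
  have jac: "coord_jacobian c (eucl_chart m) F' p k i = (\<Sum>l<m. A k l * ?J l i)" if k: "k < m" and i: "i < mdim M" for k i
  proof -
    have "partial_deriv i (\<lambda>x. F' (chart_inv c x) k) (snd c p) =
        partial_deriv i (\<lambda>x. R origin k + (\<Sum>l<m. A k l * F (chart_inv c x) l)) (snd c p)"
    proof (rule partial_deriv_cong[OF chart_image_open[OF M c] _ i])
      fix x assume "x \<in> snd c ` fst c"
      then have "chart_inv c x \<in> mpoints M"
        using subsetD[OF chart_dom_subset[OF M c] chart_inv_in] by blast
      then show "F' (chart_inv c x) k = R origin k + (\<Sum>l<m. A k l * F (chart_inv c x) l)"
        using F' aff[OF F_in k] by simp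
    qed (use p in simp)
    also have "\<dots> = (\<Sum>l<m. A k l * partial_deriv i (\<lambda>x. F (chart_inv c x) l) (snd c p))"
    proof (rule partial_deriv_affine[OF chart_image_open[OF M c] _ _ i])
      show "smooth_fun_on (mdim M) (snd c ` fst c) (\<lambda>x. F (chart_inv c x) l)" if "l < m" for l
        using F that c unfolding smooth_map_euclidean_iff[OF M] smooth_real_def by simp
    qed (use p in simp)
    finally show ?thesis
      by (simp add: coord_jacobian_euclidean)
  qed
  have "gram m F' c p i j = (\<Sum>k<m. (\<Sum>a<m. A k a * ?J a i) * (\<Sum>b<m. A k b * ?J b j))"
    unfolding gram_def using ij by (simp add: jac)
  also have "\<dots> = (\<Sum>a<m. \<Sum>b<m. ?J a i * ?J b j * (\<Sum>k<m. A k a * A k b))"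
    by (rule gram_matrix_compose)
  also have "\<dots> = (\<Sum>a<m. \<Sum>b<m. ?J a i * ?J b j * (if a = b then 1 else 0))"
    by (intro sum.cong refl) (simp add: orth)
  also have "\<dots> = gram m F c p i j"
    by (simp add: gram_def if_distrib[of "(*) _"] cong: if_cong)
  finally show ?thesis .
qed

section \<open>Positivity of the shrunk metric\<close>

locale metric_group_pair = euclidean_group_pair +
  fixes g :: "'a metric_tensor" and F :: "'a \<Rightarrow> nat \<Rightarrow> real"
  assumes metric: "riemannian_metric M g"
    and isometric: "\<And>\<gamma>. \<gamma> \<in> carrier G \<Longrightarrow> pulls_back_to M g M g (\<phi> \<gamma>)"
    and F: "smooth_map M (euclidean_manifold m) F"
    and F_equi: "\<And>\<gamma> p. \<gamma> \<in> carrier G \<Longrightarrow> p \<in> mpoints M \<Longrightarrow> F (\<phi> \<gamma> p) = \<rho> \<gamma> (F p)"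
begin

lemma F_in: "p \<in> mpoints M \<Longrightarrow> F p \<in> eucl m"
  using smooth_map_in[OF F] by simp

lemma F_continuous: "continuous_map (mtop M) (Euclidean_space m) F"
  by (rule smooth_map_euclidean_continuous[OF F])

definition shrunk :: "real \<Rightarrow> 'a metric_tensor" where
  "shrunk e c p i j = g c p i j - e\<^sup>2 * gram m F c p i j"

lemma gram_invariant:
  assumes "\<gamma> \<in> carrier G" and c: "c \<in> atlas M" and d: "d \<in> atlas M"
    and p: "p \<in> fst c" "\<phi> \<gamma> p \<in> fst d" and ij: "i < mdim M" "j < mdim M"
  shows "gram m F c p i j = (\<Sum>a<mdim M. \<Sum>b<mdim M.
    coord_jacobian c d (\<phi> \<gamma>) p a i * coord_jacobian c d (\<phi> \<gamma>) p b j * gram m F d (\<phi> \<gamma> p) a b)"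
proof -
  have "gram m (F \<circ> \<phi> \<gamma>) c p i j = gram m F c p i j"
    by (rule gram_isometry[OF M F rho_isom[OF assms(1)] _ c p(1) ij]) (simp add: F_equi[OF assms(1)])
  then show ?thesis
    using gram_compose[OF M smooth_act[OF assms(1)] F c d p ij] by simp
qed

lemma shrunk_invariant:
  assumes \<gamma>: "\<gamma> \<in> carrier G" and c: "c \<in> atlas M" and d: "d \<in> atlas M"
    and p: "p \<in> fst c" "\<phi> \<gamma> p \<in> fst d" and ij: "i < mdim M" "j < mdim M"
  shows "shrunk e c p i j = (\<Sum>a<mdim M. \<Sum>b<mdim M.
    coord_jacobian c d (\<phi> \<gamma>) p a i * coord_jacobian c d (\<phi> \<gamma>) p b j * shrunk e d (\<phi> \<gamma> p) a b)"
proof -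
  have 1: "g c p i j = (\<Sum>a<mdim M. \<Sum>b<mdim M.
      coord_jacobian c d (\<phi> \<gamma>) p a i * coord_jacobian c d (\<phi> \<gamma>) p b j * g d (\<phi> \<gamma> p) a b)"
    using isometric[OF \<gamma>] c d p ij unfolding pulls_back_to_def by blast
  show ?thesis
    unfolding shrunk_def right_diff_distrib sum_subtractf 1[symmetric]
    using gram_invariant[OF \<gamma> c d p ij] by (simp add: sum_distrib_left mult_ac)
qed

lemma metric_positive:
  assumes "c \<in> atlas M" and "p \<in> fst c" and "\<exists>i<mdim M. v i \<noteq> 0"
  shows "0 < (\<Sum>i<mdim M. \<Sum>j<mdim M. g c p i j * v i * v j)"
  using metric assms unfolding riemannian_metric_def by blast

lemma chart_component_open:
  assumes c: "c \<in> atlas M" and "continuous_on (snd c ` fst c) (\<lambda>x. u (chart_inv c x))" and "open S"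
  shows "openin (mtop M) {q \<in> fst c. u q \<in> S}"
proof -
  have "openin (Euclidean_space (mdim M)) (snd c ` fst c \<inter> (\<lambda>x. u (chart_inv c x)) -` S)"
    by (rule openin_eucl_preimage[OF chart_image_open[OF M c] assms(2,3)])
  from chart_preimage_open[OF M c this]
  have "openin (mtop M) {p \<in> fst c. snd c p \<in> snd c ` fst c \<inter> (\<lambda>x. u (chart_inv c x)) -` S}" .
  moreover have "{p \<in> fst c. snd c p \<in> snd c ` fst c \<inter> (\<lambda>x. u (chart_inv c x)) -` S} = {q \<in> fst c. u q \<in> S}"
    by (intro Collect_cong conj_cong refl) (simp add: chart_inv_left[OF M c])
  ultimately show ?thesis
    by simp
qed

lemma metric_smooth:
  assumes "c \<in> atlas M" and "i < mdim M" and "j < mdim M"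
  shows "smooth_fun_on (mdim M) (snd c ` fst c) (\<lambda>x. g c (chart_inv c x) i j)"
  using metric assms unfolding riemannian_metric_def by blast

lemma gram_smooth:
  assumes c: "c \<in> atlas M" and ij: "i < mdim M" "j < mdim M"
  shows "smooth_fun_on (mdim M) (snd c ` fst c) (\<lambda>x. gram m F c (chart_inv c x) i j)"
proof -
  let ?U = "snd c ` fst c"
  note U = chart_image_open[OF M c]
  have "smooth_fun_on (mdim M) ?U (\<lambda>x. F (chart_inv c x) k)" if "k < m" for k
    using F that c unfolding smooth_map_euclidean_iff[OF M] smooth_real_def by simp
  then have "smooth_fun_on (mdim M) ?U (\<lambda>x. \<Sum>k<m. partial_deriv i (\<lambda>x. F (chart_inv c x) k) x *
      partial_deriv j (\<lambda>x. F (chart_inv c x) k) x)"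
    using ij by (intro smooth_fun_on_sum[OF U] smooth_fun_on_mult[OF U] smooth_fun_on_partial_deriv) auto
  moreover have "gram m F c (chart_inv c x) i j = (\<Sum>k<m. partial_deriv i (\<lambda>x. F (chart_inv c x) k) x *
      partial_deriv j (\<lambda>x. F (chart_inv c x) k) x)" if "x \<in> ?U" for x
    using chart_inv_right[OF that] by (simp add: gram_def coord_jacobian_euclidean)
  ultimately show ?thesis
    using smooth_fun_on_cong[OF U, of "\<lambda>x. gram m F c (chart_inv c x) i j"] by simp
qed

definition shrunk_positive :: "real \<Rightarrow> 'a chart \<Rightarrow> 'a \<Rightarrow> bool" where
  "shrunk_positive e c p \<longleftrightarrow>
     (\<forall>v. (\<exists>i<mdim M. v i \<noteq> 0) \<longrightarrow> 0 < (\<Sum>i<mdim M. \<Sum>j<mdim M. shrunk e c p i j * v i * v j))"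

text \<open>\<open>g\<close> at \<open>p\<close> is at least \<open>l\<close> times the squared
  norm, moving from \<open>p\<close> to \<open>q\<close> costs at most l / 4 of it, and the
  subtracted tensor costs at most another l / 4. The bound \<open>e0\<close> is uniform on
  \<open>W\<close>, as the compactness argument that follows demands.\<close>

lemma shrunk_positive_local:
  assumes c: "c \<in> atlas M" and p: "p \<in> fst c"
  obtains W e0 where "openin (mtop M) W" and "p \<in> W" and "W \<subseteq> fst c" and "e0 > 0"
    and "\<And>q e. q \<in> W \<Longrightarrow> 0 < e \<Longrightarrow> e \<le> e0 \<Longrightarrow> shrunk_positive e c q"
proof -
  let ?d = "mdim M"
  obtain l where l: "l > 0"
    "\<And>v. l * (\<Sum>i<?d. (v i)\<^sup>2) \<le> (\<Sum>i<?d. \<Sum>j<?d. g c p i j * v i * v j)"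
    using quadratic_form_bounded_below[of ?d "g c p"] metric_positive[OF c p] by blast
  \<comment> \<open>Calibrated so that \<open>quadratic_form_abs_le\<close> gives l / 4; the summand
    1 avoids division by 0 in dimension 0.\<close>
  define \<eta> where "\<eta> = l / (4 * (real ?d + 1))"
  have \<eta>: "\<eta> > 0" "\<eta> * real ?d \<le> l / 4"
    using l(1) by (auto simp: \<eta>_def field_simps)
  define W where "W = fst c \<inter> (\<Inter>(i, j)\<in>{..<?d} \<times> {..<?d}.
      {q \<in> fst c. g c q i j \<in> ball (g c p i j) \<eta>} \<inter>
      {q \<in> fst c. gram m F c q i j \<in> ball (gram m F c p i j) 1})"
  have "openin (mtop M) W"
  proof (cases "?d = 0")
    \<comment> \<open>In dimension 0 the intersection is over an empty family; the factor
      \<open>fst c\<close> in \<open>W\<close> takes care of it.\<close>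
    case True
    then show ?thesis
      using chart_dom_open[OF M c] by (simp add: W_def)
  next
    case False
    have "openin (mtop M) (\<Inter>(i, j)\<in>{..<?d} \<times> {..<?d}.
      {q \<in> fst c. g c q i j \<in> ball (g c p i j) \<eta>} \<inter>
      {q \<in> fst c. gram m F c q i j \<in> ball (gram m F c p i j) 1})"
    proof (rule openin_INT2)
      show "{..<?d} \<times> {..<?d} \<noteq> {}"
        using False by auto
      fix z assume "z \<in> {..<?d} \<times> {..<?d}"
      then obtain i j where z: "z = (i, j)" "i < ?d" "j < ?d"
        by auto
      show "openin (mtop M) (case z of (i, j) \<Rightarrow> {q \<in> fst c. g c q i j \<in> ball (g c p i j) \<eta>} \<inter>
          {q \<in> fst c. gram m F c q i j \<in> ball (gram m F c p i j) 1})"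
        unfolding z(1) prod.case
        by (intro openin_Int chart_component_open[OF c] open_ball
            smooth_fun_on_imp_continuous_on[OF metric_smooth[OF c z(2,3)]]
            smooth_fun_on_imp_continuous_on[OF gram_smooth[OF c z(2,3)]])
    qed simp
    then show ?thesis
      unfolding W_def using chart_dom_open[OF M c] by (rule openin_Int[rotated])
  qed
  moreover have "p \<in> W"
    using p \<eta>(1) by (auto simp: W_def)
  moreover have "W \<subseteq> fst c"
    by (auto simp: W_def)
  \<comment> \<open>The entries of the Gram tensor at \<open>p\<close> are bounded by the sum of
    their absolute values and change by less than 1 on \<open>W\<close>.\<close>
  moreover define B where "B = (\<Sum>i<?d. \<Sum>j<?d. \<bar>gram m F c p i j\<bar>) + 1"
  have B: "B > 0"
    by (simp add: B_def sum_nonneg add_nonneg_pos)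
  have B_ge: "\<bar>gram m F c q i j\<bar> \<le> B" if q: "q \<in> W" and ij: "i < ?d" "j < ?d" for q i j
  proof -
    have "dist (gram m F c p i j) (gram m F c q i j) < 1"
      using q ij by (auto simp: W_def)
    moreover have "\<bar>gram m F c p i j\<bar> \<le> (\<Sum>j<?d. \<bar>gram m F c p i j\<bar>)"
      using ij by (intro member_le_sum) auto
    moreover have "(\<Sum>j<?d. \<bar>gram m F c p i j\<bar>) \<le> (\<Sum>i<?d. \<Sum>j<?d. \<bar>gram m F c p i j\<bar>)"
      using ij by (intro member_le_sum[of i _ "\<lambda>i. \<Sum>j<?d. \<bar>gram m F c p i j\<bar>"]) (auto simp: sum_nonneg)
    ultimately show ?thesis
      by (simp add: B_def dist_real_def)
  qed
  \<comment> \<open>The solution of \<open>e0\<^sup>2 * B * (d + 1) = l / 4\<close>, where d is the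
    dimension.\<close>
  define e0 where "e0 = sqrt (l / (4 * B * (real ?d + 1)))"
  have e0: "e0 > 0"
    using l(1) B by (simp add: e0_def)
  have e0_sq: "e0\<^sup>2 * B * real ?d \<le> l / 4"
  proof -
    have "e0\<^sup>2 = l / (4 * B * (real ?d + 1))"
      using l(1) B by (simp add: e0_def)
    moreover have "4 * B * (real ?d + 1) > 0"
      using B by simp
    ultimately have "e0\<^sup>2 * (4 * B * (real ?d + 1)) = l"
      using B by simp
    moreover have "e0\<^sup>2 * B * real ?d \<le> e0\<^sup>2 * B * (real ?d + 1)"
      using B by (intro mult_left_mono) auto
    ultimately show ?thesis
      by (simp add: algebra_simps)
  qed
  moreover have "shrunk_positive e c q" if q: "q \<in> W" and e: "0 < e" "e \<le> e0" for q e
    unfolding shrunk_positive_def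
  proof (intro allI impI)
    fix v :: "nat \<Rightarrow> real" assume v: "\<exists>i<?d. v i \<noteq> 0"
    define S where "S = (\<Sum>i<?d. (v i)\<^sup>2)"
    have S: "S > 0"
    proof -
      obtain i where "i < ?d" "v i \<noteq> 0"
        using v by blast
      then show ?thesis
        unfolding S_def by (intro sum_pos2[of _ i]) auto
    qed
    have 1: "\<bar>\<Sum>i<?d. \<Sum>j<?d. (g c q i j - g c p i j) * v i * v j\<bar> \<le> \<eta> * real ?d * S"
      unfolding S_def
    proof (rule quadratic_form_abs_le)
      fix i j assume "i < ?d" "j < ?d"
      then have "dist (g c p i j) (g c q i j) < \<eta>"
        using q by (auto simp: W_def)
      then show "\<bar>g c q i j - g c p i j\<bar> \<le> \<eta>"
        by (simp add: dist_real_def)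
    qed
    have 2: "\<bar>\<Sum>i<?d. \<Sum>j<?d. (e\<^sup>2 * gram m F c q i j) * v i * v j\<bar> \<le> e\<^sup>2 * B * real ?d * S"
      unfolding S_def
    proof (rule quadratic_form_abs_le)
      fix i j assume "i < ?d" "j < ?d"
      then show "\<bar>e\<^sup>2 * gram m F c q i j\<bar> \<le> e\<^sup>2 * B"
        using B_ge[OF q] by (simp add: abs_mult mult_left_mono)
    qed
    have "\<eta> * real ?d * S \<le> l / 4 * S"
      using \<eta>(2) S by (intro mult_right_mono) auto
    moreover have "e\<^sup>2 * B * real ?d * S \<le> l / 4 * S"
    proof -
      have "e\<^sup>2 \<le> e0\<^sup>2"
        using e by (intro power_mono) auto
      then have "e\<^sup>2 * B * real ?d \<le> e0\<^sup>2 * B * real ?d"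
        using B by (intro mult_right_mono) auto
      then show ?thesis
        using e0_sq S by (intro mult_right_mono) auto
    qed
    moreover have "l * S \<le> (\<Sum>i<?d. \<Sum>j<?d. g c p i j * v i * v j)"
      unfolding S_def by (rule l(2))
    moreover have "(\<Sum>i<?d. \<Sum>j<?d. shrunk e c q i j * v i * v j) =
        (\<Sum>i<?d. \<Sum>j<?d. g c p i j * v i * v j) + (\<Sum>i<?d. \<Sum>j<?d. (g c q i j - g c p i j) * v i * v j) -
        (\<Sum>i<?d. \<Sum>j<?d. (e\<^sup>2 * gram m F c q i j) * v i * v j)"
      by (simp add: shrunk_def left_diff_distrib sum_subtractf)
    moreover have "l * S > 0"
      using l(1) S by simp
    ultimately show "0 < (\<Sum>i<?d. \<Sum>j<?d. shrunk e c q i j * v i * v j)"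
      using 1 2 by linarith
  qed
  ultimately show ?thesis
    using that e0 by blast
qed

text \<open>The image \<open>w\<close> of \<open>v\<close> under the differential of
  \<open>\<phi> \<gamma>\<close> is non-zero, because \<open>\<phi> \<gamma>\<close> preserves
  \<open>g\<close> and \<open>g\<close> is positive on \<open>v\<close>. Then invariance of the
  shrunk tensor carries positivity from \<open>w\<close> back to \<open>v\<close>.\<close>

lemma shrunk_positive_transfer:
  assumes \<gamma>: "\<gamma> \<in> carrier G" and c: "c \<in> atlas M" and d: "d \<in> atlas M"
    and p: "p \<in> fst c" "\<phi> \<gamma> p \<in> fst d" and pos: "shrunk_positive e d (\<phi> \<gamma> p)"
  shows "shrunk_positive e c p"
  unfolding shrunk_positive_def
proof (intro allI impI)
  let ?n = "mdim M"
  fix v :: "nat \<Rightarrow> real" assume v: "\<exists>i<?n. v i \<noteq> 0"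
  let ?J = "coord_jacobian c d (\<phi> \<gamma>) p"
  define w where "w k = (\<Sum>i<?n. ?J k i * v i)" for k
  have "(\<Sum>i<?n. \<Sum>j<?n. g c p i j * v i * v j) =
      (\<Sum>i<?n. \<Sum>j<?n. (\<Sum>a<?n. \<Sum>b<?n. ?J a i * ?J b j * g d (\<phi> \<gamma> p) a b) * v i * v j)"
    using isometric[OF \<gamma>] c d p unfolding pulls_back_to_def by (intro sum.cong refl) simp
  also have "\<dots> = (\<Sum>a<?n. \<Sum>b<?n. g d (\<phi> \<gamma> p) a b * w a * w b)"
    unfolding w_def by (rule quadratic_form_pullback)
  finally have "0 < (\<Sum>a<?n. \<Sum>b<?n. g d (\<phi> \<gamma> p) a b * w a * w b)"
    using metric_positive[OF c p(1) v] by simp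
  then have "\<exists>k<?n. w k \<noteq> 0"
    by (metis (no_types, lifting) lessThan_iff less_irrefl mult_zero_right sum.neutral)
  then have "0 < (\<Sum>a<?n. \<Sum>b<?n. shrunk e d (\<phi> \<gamma> p) a b * w a * w b)"
    using pos by (simp add: shrunk_positive_def)
  also have "\<dots> = (\<Sum>i<?n. \<Sum>j<?n. (\<Sum>a<?n. \<Sum>b<?n. ?J a i * ?J b j * shrunk e d (\<phi> \<gamma> p) a b) * v i * v j)"
    unfolding w_def by (rule quadratic_form_pullback[symmetric])
  also have "\<dots> = (\<Sum>i<?n. \<Sum>j<?n. shrunk e c p i j * v i * v j)"
    by (intro sum.cong refl) (simp add: shrunk_invariant[OF \<gamma> c d p])
  finally show "0 < (\<Sum>i<?n. \<Sum>j<?n. shrunk e c p i j * v i * v j)" .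
qed

text \<open>One \<open>e\<close> works on the compact \<open>kball r\<close> by a finite cover, and
  every point is carried there by the group. The transfer changes point and chart together, so
  positivity in the charts chosen for the cover gives it in every chart.\<close>

lemma ex_shrunk_positive:
  obtains e where "e > 0" and "\<And>c p. c \<in> atlas M \<Longrightarrow> p \<in> fst c \<Longrightarrow> shrunk_positive e c p"
proof -
  obtain r where r: "r > 0" "\<And>p. p \<in> mpoints M \<Longrightarrow> \<exists>\<gamma>\<in>carrier G. \<phi> \<gamma> p \<in> oball r"
    using orbit_meets_oball by blast
  have "\<exists>W e0. openin (mtop M) W \<and> p \<in> W \<and> e0 > 0 \<and>
      (\<exists>c\<in>atlas M. W \<subseteq> fst c \<and> (\<forall>q\<in>W. \<forall>e. 0 < e \<and> e \<le> e0 \<longrightarrow> shrunk_positive e c q))"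
    if p: "p \<in> mpoints M" for p
  proof (rule atlas_cover[OF M p])
    fix c assume c: "c \<in> atlas M" "p \<in> fst c"
    show ?thesis
      by (rule shrunk_positive_local[OF c]) (use c(1) in blast)
  qed
  then have "\<forall>p\<in>mpoints M. \<exists>W e0. openin (mtop M) W \<and> p \<in> W \<and> e0 > 0 \<and>
      (\<exists>c\<in>atlas M. W \<subseteq> fst c \<and> (\<forall>q\<in>W. \<forall>e. 0 < e \<and> e \<le> e0 \<longrightarrow> shrunk_positive e c q))"
    by blast
  from bchoice[OF this] obtain W where "\<forall>p\<in>mpoints M. \<exists>e0. openin (mtop M) (W p) \<and> p \<in> W p \<and> e0 > 0 \<and>
      (\<exists>c\<in>atlas M. W p \<subseteq> fst c \<and> (\<forall>q\<in>W p. \<forall>e. 0 < e \<and> e \<le> e0 \<longrightarrow> shrunk_positive e c q))"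
    by blast
  from bchoice[OF this] obtain e0 where W: "\<And>p. p \<in> mpoints M \<Longrightarrow> openin (mtop M) (W p)" "\<And>p. p \<in> mpoints M \<Longrightarrow> p \<in> W p"
    and e0: "\<And>p. p \<in> mpoints M \<Longrightarrow> e0 p > 0"
    and pos: "\<And>p. p \<in> mpoints M \<Longrightarrow> \<exists>c\<in>atlas M. W p \<subseteq> fst c \<and>
      (\<forall>q\<in>W p. \<forall>e. 0 < e \<and> e \<le> e0 p \<longrightarrow> shrunk_positive e c q)"
    by blast
  have kM: "kball r \<subseteq> mpoints M"
    by (auto simp: kball_def)
  have "\<forall>U\<in>W ` kball r. openin (mtop M) U" "kball r \<subseteq> \<Union>(W ` kball r)"
    using W kM by blast+
  then obtain \<F> where \<F>: "finite \<F>" "\<F> \<subseteq> W ` kball r" "kball r \<subseteq> \<Union>\<F>"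
    using kball_compact[of r] unfolding compactin_def by meson
  then obtain D where D: "finite D" "D \<subseteq> kball r" "\<F> = W ` D"
    using finite_subset_image[OF \<F>(1,2)] by auto
  define e where "e = Min (insert 1 (e0 ` D))"
  have e: "e > 0" "\<And>p. p \<in> D \<Longrightarrow> e \<le> e0 p"
    using D e0 kM by (auto simp: e_def)
  have "shrunk_positive e c p" if c: "c \<in> atlas M" and p: "p \<in> fst c" for c p
  proof -
    have "p \<in> mpoints M"
      using p chart_dom_subset[OF M c] by blast
    then obtain \<gamma> where \<gamma>: "\<gamma> \<in> carrier G" "\<phi> \<gamma> p \<in> oball r"
      using r(2) by blast
    then obtain U where "U \<in> \<F>" "\<phi> \<gamma> p \<in> U"
      using oball_subset_kball \<F>(3) by blast
    then obtain y where y: "y \<in> D" "\<phi> \<gamma> p \<in> W y"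
      using D(3) by blast
    then have "y \<in> mpoints M"
      using D(2) kM by blast
    then obtain d where d: "d \<in> atlas M" "W y \<subseteq> fst d"
      "\<And>q e. q \<in> W y \<Longrightarrow> 0 < e \<Longrightarrow> e \<le> e0 y \<Longrightarrow> shrunk_positive e d q"
      using pos by blast
    have "shrunk_positive e d (\<phi> \<gamma> p)"
      using d(3)[OF y(2) e(1) e(2)[OF y(1)]] .
    then show ?thesis
      by (rule shrunk_positive_transfer[OF \<gamma>(1) c d(1) p subsetD[OF d(2) y(2)]])
  qed
  then show ?thesis
    using that e(1) by blast
qed

end

section \<open>The induced metric on the quotient\<close>

context metric_group_pair
begin

abbreviation q :: "'a \<Rightarrow> 'a set" where
  "q \<equiv> orbit G \<phi>"

abbreviation X :: "'a set manifold" where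
  "X \<equiv> quotient_manifold M G \<phi>"

text \<open>The sheets are separated in \<open>\<real>\<^sup>m\<close>: a non-trivial \<gamma> moves
  \<open>F p\<close> by a definite amount, but it would move it by less if \<open>F z\<close> and
  \<open>F (\<phi> \<gamma> z)\<close> were both close to \<open>F p\<close>. The last conclusion
  says more than injectivity, as \<open>\<phi> \<gamma> z\<close> may lie anywhere; it is what makes
  the final map an embedding.\<close>

lemma small_neighbourhood:
  assumes p: "p \<in> mpoints M" and W: "openin (mtop M) W" "p \<in> W"
  obtains V \<delta> where "openin (mtop M) V" and "p \<in> V" and "V \<subseteq> W" and "inj_on q V" and "\<delta> > 0"
    and "\<And>\<gamma> z. \<gamma> \<in> carrier G \<Longrightarrow> z \<in> V \<Longrightarrow> euclidean_dist m (F (\<phi> \<gamma> z)) (F p) < \<delta> \<Longrightarrow> \<gamma> = \<one>"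
proof -
  obtain \<delta> where \<delta>: "\<delta> > 0" "\<And>\<gamma>. \<gamma> \<in> carrier G \<Longrightarrow> euclidean_dist m (\<rho> \<gamma> (F p)) (F p) < \<delta> \<Longrightarrow> \<gamma> = \<one>"
    using rho_separated[OF F_in[OF p]] by blast
  define V where "V = W \<inter> {z \<in> mpoints M. F z \<in> {y \<in> eucl m. euclidean_dist m y (F p) < \<delta> / 2}}"
  have WM: "W \<subseteq> mpoints M"
    using openin_subset[OF W(1)] .
  have V_open: "openin (mtop M) V"
    unfolding V_def
    by (intro openin_Int W(1) openin_continuous_map_preimage[OF F_continuous openin_euclidean_ball])
  have pV: "p \<in> V"
    using p W(2) F_in[OF p] \<delta>(1) by (simp add: V_def)
  have V_W: "V \<subseteq> W"
    by (simp add: V_def)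
  have sep: "\<gamma> = \<one>" if \<gamma>: "\<gamma> \<in> carrier G" and z: "z \<in> V" and "euclidean_dist m (F (\<phi> \<gamma> z)) (F p) < \<delta> / 2" for \<gamma> z
  proof (rule \<delta>(2)[OF \<gamma>])
    have zM: "z \<in> mpoints M" and zF: "euclidean_dist m (F z) (F p) < \<delta> / 2"
      using z by (auto simp: V_def)
    have "euclidean_dist m (\<rho> \<gamma> (F p)) (\<rho> \<gamma> (F z)) = euclidean_dist m (F p) (F z)"
      by (rule rho_dist[OF \<gamma> F_in[OF p] F_in[OF zM]])
    then show "euclidean_dist m (\<rho> \<gamma> (F p)) (F p) < \<delta>"
      using that(3) zF F_equi[OF \<gamma> zM] euclidean_dist_commute[of m "F p" "F z"]
        euclidean_dist_triangle[of m "\<rho> \<gamma> (F p)" "F p" "\<rho> \<gamma> (F z)"] by simp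
  qed
  have "inj_on q V"
  proof (rule inj_onI)
    fix z z' assume z: "z \<in> V" "z' \<in> V" "q z = q z'"
    then have zM: "z \<in> mpoints M" "z' \<in> mpoints M"
      using V_W WM by auto
    obtain \<gamma> where \<gamma>: "\<gamma> \<in> carrier G" "z' = \<phi> \<gamma> z"
      using A.orbit_eqD[OF zM z(3)] by blast
    have "euclidean_dist m (F (\<phi> \<gamma> z)) (F p) < \<delta> / 2"
      using z(2) \<gamma>(2) by (simp add: V_def)
    then have "\<gamma> = \<one>"
      by (rule sep[OF \<gamma>(1) z(1)])
    then show "z = z'"
      using \<gamma>(2) A.id_eq_one zM(1) by (metis restrict_apply')
  qed
  moreover have "\<delta> / 2 > 0"
    using \<delta>(1) by simp
  ultimately show ?thesis
    using that[OF V_open pV V_W] sep by blast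
qed

section \<open>Charts and metric of the quotient\<close>

definition charted :: "'a chart \<Rightarrow> 'a set \<Rightarrow> bool" where
  "charted c V \<longleftrightarrow> c \<in> atlas M \<and> openin (mtop M) V \<and> V \<subseteq> fst c \<and> inj_on q V"

definition qchart :: "'a chart \<Rightarrow> 'a set \<Rightarrow> 'a set chart" where
  "qchart c V = (q ` V, snd c \<circ> inv_into V q)"

lemma quotient_simps:
  "mdim X = mdim M" "mtop X = quotient_topology (mtop M) q" "atlas X = {qchart c V | c V. charted c V}"
  by (simp_all add: quotient_manifold_def charted_def qchart_def)

lemma mpoints_quotient: "mpoints X = q ` mpoints M"
  by (simp add: quotient_simps topspace_quotient_topology)

lemma chartedD:
  assumes "charted c V"
  shows "c \<in> atlas M" and "openin (mtop M) V" and "V \<subseteq> fst c" and "inj_on q V"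
  using assms by (auto simp: charted_def)

lemma charted_subset: "charted c V \<Longrightarrow> V \<subseteq> mpoints M"
  using chartedD(2) openin_subset by blast

lemma fst_qchart: "fst (qchart c V) = q ` V"
  by (simp add: qchart_def)

lemma qchart_apply: "charted c V \<Longrightarrow> v \<in> V \<Longrightarrow> snd (qchart c V) (q v) = snd c v"
  using chartedD(4) by (simp add: qchart_def inv_into_f_f)

lemma qchart_image:
  assumes "charted c V"
  shows "snd (qchart c V) ` fst (qchart c V) = snd c ` V"
proof -
  have "snd (qchart c V) ` q ` V = (\<lambda>v. snd (qchart c V) (q v)) ` V"
    by (simp add: image_image)
  also have "\<dots> = snd c ` V"
    by (rule image_cong[OF refl qchart_apply[OF assms]])
  finally show ?thesis
    by (simp add: fst_qchart)
qed

lemma qchart_image_open: "charted c V \<Longrightarrow> openin (Euclidean_space (mdim M)) (snd c ` V)"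
  by (rule chart_image_subset_open[OF M chartedD(1-3)])

lemma qchart_inv:
  assumes cV: "charted c V" and v: "v \<in> V"
  shows "chart_inv (qchart c V) (snd c v) = q v"
proof -
  have inj: "inj_on (snd (qchart c V)) (q ` V)"
  proof (rule inj_onI)
    fix x y assume x: "x \<in> q ` V" and y: "y \<in> q ` V" and eq: "snd (qchart c V) x = snd (qchart c V) y"
    obtain a b where "x = q a" "y = q b" "a \<in> V" "b \<in> V"
      using x y by blast
    moreover have "snd c a = snd c b"
      using eq calculation qchart_apply[OF cV] by simp
    ultimately show "x = y"
      using inj_onD[OF chart_inj[OF M chartedD(1)[OF cV]], of a b] chartedD(3)[OF cV] by auto
  qed
  have "chart_inv (qchart c V) (snd (qchart c V) (q v)) = q v"
    unfolding chart_inv_def fst_qchart by (rule inv_into_f_f[OF inj imageI[OF v]])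
  then show ?thesis
    by (simp only: qchart_apply[OF cV v])
qed

lemma qchart_inv':
  assumes cV: "charted c V" and x: "x \<in> snd c ` V"
  shows "chart_inv (qchart c V) x = q (chart_inv c x)"
proof -
  obtain v where v: "v \<in> V" "x = snd c v"
    using x by blast
  have "chart_inv c x = v"
    unfolding v(2) by (rule chart_inv_left[OF M chartedD(1)[OF cV] subsetD[OF chartedD(3)[OF cV] v(1)]])
  then show ?thesis
    using qchart_inv[OF cV v(1)] v(2) by simp
qed

lemma q_image: "\<gamma> \<in> carrier G \<Longrightarrow> p \<in> mpoints M \<Longrightarrow> q (\<phi> \<gamma> p) = q p"
  by (rule A.orbit_image)

text \<open>Near \<open>p\<close>, the coordinate change of the quotient is
  \<open>\<phi> \<gamma>\<close> read in \<open>c\<close> and \<open>c'\<close>, since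
  \<open>z\<close> and \<open>\<phi> \<gamma> z\<close> have the same orbit. Tensor computations on
  the quotient thereby become computations on \<open>M\<close>.\<close>

lemma transition_jacobian:
  assumes cV: "charted c V" and cV': "charted c' V'" and p: "p \<in> V"
    and \<gamma>: "\<gamma> \<in> carrier G" "\<phi> \<gamma> p \<in> V'" and i: "i < mdim M"
  shows "coord_jacobian (qchart c V) (qchart c' V') (\<lambda>x. x) (q p) k i = coord_jacobian c c' (\<phi> \<gamma>) p k i"
proof -
  let ?W = "V \<inter> {z \<in> mpoints M. \<phi> \<gamma> z \<in> V'}"
  note c = chartedD[OF cV] and c' = chartedD[OF cV']
  have "openin (mtop M) ?W"
    by (intro openin_Int c(2) openin_continuous_map_preimage[OF phi_continuous[OF \<gamma>(1)] c'(2)])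
  then have open_W: "openin (Euclidean_space (mdim M)) (snd c ` ?W)"
    using c(3) by (intro chart_image_subset_open[OF M c(1)]) auto
  have "partial_deriv i (\<lambda>x. local_rep (qchart c V) (qchart c' V') (\<lambda>x. x) x k) (snd c p) =
      partial_deriv i (\<lambda>x. local_rep c c' (\<phi> \<gamma>) x k) (snd c p)"
  proof (rule partial_deriv_cong[OF open_W _ i])
    show "snd c p \<in> snd c ` ?W"
      using p \<gamma>(2) charted_subset[OF cV] by auto
    fix x assume "x \<in> snd c ` ?W"
    then obtain z where z: "x = snd c z" "z \<in> V" "z \<in> mpoints M" "\<phi> \<gamma> z \<in> V'"
      by blast
    have "snd (qchart c' V') (q z) = snd (qchart c' V') (q (\<phi> \<gamma> z))"
      by (simp only: q_image[OF \<gamma>(1) z(3)])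
    also have "\<dots> = snd c' (\<phi> \<gamma> z)"
      by (rule qchart_apply[OF cV' z(4)])
    finally show "local_rep (qchart c V) (qchart c' V') (\<lambda>x. x) x k = local_rep c c' (\<phi> \<gamma>) x k"
      using qchart_inv[OF cV z(2)] chart_inv_left[OF M c(1) subsetD[OF c(3) z(2)]] by (simp add: local_rep_def z(1))
  qed
  then show ?thesis
    by (simp add: coord_jacobian_def qchart_apply[OF cV p])
qed

text \<open>A chart of the quotient is a bare pair of a set and a function and does not record the
  \<open>c\<close> and \<open>V\<close> from which it was made, so some such pair is chosen.\<close>

definition quotient_metric :: "real \<Rightarrow> 'a set metric_tensor" where
  "quotient_metric e d y i j =
     (let cV = SOME cV. charted (fst cV) (snd cV) \<and> d = qchart (fst cV) (snd cV)
      in shrunk e (fst cV) (inv_into (snd cV) q y) i j)"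

text \<open>Independence of the chart of \<open>M\<close> that was chosen: the transition map between two charts of
  \<open>M\<close> that induce the same chart of the quotient is the identity.\<close>

lemma quotient_metric_eq:
  assumes cV: "charted c V" and p: "p \<in> V" and ij: "i < mdim M" "j < mdim M"
  shows "quotient_metric e (qchart c V) (q p) i j = shrunk e c p i j"
proof -
  define cV0 where "cV0 = (SOME cV. charted (fst cV) (snd cV) \<and> qchart c V = qchart (fst cV) (snd cV))"
  define c0 V0 where "c0 = fst cV0" and "V0 = snd cV0"
  have "charted (fst cV0) (snd cV0) \<and> qchart c V = qchart (fst cV0) (snd cV0)"
    unfolding cV0_def by (rule someI[of _ "(c, V)"]) (simp add: cV)
  then have c0: "charted c0 V0" "qchart c V = qchart c0 V0"
    by (simp_all add: c0_def V0_def)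
  have "q p \<in> q ` V0"
    using c0(2) p fst_qchart by (metis imageI)
  then obtain p0 where p0: "p0 \<in> V0" "q p = q p0"
    by blast
  then have "inv_into V0 q (q p) = p0"
    using chartedD(4)[OF c0(1)] by (simp add: inv_into_f_f)
  then have 1: "quotient_metric e (qchart c V) (q p) i j = shrunk e c0 p0 i j"
    by (simp add: quotient_metric_def Let_def c0_def V0_def cV0_def)
  have pM: "p \<in> mpoints M" "p0 \<in> mpoints M"
    using p p0(1) charted_subset[OF cV] charted_subset[OF c0(1)] by auto
  obtain \<gamma> where \<gamma>: "\<gamma> \<in> carrier G" "p = \<phi> \<gamma> p0"
    using A.orbit_eqD[OF pM(2,1) p0(2)[symmetric]] by blast
  have J: "coord_jacobian c0 c (\<phi> \<gamma>) p0 k l = (if k = l then 1 else 0)" if kl: "k < mdim M" "l < mdim M" for k l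
  proof -
    have "coord_jacobian c0 c (\<phi> \<gamma>) p0 k l = coord_jacobian (qchart c0 V0) (qchart c V) (\<lambda>x. x) (q p0) k l"
      using transition_jacobian[OF c0(1) cV p0(1) \<gamma>(1) _ kl(2)] p \<gamma>(2) by simp
    also have "\<dots> = partial_deriv l (\<lambda>x. local_rep (qchart c0 V0) (qchart c0 V0) (\<lambda>x. x) x k) (snd c0 p0)"
      using qchart_apply[OF c0(1) p0(1)] by (simp add: coord_jacobian_def c0(2))
    also have "\<dots> = partial_deriv l (\<lambda>x. x k) (snd c0 p0)"
    proof (rule partial_deriv_cong[OF qchart_image_open[OF c0(1)] imageI[OF p0(1)] kl(2)])
      fix x assume "x \<in> snd c0 ` V0"
      then show "local_rep (qchart c0 V0) (qchart c0 V0) (\<lambda>x. x) x k = x k"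
        using chart_inv_right[of x "qchart c0 V0"] qchart_image[OF c0(1)] by (simp add: local_rep_def)
    qed
    also have "\<dots> = (if k = l then 1 else 0)"
      by (auto simp: partial_deriv_def)
    finally show ?thesis .
  qed
  have "shrunk e c0 p0 i j = (\<Sum>a<mdim M. \<Sum>b<mdim M.
      coord_jacobian c0 c (\<phi> \<gamma>) p0 a i * coord_jacobian c0 c (\<phi> \<gamma>) p0 b j * shrunk e c (\<phi> \<gamma> p0) a b)"
    using p p0(1) \<gamma>(2) chartedD(1,3)[OF cV] chartedD(1,3)[OF c0(1)]
    by (intro shrunk_invariant[OF \<gamma>(1) _ _ _ _ ij]) auto
  also have "\<dots> = (\<Sum>a<mdim M. \<Sum>b<mdim M. (if a = i then 1 else 0) * (if b = j then 1 else 0) * shrunk e c p a b)"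
    using ij \<gamma>(2) by (intro sum.cong refl) (simp add: J)
  also have "\<dots> = shrunk e c p i j"
  proof -
    have "(\<Sum>b<mdim M. (if a = i then 1 else 0) * (if b = j then 1 else 0) * shrunk e c p a b) =
        (if a = i then shrunk e c p a j else 0)" for a
      using ij(2) by (simp add: if_distrib[of "\<lambda>x. x * _"] cong: if_cong)
    then show ?thesis
      using ij(1) by simp
  qed
  finally show ?thesis
    using 1 by simp
qed

lemma shrunk_smooth:
  assumes "c \<in> atlas M" and "i < mdim M" and "j < mdim M"
  shows "smooth_fun_on (mdim M) (snd c ` fst c) (\<lambda>x. shrunk e c (chart_inv c x) i j)"
  unfolding shrunk_def
  by (intro smooth_fun_on_diff smooth_fun_on_mult smooth_fun_on_const chart_image_open[OF M]
      metric_smooth gram_smooth assms)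

text \<open>Two lifts of a point of the quotient differ by a group element, so the transformation
  law between quotient charts is the invariance of \<open>shrunk e\<close>. The remaining conditions
  are inherited sheet by sheet.\<close>

lemma quotient_metric_riemannian:
  assumes pos: "\<And>c p. c \<in> atlas M \<Longrightarrow> p \<in> fst c \<Longrightarrow> shrunk_positive e c p"
  shows "riemannian_metric X (quotient_metric e)"
  unfolding riemannian_metric_def
proof (intro conjI ballI)
  let ?h = "quotient_metric e"
  show "pulls_back_to X ?h X ?h (\<lambda>p. p)"
    unfolding pulls_back_to_def quotient_simps(1)
  proof (intro ballI impI allI)
    fix d d' y i j
    assume d: "d \<in> atlas X" "d' \<in> atlas X" and y: "y \<in> fst d" "y \<in> fst d'" and ij: "i < mdim M" "j < mdim M"
    obtain c V where cV: "charted c V" "d = qchart c V"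
      using d(1) unfolding quotient_simps by blast
    obtain c' V' where cV': "charted c' V'" "d' = qchart c' V'"
      using d(2) unfolding quotient_simps by blast
    obtain p where p: "p \<in> V" "y = q p"
      using y(1) cV(2) by (auto simp: fst_qchart)
    obtain p' where p': "p' \<in> V'" "y = q p'"
      using y(2) cV'(2) by (auto simp: fst_qchart)
    have pM: "p \<in> mpoints M" "p' \<in> mpoints M"
      using p p' charted_subset[OF cV(1)] charted_subset[OF cV'(1)] by auto
    obtain \<gamma> where \<gamma>: "\<gamma> \<in> carrier G" "p' = \<phi> \<gamma> p"
      using A.orbit_eqD[OF pM] p(2) p'(2) by metis
    have \<gamma>p: "\<phi> \<gamma> p \<in> V'"
      using p'(1) \<gamma>(2) by simp
    have "?h d y i j = shrunk e c p i j"
      unfolding cV(2) p(2) by (rule quotient_metric_eq[OF cV(1) p(1) ij])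
    also have "\<dots> = (\<Sum>a<mdim M. \<Sum>b<mdim M.
        coord_jacobian c c' (\<phi> \<gamma>) p a i * coord_jacobian c c' (\<phi> \<gamma>) p b j * shrunk e c' (\<phi> \<gamma> p) a b)"
      using p(1) \<gamma>p chartedD(1,3)[OF cV(1)] chartedD(1,3)[OF cV'(1)]
      by (intro shrunk_invariant[OF \<gamma>(1) _ _ _ _ ij]) auto
    also have "\<dots> = (\<Sum>a<mdim M. \<Sum>b<mdim M.
        coord_jacobian d d' (\<lambda>p. p) y a i * coord_jacobian d d' (\<lambda>p. p) y b j * ?h d' y a b)"
    proof (intro sum.cong refl)
      fix a b assume ab: "a \<in> {..<mdim M}" "b \<in> {..<mdim M}"
      have "?h d' y a b = shrunk e c' (\<phi> \<gamma> p) a b"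
        unfolding cV'(2) p'(2) \<gamma>(2)[symmetric] using ab by (intro quotient_metric_eq[OF cV'(1) p'(1)]) auto
      moreover have "coord_jacobian d d' (\<lambda>p. p) y k l = coord_jacobian c c' (\<phi> \<gamma>) p k l" if "l < mdim M" for k l
        unfolding cV(2) cV'(2) p(2) by (rule transition_jacobian[OF cV(1) cV'(1) p(1) \<gamma>(1) \<gamma>p that])
      ultimately show "coord_jacobian c c' (\<phi> \<gamma>) p a i * coord_jacobian c c' (\<phi> \<gamma>) p b j * shrunk e c' (\<phi> \<gamma> p) a b =
          coord_jacobian d d' (\<lambda>p. p) y a i * coord_jacobian d d' (\<lambda>p. p) y b j * ?h d' y a b"
        using ij by simp
    qed
    finally show "?h d y i j = (\<Sum>a<mdim M. \<Sum>b<mdim M.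
        coord_jacobian d d' (\<lambda>p. p) y a i * coord_jacobian d d' (\<lambda>p. p) y b j * ?h d' y a b)" .
  qed
  fix d assume "d \<in> atlas X"
  then obtain c V where cV: "charted c V" "d = qchart c V"
    unfolding quotient_simps by blast
  note c = chartedD[OF cV(1)]
  show "\<forall>i<mdim X. \<forall>j<mdim X. smooth_fun_on (mdim X) (snd d ` fst d) (\<lambda>x. ?h d (chart_inv d x) i j)"
    unfolding quotient_simps(1) cV(2) qchart_image[OF cV(1)]
  proof (intro allI impI)
    fix i j assume ij: "i < mdim M" "j < mdim M"
    have "smooth_fun_on (mdim M) (snd c ` V) (\<lambda>x. shrunk e c (chart_inv c x) i j)"
      by (rule smooth_fun_on_subset[OF shrunk_smooth[OF c(1) ij] image_mono[OF c(3)]])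
    moreover have "?h (qchart c V) (chart_inv (qchart c V) x) i j = shrunk e c (chart_inv c x) i j" if "x \<in> snd c ` V" for x
    proof -
      obtain v where v: "v \<in> V" "x = snd c v"
        using \<open>x \<in> snd c ` V\<close> by blast
      then show ?thesis
        using quotient_metric_eq[OF cV(1) v(1) ij] qchart_inv[OF cV(1) v(1)] chart_inv_left[OF M c(1) subsetD[OF c(3) v(1)]]
        by simp
    qed
    ultimately show "smooth_fun_on (mdim M) (snd c ` V) (\<lambda>x. ?h (qchart c V) (chart_inv (qchart c V) x) i j)"
      using smooth_fun_on_cong[OF qchart_image_open[OF cV(1)], of "\<lambda>x. ?h (qchart c V) (chart_inv (qchart c V) x) i j"]
      by simp
  qed
  fix y assume "y \<in> fst d"
  then obtain p where p: "p \<in> V" "y = q p"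
    using cV(2) by (auto simp: fst_qchart)
  have pc: "p \<in> fst c"
    using p(1) c(3) by blast
  have h_eq: "?h d y i j = shrunk e c p i j" if "i < mdim M" "j < mdim M" for i j
    unfolding cV(2) p(2) by (rule quotient_metric_eq[OF cV(1) p(1) that])
  show "\<forall>i<mdim X. \<forall>j<mdim X. ?h d y i j = ?h d y j i"
    unfolding quotient_simps(1)
  proof (intro allI impI)
    fix i j assume ij: "i < mdim M" "j < mdim M"
    have "g c p i j = g c p j i"
      using metric c(1) pc ij unfolding riemannian_metric_def by blast
    then show "?h d y i j = ?h d y j i"
      using h_eq ij by (simp add: shrunk_def gram_def mult.commute)
  qed
  show "\<forall>v. (\<exists>i<mdim X. v i \<noteq> 0) \<longrightarrow> 0 < (\<Sum>i<mdim X. \<Sum>j<mdim X. ?h d y i j * v i * v j)"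
    unfolding quotient_simps(1)
  proof (intro allI impI)
    fix v :: "nat \<Rightarrow> real" assume v: "\<exists>i<mdim M. v i \<noteq> 0"
    have "0 < (\<Sum>i<mdim M. \<Sum>j<mdim M. shrunk e c p i j * v i * v j)"
      using pos[OF c(1) pc] v by (simp add: shrunk_positive_def)
    also have "\<dots> = (\<Sum>i<mdim M. \<Sum>j<mdim M. ?h d y i j * v i * v j)"
      by (intro sum.cong refl) (simp add: h_eq)
    finally show "0 < (\<Sum>i<mdim M. \<Sum>j<mdim M. ?h d y i j * v i * v j)" .
  qed
qed

end

section \<open>The equivariant embedding\<close>

lemma sum_lessThan_add: "(\<Sum>i<a + b. h i) = (\<Sum>i<a. h i) + (\<Sum>j<b. h (a + j))" for h :: "nat \<Rightarrow> real"
  by (induction b) (auto simp: add.assoc)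

lemma sum_lessThan_split3:
  fixes h :: "nat \<Rightarrow> real"
  assumes "m \<le> n"
  shows "(\<Sum>i<N + n. h i) = (\<Sum>i<N. h i) + (\<Sum>j<m. h (N + j)) + (\<Sum>j<n - m. h (N + (m + j)))"
proof -
  have "(\<Sum>i<N + n. h i) = (\<Sum>i<N + (m + (n - m)). h i)"
    using assms by simp
  then show ?thesis
    by (simp only: sum_lessThan_add add.assoc)
qed

text \<open>A vector annihilated by the differential has length 0 in the pulled-back metric, which
  is \<open>g\<close>.\<close>

lemma pulls_back_immersion:
  assumes metric: "riemannian_metric M g" and f: "smooth_map M M' f" and pb: "pulls_back_to M g M' g' f"
  shows "immersion M M' f"
  unfolding immersion_def
proof (intro conjI f ballI impI allI)
  fix c d p v i
  assume c: "c \<in> atlas M" and d: "d \<in> atlas M'" and p: "p \<in> fst c" "f p \<in> fst d"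
    and v: "\<forall>k<mdim M'. (\<Sum>i<mdim M. coord_jacobian c d f p k i * v i) = 0" and i: "i < mdim M"
  let ?J = "coord_jacobian c d f p"
  have "(\<Sum>i<mdim M. \<Sum>j<mdim M. g c p i j * v i * v j) =
      (\<Sum>i<mdim M. \<Sum>j<mdim M. (\<Sum>k<mdim M'. \<Sum>l<mdim M'. ?J k i * ?J l j * g' d (f p) k l) * v i * v j)"
    using pb c d p unfolding pulls_back_to_def by (intro sum.cong refl) simp
  also have "\<dots> = (\<Sum>k<mdim M'. \<Sum>l<mdim M'. g' d (f p) k l * (\<Sum>i<mdim M. ?J k i * v i) * (\<Sum>j<mdim M. ?J l j * v j))"
    by (rule quadratic_form_pullback)
  also have "\<dots> = 0"
    by (intro sum.neutral ballI) (use v in simp)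
  finally have "\<not> 0 < (\<Sum>i<mdim M. \<Sum>j<mdim M. g c p i j * v i * v j)"
    by simp
  then show "v i = 0"
    using metric c p(1) i unfolding riemannian_metric_def by blast
qed

text \<open>Continuity of the inverse, in a form that asks for one open set of the target at each
  point and does not mention the relative topology of the image.\<close>

lemma embedding_mapI:
  assumes cont: "continuous_map T T' u" and inj: "inj_on u (topspace T)"
    and nbhd: "\<And>p U. openin T U \<Longrightarrow> p \<in> U \<Longrightarrow>
      \<exists>W. openin T' W \<and> u p \<in> W \<and> (\<forall>z\<in>topspace T. u z \<in> W \<longrightarrow> z \<in> U)"
  shows "embedding_map T T' u"
  unfolding embedding_map_def
proof (rule bijective_open_imp_homeomorphic_map)
  have uT: "u ` topspace T \<subseteq> topspace T'"
    using continuous_map_image_subset_topspace[OF cont] .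
  show "continuous_map T (subtopology T' (u ` topspace T)) u"
    using cont by (simp add: continuous_map_in_subtopology)
  show "u ` topspace T = topspace (subtopology T' (u ` topspace T))"
    using uT by auto
  show "open_map T (subtopology T' (u ` topspace T)) u"
    unfolding open_map_def
  proof (intro allI impI)
    fix U assume U: "openin T U"
    \<comment> \<open>The union of all suitable sets avoids choosing one for each point.\<close>
    define W where "W = \<Union>{W. openin T' W \<and> (\<forall>z\<in>topspace T. u z \<in> W \<longrightarrow> z \<in> U)}"
    have "openin T' W"
      unfolding W_def by (rule openin_Union) blast
    moreover have "u ` U = W \<inter> u ` topspace T"
    proof (intro equalityI subsetI)
      fix y assume "y \<in> u ` U"
      then obtain p where p: "p \<in> U" "y = u p"
        by blast
      then have "y \<in> W"
        using nbhd[OF U p(1)] unfolding W_def by blast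
      moreover have "p \<in> topspace T"
        using openin_subset[OF U] p(1) by blast
      ultimately show "y \<in> W \<inter> u ` topspace T"
        using p(2) by blast
    qed (auto simp: W_def)
    ultimately show "openin (subtopology T' (u ` topspace T)) (u ` U)"
      unfolding openin_subtopology by blast
  qed
qed (rule inj)

text \<open>A point of \<open>\<real>\<^sup>N \<times> \<real>\<^sup>m\<close>, the second factor scaled by \<open>e\<close>, as a point of \<open>\<real>\<^sup>N\<^sup>+\<^sup>n\<close> for \<open>m \<le> n\<close>.\<close>

definition join_vec :: "nat \<Rightarrow> nat \<Rightarrow> real \<Rightarrow> (nat \<Rightarrow> real) \<Rightarrow> (nat \<Rightarrow> real) \<Rightarrow> nat \<Rightarrow> real" where
  "join_vec N m e y x = (\<lambda>i. if i < N then y i else if i < N + m then e * x (i - N) else 0)"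

definition snd_vec :: "nat \<Rightarrow> nat \<Rightarrow> real \<Rightarrow> (nat \<Rightarrow> real) \<Rightarrow> nat \<Rightarrow> real" where
  "snd_vec N m e w = (\<lambda>j. if j < m then w (N + j) / e else 0)"

lemma join_vec_in: "m \<le> n \<Longrightarrow> join_vec N m e y x \<in> eucl (N + n)"
  by (auto simp: join_vec_def in_eucl)

lemma snd_vec_in: "snd_vec N m e w \<in> eucl m"
  by (auto simp: snd_vec_def in_eucl)

lemma snd_join_vec: "e \<noteq> 0 \<Longrightarrow> x \<in> eucl m \<Longrightarrow> snd_vec N m e (join_vec N m e y x) = x"
  by (auto simp: snd_vec_def join_vec_def in_eucl fun_eq_iff)

text \<open>The identity on the first N and the last n - m coordinates, and \<open>R\<close>
  conjugated by the scaling with \<open>e\<close> in between; conjugation keeps it an isometry even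
  when \<open>R\<close> has a translation part. The restriction to \<open>eucl (N + n)\<close> makes
  it extensional, as membership in \<open>Bij\<close> demands.\<close>

definition block_isometry :: "nat \<Rightarrow> nat \<Rightarrow> nat \<Rightarrow> real \<Rightarrow> ((nat \<Rightarrow> real) \<Rightarrow> nat \<Rightarrow> real) \<Rightarrow> (nat \<Rightarrow> real) \<Rightarrow> nat \<Rightarrow> real" where
  "block_isometry N n m e R = (\<lambda>w\<in>eucl (N + n). \<lambda>i.
     if N \<le> i \<and> i < N + m then e * R (snd_vec N m e w) (i - N) else w i)"

lemma block_isometry_in:
  assumes "m \<le> n" and "w \<in> eucl (N + n)"
  shows "block_isometry N n m e R w \<in> eucl (N + n)"
  using assms by (auto simp: block_isometry_def in_eucl)

lemma snd_block_isometry: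
  assumes "e \<noteq> 0" and "w \<in> eucl (N + n)" and "R (snd_vec N m e w) \<in> eucl m"
  shows "snd_vec N m e (block_isometry N n m e R w) = R (snd_vec N m e w)"
proof
  fix j
  show "snd_vec N m e (block_isometry N n m e R w) j = R (snd_vec N m e w) j"
  proof (cases "j < m")
    case True
    then have "block_isometry N n m e R w (N + j) = e * R (snd_vec N m e w) j"
      using assms(2) by (simp add: block_isometry_def)
    moreover have "snd_vec N m e v j = v (N + j) / e" for v
      using True by (simp add: snd_vec_def)
    ultimately show ?thesis
      using assms(1) by simp
  next
    case False
    then show ?thesis
      using assms(3) by (simp add: snd_vec_def[of N m e "block_isometry N n m e R w"] in_eucl)
  qed
qed

lemma block_isometry_dist:
  assumes R: "R \<in> euclidean_isometries m" and "e \<noteq> 0" and "m \<le> n"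
    and w: "w \<in> eucl (N + n)" "w' \<in> eucl (N + n)"
  shows "euclidean_dist (N + n) (block_isometry N n m e R w) (block_isometry N n m e R w') = euclidean_dist (N + n) w w'"
proof -
  let ?B = "block_isometry N n m e R"
  let ?s = "snd_vec N m e"
  have "euclidean_dist m (R (?s w)) (R (?s w')) = euclidean_dist m (?s w) (?s w')"
    by (rule euclidean_isometriesD(3)[OF R snd_vec_in snd_vec_in])
  then have 1: "(\<Sum>j<m. (R (?s w) j - R (?s w') j)\<^sup>2) = (\<Sum>j<m. (?s w j - ?s w' j)\<^sup>2)"
    by (simp add: euclidean_dist_def L2_set_def)
  have "(\<Sum>j<m. (?B w (N + j) - ?B w' (N + j))\<^sup>2) = (\<Sum>j<m. e\<^sup>2 * (R (?s w) j - R (?s w') j)\<^sup>2)"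
    using w by (intro sum.cong refl) (simp add: block_isometry_def power2_eq_square algebra_simps)
  also have "\<dots> = e\<^sup>2 * (\<Sum>j<m. (?s w j - ?s w' j)\<^sup>2)"
    by (simp only: sum_distrib_left[symmetric] 1)
  also have "\<dots> = (\<Sum>j<m. (w (N + j) - w' (N + j))\<^sup>2)"
    unfolding sum_distrib_left using assms(2)
    by (intro sum.cong refl) (simp add: snd_vec_def diff_divide_distrib[symmetric] power_divide)
  finally have "(\<Sum>j<m. (?B w (N + j) - ?B w' (N + j))\<^sup>2) = (\<Sum>j<m. (w (N + j) - w' (N + j))\<^sup>2)" .
  moreover have "(\<Sum>i<N. (?B w i - ?B w' i)\<^sup>2) = (\<Sum>i<N. (w i - w' i)\<^sup>2)"
    using w by (intro sum.cong refl) (simp add: block_isometry_def)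
  moreover have "(\<Sum>j<n - m. (?B w (N + (m + j)) - ?B w' (N + (m + j)))\<^sup>2) =
      (\<Sum>j<n - m. (w (N + (m + j)) - w' (N + (m + j)))\<^sup>2)"
    using w by (intro sum.cong refl) (simp add: block_isometry_def)
  ultimately show ?thesis
    unfolding euclidean_dist_def L2_set_def sum_lessThan_split3[OF assms(3)] by simp
qed

section \<open>The action on the target space\<close>

context euclidean_group_pair
begin

lemma block_isometry_compose:
  assumes g: "\<gamma> \<in> carrier G" "\<delta> \<in> carrier G" and e: "e \<noteq> 0" and mn: "m \<le> n'" and w: "w \<in> eucl (N + n')"
  shows "block_isometry N n' m e (\<rho> (\<gamma> \<otimes> \<delta>)) w =
    block_isometry N n' m e (\<rho> \<gamma>) (block_isometry N n' m e (\<rho> \<delta>) w)"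
proof -
  define w' where "w' = block_isometry N n' m e (\<rho> \<delta>) w"
  have w': "w' \<in> eucl (N + n')"
    unfolding w'_def by (rule block_isometry_in[OF mn w])
  have "snd_vec N m e w' = \<rho> \<delta> (snd_vec N m e w)"
    unfolding w'_def by (rule snd_block_isometry[where R = "\<rho> \<delta>", OF e w]) (rule rho_in[OF g(2) snd_vec_in])
  then have R: "block_isometry N n' m e (\<rho> \<gamma>) w' =
      (\<lambda>i. if N \<le> i \<and> i < N + m then e * \<rho> \<gamma> (\<rho> \<delta> (snd_vec N m e w)) (i - N) else w' i)"
    using w' by (simp add: block_isometry_def cong: if_cong)
  have L: "block_isometry N n' m e (\<rho> (\<gamma> \<otimes> \<delta>)) w =
      (\<lambda>i. if N \<le> i \<and> i < N + m then e * \<rho> \<gamma> (\<rho> \<delta> (snd_vec N m e w)) (i - N) else w i)"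
    using w R.composition_rule[OF snd_vec_in g] by (simp add: block_isometry_def cong: if_cong)
  have "w' i = w i" if "\<not> (N \<le> i \<and> i < N + m)" for i
    using w that by (auto simp: w'_def block_isometry_def)
  then show ?thesis
    unfolding w'_def[symmetric] L R by (auto simp: fun_eq_iff)
qed

lemma block_isometry_one:
  assumes e: "e \<noteq> 0" and w: "w \<in> eucl (N + n')"
  shows "block_isometry N n' m e (\<rho> \<one>) w = w"
proof -
  have "\<rho> \<one> (snd_vec N m e w) = snd_vec N m e w"
    using R.id_eq_one snd_vec_in by (metis restrict_apply')
  then show ?thesis
    using w e by (auto simp: block_isometry_def fun_eq_iff snd_vec_def)
qed

text \<open>The map of the inverse group element is a two-sided inverse, which settles
  bijectivity.\<close>

lemma block_isometry_hom:
  assumes e: "e \<noteq> 0" and mn: "m \<le> n'"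
  shows "(\<lambda>\<gamma>. block_isometry N n' m e (\<rho> \<gamma>)) \<in> hom G (isom_group (N + n'))"
proof -
  let ?B = "\<lambda>\<gamma>. block_isometry N n' m e (\<rho> \<gamma>)"
  let ?E = "eucl (N + n')"
  have inv1: "?B (inv \<gamma>) (?B \<gamma> w) = w" if "\<gamma> \<in> carrier G" "w \<in> ?E" for \<gamma> w
    using block_isometry_compose[OF _ _ e mn that(2), of "inv \<gamma>" \<gamma>] block_isometry_one[OF e that(2)] that(1) by simp
  have inv2: "?B \<gamma> (?B (inv \<gamma>) w) = w" if "\<gamma> \<in> carrier G" "w \<in> ?E" for \<gamma> w
    using block_isometry_compose[OF _ _ e mn that(2), of \<gamma> "inv \<gamma>"] block_isometry_one[OF e that(2)] that(1) by simp
  have bij: "?B \<gamma> \<in> Bij ?E" if \<gamma>: "\<gamma> \<in> carrier G" for \<gamma>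
  proof -
    have "bij_betw (?B \<gamma>) ?E ?E"
      using inv1[OF \<gamma>] inv2[OF \<gamma>] block_isometry_in[OF mn]
      by (intro bij_betw_byWitness[where f' = "?B (inv \<gamma>)"]) auto
    then show ?thesis
      by (simp add: Bij_def block_isometry_def)
  qed
  show ?thesis
  proof (rule homI)
    show "?B \<gamma> \<in> carrier (isom_group (N + n'))" if "\<gamma> \<in> carrier G" for \<gamma>
      using bij[OF that] block_isometry_dist[OF rho_isom[OF that] e mn]
      by (simp add: isom_group_def euclidean_isometries_def)
    show "?B (\<gamma> \<otimes> \<delta>) = ?B \<gamma> \<otimes>\<^bsub>isom_group (N + n')\<^esub> ?B \<delta>" if g: "\<gamma> \<in> carrier G" "\<delta> \<in> carrier G" for \<gamma> \<delta>
    proof -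
      have "?B \<gamma> \<otimes>\<^bsub>isom_group (N + n')\<^esub> ?B \<delta> = compose ?E (?B \<gamma>) (?B \<delta>)"
        using bij g by (simp add: isom_group_def BijGroup_def)
      also have "\<dots> = ?B (\<gamma> \<otimes> \<delta>)"
      proof (rule extensionalityI[of _ ?E])
        show "?B (\<gamma> \<otimes> \<delta>) \<in> extensional ?E"
          by (simp add: block_isometry_def)
        show "compose ?E (?B \<gamma>) (?B \<delta>) w = ?B (\<gamma> \<otimes> \<delta>) w" if "w \<in> ?E" for w
          using block_isometry_compose[OF g e mn that] that by (simp add: compose_eq)
      qed simp
      finally show ?thesis
        by simp
    qed
  qed
qed

lemma block_isometry_join_vec:
  assumes "\<gamma> \<in> carrier G" and e: "e \<noteq> 0" and mn: "m \<le> n'" and x: "x \<in> eucl m"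
  shows "block_isometry N n' m e (\<rho> \<gamma>) (join_vec N m e y x) = join_vec N m e y (\<rho> \<gamma> x)"
proof -
  have "block_isometry N n' m e (\<rho> \<gamma>) (join_vec N m e y x) =
      (\<lambda>i. if N \<le> i \<and> i < N + m then e * \<rho> \<gamma> x (i - N) else join_vec N m e y x i)"
    using join_vec_in[OF mn, of N e y x] snd_join_vec[OF e x, of N y] by (simp add: block_isometry_def cong: if_cong)
  then show ?thesis
    by (auto simp: join_vec_def fun_eq_iff)
qed

end

section \<open>The embedding\<close>

context metric_group_pair
begin

text \<open>The induced metric of \<open>u\<close> is a sum over its blocks: \<open>shrunk e\<close>
  from \<open>fN \<circ> q\<close>, \<open>e\<^sup>2\<close> times the Gram tensor of
  \<open>F\<close>, and 0 from the padding, which makes \<open>g\<close>. The first block determines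
  the orbit of a point and the second its position in the orbit.\<close>

lemma ex_equivariant_isometric_embedding:
  assumes e: "e > 0" and mn: "m \<le> n"
    and emb: "isometric_embedding X (quotient_metric e) N fN"
  shows "\<exists>u. isometric_embedding M g (N + n) u \<and> equivariant G (mpoints M) \<phi> (N + n) u"
proof -
  have fN: "smooth_map X (euclidean_manifold N) fN" and fN_emb: "embedding_map (mtop X) (Euclidean_space N) fN"
    and fN_pb: "pulls_back_to X (quotient_metric e) (euclidean_manifold N) flat_metric fN"
    using emb by (auto simp: isometric_embedding_def smooth_embedding_def immersion_def)
  have fN_in: "fN \<in> mpoints X \<rightarrow> eucl N"
    using smooth_map_in[OF fN] by simp
  have fN_inj: "inj_on fN (mpoints X)"
    using fN_emb by (simp add: embedding_map_def homeomorphic_imp_injective_map)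
  define u1 where "u1 = fN \<circ> q"
  have u1_in: "u1 p \<in> eucl N" if "p \<in> mpoints M" for p
    using fN_in that by (auto simp: u1_def mpoints_quotient)
  have u1_smooth: "smooth_real M (\<lambda>p. u1 p k)" if k: "k < N" for k
    unfolding smooth_real_def
  proof
    fix c assume c: "c \<in> atlas M"
    show "smooth_fun_on (mdim M) (snd c ` fst c) (\<lambda>x. u1 (chart_inv c x) k)"
    proof (rule smooth_fun_on_local[OF chart_image_subset[OF M c]])
      fix x assume "x \<in> snd c ` fst c"
      then obtain p where p: "p \<in> fst c" "x = snd c p"
        by blast
      have pM: "p \<in> mpoints M"
        using p(1) chart_dom_subset[OF M c] by blast
      \<comment> \<open>On a sheet \<open>V\<close> the charts \<open>c\<close> and
        \<open>qchart c V\<close> have the same coordinates, in which \<open>u1\<close> and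
        \<open>fN\<close> become the same function.\<close>
      obtain V where V: "openin (mtop M) V" "p \<in> V" "V \<subseteq> fst c" "inj_on q V"
        using small_neighbourhood[OF pM chart_dom_open[OF M c] p(1)] by metis
      have cV: "charted c V"
        using c V by (simp add: charted_def)
      have dom: "local_dom (qchart c V) (eucl_chart N) fN = snd c ` V"
      proof -
        have "{y \<in> fst (qchart c V). fN y \<in> fst (eucl_chart N)} = fst (qchart c V)"
          using u1_in charted_subset[OF cV] by (auto simp: fst_qchart u1_def)
        then show ?thesis
          unfolding local_dom_def by (simp only: qchart_image[OF cV])
      qed
      have "qchart c V \<in> atlas X"
        using cV unfolding quotient_simps by blast
      then have "smooth_fun_on (mdim X) (local_dom (qchart c V) (eucl_chart N) fN)
          (\<lambda>x. local_rep (qchart c V) (eucl_chart N) fN x k)"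
        using k by (intro smooth_map_local_rep[OF fN]) auto
      then have "smooth_fun_on (mdim M) (snd c ` V) (\<lambda>x. fN (chart_inv (qchart c V) x) k)"
        by (simp add: dom quotient_simps local_rep_def)
      moreover have "fN (chart_inv (qchart c V) x) k = u1 (chart_inv c x) k" if "x \<in> snd c ` V" for x
        by (simp add: qchart_inv'[OF cV that] u1_def)
      ultimately have "smooth_fun_on (mdim M) (snd c ` V) (\<lambda>x. u1 (chart_inv c x) k)"
        using smooth_fun_on_cong[OF qchart_image_open[OF cV], of "\<lambda>x. fN (chart_inv (qchart c V) x) k"] by simp
      then have "smooth_fun_on (mdim M) (snd c ` fst c \<inter> snd c ` V) (\<lambda>x. u1 (chart_inv c x) k)"
        by (rule smooth_fun_on_subset) simp
      then show "\<exists>V. openin (Euclidean_space (mdim M)) V \<and> x \<in> V \<and>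
          smooth_fun_on (mdim M) (snd c ` fst c \<inter> V) (\<lambda>x. u1 (chart_inv c x) k)"
        using qchart_image_open[OF cV] p(2) V(2) by blast
    qed
  qed
  have u1_gram: "gram N u1 c p i j = shrunk e c p i j"
    if c: "c \<in> atlas M" and p: "p \<in> fst c" and ij: "i < mdim M" "j < mdim M" for c p i j
  proof -
    have pM: "p \<in> mpoints M"
      using p chart_dom_subset[OF M c] by blast
    obtain V where V: "openin (mtop M) V" "p \<in> V" "V \<subseteq> fst c" "inj_on q V"
      using small_neighbourhood[OF pM chart_dom_open[OF M c] p] by metis
    have cV: "charted c V"
      using c V by (simp add: charted_def)
    have atlas: "qchart c V \<in> atlas X" "q p \<in> fst (qchart c V)"
      using cV V(2) unfolding quotient_simps fst_qchart by blast+
    have X_charts: "fst d \<subseteq> mpoints X" if d: "d \<in> atlas X" for d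
    proof -
      obtain c V where "charted c V" "d = qchart c V"
        using d unfolding quotient_simps by blast
      then show ?thesis
        using image_mono[OF charted_subset] by (simp add: fst_qchart mpoints_quotient)
    qed
    have "\<forall>d\<in>atlas X. \<forall>y\<in>fst d. \<forall>i<mdim X. \<forall>j<mdim X. quotient_metric e d y i j = gram N fN d y i j"
      using fN_pb pulls_back_flat_iff[OF fN_in X_charts] by blast
    then have "quotient_metric e (qchart c V) (q p) i j = gram N fN (qchart c V) (q p) i j"
      using atlas ij by (simp only: quotient_simps(1))
    moreover have "coord_jacobian (qchart c V) (eucl_chart N) fN (q p) k l = coord_jacobian c (eucl_chart N) u1 p k l"
      if "l < mdim M" for k l
      unfolding coord_jacobian_euclidean qchart_apply[OF cV V(2)]
      by (rule partial_deriv_cong[OF qchart_image_open[OF cV] imageI[OF V(2)] that])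
        (simp add: qchart_inv'[OF cV] u1_def)
    ultimately show ?thesis
      using quotient_metric_eq[OF cV V(2) ij] ij by (simp add: gram_def)
  qed
  define u where "u p = join_vec N m e (u1 p) (F p)" for p
  have u_smooth: "smooth_map M (euclidean_manifold (N + n)) u"
    unfolding smooth_map_euclidean_iff[OF M]
  proof (intro conjI allI impI)
    show "u \<in> mpoints M \<rightarrow> eucl (N + n)"
      using join_vec_in[OF mn] by (simp add: u_def)
    fix k
    consider "k < N" | "N \<le> k" "k < N + m" | "N + m \<le> k"
      by linarith
    then show "smooth_real M (\<lambda>p. u p k)"
    proof cases
      case 1
      then show ?thesis
        using u1_smooth[OF 1] by (simp add: u_def join_vec_def)
    next
      case 2
      then have "smooth_real M (\<lambda>p. F p (k - N))"
        using F unfolding smooth_map_euclidean_iff[OF M] by auto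
      then show ?thesis
        using 2 smooth_real_mult[OF M smooth_real_const[OF M, of e]] by (simp add: u_def join_vec_def)
    next
      case 3
      then show ?thesis
        using smooth_real_const[OF M, of 0] by (simp add: u_def join_vec_def)
    qed
  qed
  have u_gram: "g c p i j = gram (N + n) u c p i j"
    if c: "c \<in> atlas M" and p: "p \<in> fst c" and ij: "i < mdim M" "j < mdim M" for c p i j
  proof -
    let ?J = "\<lambda>k i. coord_jacobian c (eucl_chart (N + n)) u p k i"
    have J1: "?J k l = coord_jacobian c (eucl_chart N) u1 p k l" if "k < N" for k l
      using that by (simp add: coord_jacobian_euclidean u_def join_vec_def)
    have J2: "?J (N + k) l = e * coord_jacobian c (eucl_chart m) F p k l" if k: "k < m" and l: "l < mdim M" for k l
    proof -
      have "smooth_fun_on (mdim M) (snd c ` fst c) (\<lambda>x. F (chart_inv c x) k)"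
        using F k c unfolding smooth_map_euclidean_iff[OF M] smooth_real_def by blast
      then have "((\<lambda>t. F (chart_inv c ((snd c p)(l := t))) k) has_real_derivative
          partial_deriv l (\<lambda>x. F (chart_inv c x) k) (snd c p)) (at (snd c p l))"
        using p by (intro Ck_on_partial_deriv[OF smooth_fun_onD _ l]) auto
      from DERIV_imp_deriv[OF DERIV_cmult[OF this, of e]] show ?thesis
        using k by (simp add: coord_jacobian_euclidean u_def join_vec_def partial_deriv_def)
    qed
    have J3: "?J (N + (m + k)) l = 0" for k l
      by (simp add: coord_jacobian_euclidean u_def join_vec_def partial_deriv_def)
    have "gram (N + n) u c p i j = gram N u1 c p i j + e\<^sup>2 * gram m F c p i j"
      unfolding gram_def sum_lessThan_split3[OF mn] using ij
      by (simp add: J1 J2 J3 sum_distrib_left power2_eq_square mult_ac)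
    then show ?thesis
      using u1_gram[OF c p ij] by (simp add: shrunk_def)
  qed
  have u_pb: "pulls_back_to M g (euclidean_manifold (N + n)) flat_metric u"
  proof -
    have "u \<in> mpoints M \<rightarrow> eucl (N + n)"
      using join_vec_in[OF mn] by (simp add: u_def)
    then show ?thesis
      using pulls_back_flat_iff[OF _ chart_dom_subset[OF M], of u "N + n" g] u_gram by blast
  qed
  have u_cont: "continuous_map (mtop M) (Euclidean_space (N + n)) u"
    by (rule smooth_map_euclidean_continuous[OF u_smooth])
  have snd_u: "snd_vec N m e (u p) = F p" if "p \<in> mpoints M" for p
    unfolding u_def using e F_in[OF that] by (intro snd_join_vec) auto
  define fst_vec where "fst_vec w = (\<lambda>i. if i < N then w i else 0 :: real)" for w :: "nat \<Rightarrow> real"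
  have fst_u: "fst_vec (u p) = u1 p" if "p \<in> mpoints M" for p
    using u1_in[OF that] by (auto simp: fst_vec_def u_def join_vec_def in_eucl fun_eq_iff)
  have id_cont: "continuous_map (Euclidean_space (N + n)) (Euclidean_space (N + n)) (\<lambda>w. w)"
    by (simp add: continuous_map_id[unfolded id_def])
  have fst_cont: "continuous_map (Euclidean_space (N + n)) (Euclidean_space N) fst_vec"
    unfolding fst_vec_def continuous_map_componentwise_Euclidean_space
    using continuous_map_eucl_coord[OF id_cont] by blast
  have snd_cont: "continuous_map (Euclidean_space (N + n)) (Euclidean_space m) (snd_vec N m e)"
    unfolding snd_vec_def continuous_map_componentwise_Euclidean_space using e
    by (intro allI impI continuous_map_real_divide continuous_map_eucl_coord[OF id_cont] continuous_map_const[THEN iffD2]) auto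
  have "embedding_map (mtop M) (Euclidean_space (N + n)) u"
  proof (rule embedding_mapI[OF u_cont])
    show "\<exists>W. openin (Euclidean_space (N + n)) W \<and> u p \<in> W \<and> (\<forall>z\<in>mpoints M. u z \<in> W \<longrightarrow> z \<in> U)"
      if U: "openin (mtop M) U" "p \<in> U" for p U
    proof -
      have pM: "p \<in> mpoints M"
        using openin_subset[OF U(1)] U(2) by blast
      obtain V \<delta> where V: "openin (mtop M) V" "p \<in> V" "V \<subseteq> U" and \<delta>: "\<delta> > 0"
        and sep: "\<And>\<gamma> z. \<gamma> \<in> carrier G \<Longrightarrow> z \<in> V \<Longrightarrow> euclidean_dist m (F (\<phi> \<gamma> z)) (F p) < \<delta> \<Longrightarrow> \<gamma> = \<one>"
        using small_neighbourhood[OF pM U] by metis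
      have VM: "V \<subseteq> mpoints M"
        using openin_subset[OF V(1)] .
      have "openin (mtop X) (q ` V)"
        unfolding quotient_simps by (rule orbit_map_open[OF act phi_continuous V(1)])
      then have "openin (subtopology (Euclidean_space N) (fN ` mpoints X)) (fN ` q ` V)"
        using fN_emb homeomorphic_imp_open_map unfolding embedding_map_def open_map_def by blast
      then obtain W1 where W1: "openin (Euclidean_space N) W1" "fN ` q ` V = W1 \<inter> fN ` mpoints X"
        unfolding openin_subtopology by blast
      \<comment> \<open>The condition on the first block places \<open>z\<close> in the orbit of a
        point of \<open>V\<close>; closeness of \<open>F z\<close> to \<open>F p\<close> then
        singles out the sheet \<open>V\<close> itself.\<close>
      define W where "W = {w \<in> eucl (N + n). fst_vec w \<in> W1} \<inter>
          {w \<in> eucl (N + n). snd_vec N m e w \<in> {x \<in> eucl m. euclidean_dist m x (F p) < \<delta>}}"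
      have W_open: "openin (Euclidean_space (N + n)) W"
        unfolding W_def
        by (intro openin_Int openin_continuous_map_preimage[OF fst_cont W1(1)]
            openin_continuous_map_preimage[OF snd_cont openin_euclidean_ball])
      have u_W: "u z \<in> W \<longleftrightarrow> u1 z \<in> W1 \<and> euclidean_dist m (F z) (F p) < \<delta>" if "z \<in> mpoints M" for z
      proof -
        have "u z \<in> eucl (N + n)"
          unfolding u_def by (rule join_vec_in[OF mn])
        then show ?thesis
          using F_in[OF that] by (simp add: W_def fst_u[OF that] snd_u[OF that])
      qed
      have u1_W1: "u1 z \<in> W1 \<longleftrightarrow> q z \<in> q ` V" if "z \<in> mpoints M" for z
      proof -
        have z: "q z \<in> mpoints X" and VX: "q ` V \<subseteq> mpoints X"
          using that VM by (auto simp: mpoints_quotient)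
        have "u1 z \<in> W1 \<longleftrightarrow> fN (q z) \<in> fN ` q ` V"
          unfolding W1(2) using z by (auto simp: u1_def)
        then show ?thesis
          using inj_on_image_mem_iff[OF fN_inj z VX] by simp
      qed
      have "u p \<in> W"
        using u_W[OF pM] u1_W1[OF pM] V(2) \<delta> by simp
      moreover have "z \<in> U" if z: "z \<in> mpoints M" and "u z \<in> W" for z
      proof -
        have zF: "euclidean_dist m (F z) (F p) < \<delta>" and "q z \<in> q ` V"
          using u_W[OF z] u1_W1[OF z] that(2) by auto
        then obtain v where v: "v \<in> V" "q v = q z"
          by (metis imageE)
        obtain \<gamma> where \<gamma>: "\<gamma> \<in> carrier G" "z = \<phi> \<gamma> v"
          using A.orbit_eqD[OF subsetD[OF VM v(1)] z v(2)] by blast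
        then have "\<gamma> = \<one>"
          using sep[OF \<gamma>(1) v(1)] zF by simp
        then have "z = v"
          using \<gamma>(2) A.id_eq_one subsetD[OF VM v(1)] by (metis restrict_apply')
        then show ?thesis
          using v(1) V(3) by blast
      qed
      ultimately show ?thesis
        using W_open by blast
    qed
    show "inj_on u (mpoints M)"
    proof (rule inj_onI)
      fix z z' assume z: "z \<in> mpoints M" "z' \<in> mpoints M" and eq: "u z = u z'"
      \<comment> \<open>Equal first blocks give \<open>z' = \<phi> \<gamma> z\<close>, equal second
        blocks make \<open>F z\<close> a fixed point of \<open>\<rho> \<gamma>\<close>, and \<rho>
        acts freely.\<close>
      have "fN (q z) = fN (q z')"
        using fst_u[OF z(1)] fst_u[OF z(2)] eq by (simp add: u1_def)
      then have "q z = q z'"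
        by (rule inj_onD[OF fN_inj]) (use z in \<open>simp_all add: mpoints_quotient\<close>)
      then obtain \<gamma> where \<gamma>: "\<gamma> \<in> carrier G" "z' = \<phi> \<gamma> z"
        using A.orbit_eqD[OF z] by blast
      have "F z' = F z"
        using snd_u[OF z(1)] snd_u[OF z(2)] eq by simp
      then have "\<gamma> = \<one>"
        using rho_free[OF \<gamma>(1) F_in[OF z(1)]] F_equi[OF \<gamma>(1) z(1)] \<gamma>(2) by simp
      then show "z = z'"
        using \<gamma>(2) A.id_eq_one z(1) by (metis restrict_apply')
    qed
  qed
  then have "isometric_embedding M g (N + n) u"
    using u_pb pulls_back_immersion[OF metric u_smooth u_pb]
    by (simp add: isometric_embedding_def smooth_embedding_def)
  moreover have "equivariant G (mpoints M) \<phi> (N + n) u"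
    unfolding equivariant_def
  proof (rule bexI)
    have e0: "e \<noteq> 0"
      using e by simp
    show "(\<lambda>\<gamma>. block_isometry N n m e (\<rho> \<gamma>)) \<in> hom G (isom_group (N + n))"
      by (rule block_isometry_hom[OF e0 mn])
    show "\<forall>\<gamma>\<in>carrier G. \<forall>x\<in>mpoints M. u (\<phi> \<gamma> x) = block_isometry N n m e (\<rho> \<gamma>) (u x)"
    proof (intro ballI)
      fix \<gamma> x assume \<gamma>: "\<gamma> \<in> carrier G" and x: "x \<in> mpoints M"
      have "u1 (\<phi> \<gamma> x) = u1 x"
        by (simp add: u1_def q_image[OF \<gamma> x])
      then show "u (\<phi> \<gamma> x) = block_isometry N n m e (\<rho> \<gamma>) (u x)"
        unfolding u_def by (simp add: F_equi[OF \<gamma> x] block_isometry_join_vec[OF \<gamma> e0 mn F_in[OF x]])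
    qed
  qed
  ultimately show ?thesis
    by blast
qed

end

theorem theorem3:
  fixes M :: "'a manifold" and g :: "'a metric_tensor"
    and \<Gamma> :: "('g, 'm) monoid_scheme" and \<phi> :: "'g \<Rightarrow> 'a \<Rightarrow> 'a"
    and n N :: nat
  assumes "smooth_manifold M" and "riemannian_metric M g"
    and "diffeomorphic M (euclidean_manifold n)"
    and "bieberbach_group \<Gamma>"
    and "isometric_action \<Gamma> M g \<phi>"
    and "free_action \<Gamma> (mpoints M) \<phi>"
    and "properly_discontinuous_action \<Gamma> (mtop M) \<phi>"
    and "cocompact_action \<Gamma> (mtop M) \<phi>"
    and "is_nash_dimension (quotient_manifold M \<Gamma> \<phi>) N"
  shows "\<exists>u. isometric_embedding M g (N + n) u \<and> equivariant \<Gamma> (mpoints M) \<phi> (N + n) u"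
proof -
  obtain f f' where f: "smooth_map M (euclidean_manifold n) f" and f': "smooth_map (euclidean_manifold n) M f'"
    and f'_f: "\<And>p. p \<in> mpoints M \<Longrightarrow> f' (f p) = p" and f_f': "\<And>y. y \<in> eucl n \<Longrightarrow> f (f' y) = y"
    using assms(3) unfolding diffeomorphic_def diffeomorphism_def by auto
  obtain m \<rho> where \<rho>: "\<rho> \<in> hom \<Gamma> (isom_group m)"
    "\<And>\<gamma> x. \<gamma> \<in> carrier \<Gamma> \<Longrightarrow> x \<in> eucl m \<Longrightarrow> \<rho> \<gamma> x = x \<Longrightarrow> \<gamma> = \<one>\<^bsub>\<Gamma>\<^esub>"
    "\<And>r. finite {\<gamma> \<in> carrier \<Gamma>. euclidean_dist m (\<rho> \<gamma> origin) origin \<le> r}"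
    "\<exists>r. \<forall>x\<in>eucl m. \<exists>\<gamma>\<in>carrier \<Gamma>. euclidean_dist m (\<rho> \<gamma> x) origin < r"
  proof (rule bieberbach_group_action[OF assms(4)])
    fix m \<rho> assume *: "\<rho> \<in> hom \<Gamma> (isom_group m)"
      "\<And>\<gamma> x. \<gamma> \<in> carrier \<Gamma> \<Longrightarrow> x \<in> eucl m \<Longrightarrow> \<rho> \<gamma> x = x \<Longrightarrow> \<gamma> = \<one>\<^bsub>\<Gamma>\<^esub>"
      "\<And>r. finite {\<gamma> \<in> carrier \<Gamma>. euclidean_dist m (\<rho> \<gamma> origin) origin \<le> r}"
      "\<exists>r. \<forall>x\<in>eucl m. \<exists>\<gamma>\<in>carrier \<Gamma>. euclidean_dist m (\<rho> \<gamma> x) origin < r"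
    show thesis
      by (rule that) (fact *)+
  qed
  have act: "group_action \<Gamma> (mpoints M) \<phi>"
    and iso: "\<And>\<gamma>. \<gamma> \<in> carrier \<Gamma> \<Longrightarrow> riemannian_isometry M g M g (\<phi> \<gamma>)"
    using assms(5) by (auto simp: isometric_action_def)
  have smooth_act: "smooth_map M M (\<phi> \<gamma>)" and pb: "pulls_back_to M g M g (\<phi> \<gamma>)" if "\<gamma> \<in> carrier \<Gamma>" for \<gamma>
    using iso[OF that] by (auto simp: riemannian_isometry_def diffeomorphism_def)
  have f'_cont: "continuous_map (Euclidean_space n) (mtop M) f'"
    using smooth_map_continuous[OF f'] by simp
  have pair: "euclidean_group_pair M \<Gamma> \<phi> n f f' m \<rho>"
    by (intro euclidean_group_pair.intro assms(1,7,8) f f'_cont f'_f f_f' act smooth_act \<rho>)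
  interpret P: euclidean_group_pair M \<Gamma> \<phi> n f f' m \<rho>
    by (rule pair)
  obtain F where F: "smooth_map M (euclidean_manifold m) F"
    "\<And>\<gamma> p. \<gamma> \<in> carrier \<Gamma> \<Longrightarrow> p \<in> mpoints M \<Longrightarrow> F (\<phi> \<gamma> p) = \<rho> \<gamma> (F p)"
    using P.ex_equivariant_map by blast
  interpret Q: metric_group_pair M \<Gamma> \<phi> n f f' m \<rho> g F
    by unfold_locales (use assms(2) pb F in auto)
  obtain e where e: "e > 0" "\<And>c p. c \<in> atlas M \<Longrightarrow> p \<in> fst c \<Longrightarrow> Q.shrunk_positive e c p"
    using Q.ex_shrunk_positive by blast
  have "riemannian_metric (quotient_manifold M \<Gamma> \<phi>) (Q.quotient_metric e)"
    by (rule Q.quotient_metric_riemannian[OF e(2)])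
  \<comment> \<open>Here \<open>N\<close> enters: the shrunk metric on the quotient is one of those
    that the Nash dimension has to accommodate.\<close>
  then obtain fN where "isometric_embedding (quotient_manifold M \<Gamma> \<phi>) (Q.quotient_metric e) N fN"
    using assms(9) unfolding is_nash_dimension_def isometrically_embeds_def by blast
  then show ?thesis
    by (rule Q.ex_equivariant_isometric_embedding[OF e(1) P.dimension_le])
qed

end
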